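(* Let $Q\subseteq M$ be a compact convex set with nonempty interior $Q^\circ$, let $\ell:Q\to\mathbb{R}$ be a nonconstant affine function with minimum value $\ell^*$ over $Q$, let $F:Q^\circ\to\mathbb{R}$ be a $\nu$-self-concordant barrier of $Q$ ($\nu>0$), and for $t\ge0$ let $f_t:=t\ell+F$ on $Q^\circ$. Let $\beta$ satisfy $0<\beta<\frac{\sqrt\beta}{1+\sqrt\beta}$ and put $\alpha:=\frac{\sqrt\beta}{1+\sqrt\beta}-\beta>0$. For $x\in Q^\circ$ and $t\ge 0$ define $$t^+:=t+\frac{\alpha}{\|D\ell_x\|^*_{F,x}},\qquad x^+:=\exp_x\overline{u},$$ where $\overline{u}\in T_x$ is the Newton direction of $f_{t^+}$ at $x$. Suppose that $\|(Df_t)_x\|^*_{F,x}\le\beta$. Then: (1) $x^+\in Q^\circ$ and $\|(Df_{t^+})_{x^+}\|^*_{F,x^+}\le\beta$. If in addition $t>0$, then: (2) $\|D\ell_x\|^*_{F,x}\le\frac1t(\beta+\sqrt\nu)$, and hence $t^+\ge\left(1+\frac{\alpha}{\beta+\sqrt\nu}\right)t$. (3) $\ell(x)-\ell^*\le\frac1t\left(\nu+\frac{(\beta+\sqrt\nu)\beta}{1-\beta}\right)$. Consequently, given $\epsilon>0$ and a starting point $x_0\in Q^\circ$ with $\|DF_{x_0}\|^*_{F,x_0}\le\beta$, the path-following method (start from $(x,t)=(x_0,0)$ and repeat $(x,t)\leftarrow(x^+,t^+)$) produces a point $x\in Q^\circ$ with $\ell(x)-\ell^*\le\epsilon$ in $O\big(\sqrt\nu\,\log(\nu\|D\ell_{x_0}\|^*_{F,x_0}/\epsilon)\big)$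 iterations; i.e. there is a constant $c$ depending only on $\beta$ such that at most $c\sqrt\nu\,\max\{1,\log(\nu\|D\ell_{x_0}\|^*_{F,x_0}/\epsilon)\}$ iterations suffice.
   Context: Setting. $M$ is a smooth finite-dimensional manifold with an affine connection $\nabla$ that is torsion-free and such that for every $x\in M$ the exponential map $\exp_x$ is defined on all of $T_x=T_xM$ and maps onto $M$. Functions are assumed sufficiently smooth. Geodesics are those of $\nabla$ (affinely parametrized). A set $C\subseteq M$ is convex if every geodesic $\gamma:[a,b]\to M$ with $\gamma(a),\gamma(b)\in C$ satisfies $\gamma(t)\in C$ for all $t\in[a,b]$. A function $f:C\to\mathbb{R}$ on an open convex set is convex if $f\circ\gamma$ is convex for every geodesic $\gamma$ in $C$. $Df$ is the differential of $f$ and $Hf$ is the Hessian, $Hf(X,Y)=X(Df(Y))-Df(\nabla_XY)$, a symmetric $(0,2)$-tensor field; $\nabla_vHf$ is its covariant derivative. $f$ is nondegenerate if $Hf_x$ is positive definite for all $x\in C$, and closed if $\{(x,y)\in C\times\mathbb{R}: y\ge f(x)\}$ is closed (in $M\times\mathbb{R}$). A closed nondegenerate convex $f:C\to\mathbb{R}$ is $\sigma$-self-concordant ($\sigma$-SC), $\sigma\ge0$, if $|(\nabla_vHf)(u,u)|\le 2\sigma\,Hf(v,v)^{1/2}Hf(u,u)$ for all $x\in C$, $u,v\in T_x$. For $\nu>0$, a $\nu$-self-concordant barrier of (the closure of) an open convex set $C$ is a $1$-SC function $F:C\to\mathbb{R}$ with $DF_x(u)^2\le\nu HF_x(u,u)$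 for all $x\in C$, $u\in T_x$. In particular, saying that $F:Q^\circ\to\mathbb{R}$ is a barrier of $Q$ includes that $Q^\circ$ is an open convex set with closure $Q$. Affine function: $\ell$ is affine along every geodesic, i.e. $(\ell\circ\gamma)''=0$ for all geodesics $\gamma$; it is taken continuous on $Q$ and smooth on $Q^\circ$ (nonconstancy then gives $D\ell_x\ne0$ for all $x\in Q^\circ$). Dual local norm: for $p\in T_x^*$, $\|p\|^*_{F,x}:=\sqrt{p(HF_x^{-1}p)}$, where $HF_x$ is viewed as an isomorphism $T_x\to T_x^*$. The Newton direction of $f_{t^+}$ at $x$ is the $\overline{u}\in T_x$ with $(Df_{t^+})_x(\cdot)+(Hf_{t^+})_x(\overline{u},\cdot)=0$. *)

theory Defs
  imports "HOL-Analysis.Analysis"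
begin

section \<open>\<open>C\<^sup>k\<close> maps between Euclidean spaces\<close>

text \<open>Only used for open \<open>S\<close>, where it is the usual notion: all iterated directional
  derivatives up to order \<open>k\<close> exist and are continuous.\<close>

primrec Ck_on :: "nat \<Rightarrow> 'a::euclidean_space set \<Rightarrow> ('a \<Rightarrow> 'b::real_normed_vector) \<Rightarrow> bool" where
  "Ck_on 0 S f \<longleftrightarrow> continuous_on S f"
| "Ck_on (Suc k) S f \<longleftrightarrow> (\<forall>x\<in>S. f differentiable (at x)) \<and>
     (\<forall>v. Ck_on k S (\<lambda>x. frechet_derivative f (at x) v))"

definition smooth_map_on :: "'a::euclidean_space set \<Rightarrow> ('a \<Rightarrow> 'b::real_normed_vector) \<Rightarrow> bool" where
  "smooth_map_on S f \<longleftrightarrow> (\<forall>k. Ck_on k S f)"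


section \<open>Manifolds and tangent vectors\<close>

text \<open>The underlying topological space is the type \<open>'m\<close> (Hausdorff and second countable),
  the model space is \<open>'e\<close>, and a chart is a pair of its domain and its coordinate map.
  A tangent vector is the family of its representatives in the charts of the atlas that are
  defined at its base point; charts not defined there get the value \<open>0\<close>.\<close>

type_synonym ('m, 'e) chart = "'m set \<times> ('m \<Rightarrow> 'e)"

type_synonym ('m, 'e) tangent = "('m, 'e) chart \<Rightarrow> 'e"

text \<open>\<open>nabla M x u Y\<close> is the covariant derivative at \<open>x\<close> of the vector field \<open>Y\<close> (which only
  matters near \<open>x\<close>) in the direction of \<open>u \<in> T\<^sub>x\<close>.\<close>

record ('m, 'e) affine_manifold =
  atlas :: "('m, 'e) chart set"
  nabla :: "'m \<Rightarrow> ('m, 'e) tangent \<Rightarrow> ('m \<Rightarrow> ('m, 'e) tangent) \<Rightarrow> ('m, 'e) tangent"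

abbreviation dom_of :: "('m, 'e) chart \<Rightarrow> 'm set" where
  "dom_of c \<equiv> fst c"

abbreviation coord :: "('m, 'e) chart \<Rightarrow> 'm \<Rightarrow> 'e" where
  "coord c \<equiv> snd c"

abbreviation coord_inv :: "('m, 'e) chart \<Rightarrow> 'e \<Rightarrow> 'm" where
  "coord_inv c \<equiv> inv_into (dom_of c) (coord c)"

definition smooth_manifold ::
  "('m::{t2_space,second_countable_topology}, 'e::euclidean_space) affine_manifold \<Rightarrow> bool" where
  "smooth_manifold M \<longleftrightarrow>
     (\<forall>c\<in>atlas M. open (dom_of c) \<and> open (coord c ` dom_of c) \<and>
        homeomorphism (dom_of c) (coord c ` dom_of c) (coord c) (coord_inv c)) \<and>
     (\<Union>c\<in>atlas M. dom_of c) = UNIV \<and>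
     (\<forall>c\<in>atlas M. \<forall>d\<in>atlas M.
        smooth_map_on (coord c ` (dom_of c \<inter> dom_of d)) (coord d \<circ> coord_inv c))"

definition charts_at :: "('m, 'e) affine_manifold \<Rightarrow> 'm \<Rightarrow> ('m, 'e) chart set" where
  "charts_at M x = {c \<in> atlas M. x \<in> dom_of c}"

definition chart_at :: "('m, 'e) affine_manifold \<Rightarrow> 'm \<Rightarrow> ('m, 'e) chart" where
  "chart_at M x = (SOME c. c \<in> charts_at M x)"

text \<open>Derivative at \<open>x\<close> of the transition map from \<open>c\<close> to \<open>d\<close>.\<close>

definition trans_deriv ::
  "('m, 'e::euclidean_space) chart \<Rightarrow> ('m, 'e) chart \<Rightarrow> 'm \<Rightarrow> 'e \<Rightarrow> 'e" where
  "trans_deriv c d x = frechet_derivative (coord d \<circ> coord_inv c) (at (coord c x))"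

definition tangent_space ::
  "('m, 'e::euclidean_space) affine_manifold \<Rightarrow> 'm \<Rightarrow> ('m, 'e) tangent set" where
  "tangent_space M x =
     {v. (\<forall>c\<in>charts_at M x. \<forall>d\<in>charts_at M x. v d = trans_deriv c d x (v c)) \<and>
         (\<forall>c. c \<notin> charts_at M x \<longrightarrow> v c = 0)}"

text \<open>The vector field on the domain of \<open>c\<close> whose representative in \<open>c\<close> is the constant \<open>w\<close>.\<close>

definition coord_field ::
  "('m, 'e::euclidean_space) affine_manifold \<Rightarrow> ('m, 'e) chart \<Rightarrow> 'e \<Rightarrow> 'm \<Rightarrow> ('m, 'e) tangent" where
  "coord_field M c w y = (\<lambda>d. if d \<in> charts_at M y then trans_deriv c d y w else 0)"

definition Ck_fun_on ::
  "('m, 'e::euclidean_space) affine_manifold \<Rightarrow> nat \<Rightarrow> 'm set \<Rightarrow> ('m \<Rightarrow> real) \<Rightarrow> bool" where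
  "Ck_fun_on M k U f \<longleftrightarrow> (\<forall>c\<in>atlas M. Ck_on k (coord c ` (U \<inter> dom_of c)) (f \<circ> coord_inv c))"

definition smooth_fun_on ::
  "('m, 'e::euclidean_space) affine_manifold \<Rightarrow> 'm set \<Rightarrow> ('m \<Rightarrow> real) \<Rightarrow> bool" where
  "smooth_fun_on M U f \<longleftrightarrow> (\<forall>k. Ck_fun_on M k U f)"

definition smooth_field_on ::
  "('m, 'e::euclidean_space) affine_manifold \<Rightarrow> 'm set \<Rightarrow> ('m \<Rightarrow> ('m, 'e) tangent) \<Rightarrow> bool" where
  "smooth_field_on M U X \<longleftrightarrow> (\<forall>y\<in>U. X y \<in> tangent_space M y) \<and>
     (\<forall>c\<in>atlas M. smooth_map_on (coord c ` (U \<inter> dom_of c)) (\<lambda>p. X (coord_inv c p) c))"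

text \<open>The differential \<open>Df\<^sub>x(v)\<close>. By the chain rule any chart at \<open>x\<close> gives the same value,
  see \<open>differential_eq_chart\<close> below.\<close>

definition differential ::
  "('m, 'e::euclidean_space) affine_manifold \<Rightarrow> ('m \<Rightarrow> real) \<Rightarrow> 'm \<Rightarrow> ('m, 'e) tangent \<Rightarrow> real" where
  "differential M f x v =
     (let c = chart_at M x in frechet_derivative (f \<circ> coord_inv c) (at (coord c x)) (v c))"


section \<open>Affine connections\<close>

text \<open>Koszul's axioms for an affine connection, stated for vector fields on arbitrary open
  sets together with locality.\<close>

definition is_connection ::
  "('m::{t2_space,second_countable_topology}, 'e::euclidean_space) affine_manifold \<Rightarrow> bool" where
  "is_connection M \<longleftrightarrow>
     (\<forall>U X Y. open U \<and> smooth_field_on M U X \<and> smooth_field_on M U Y \<longrightarrow>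
        smooth_field_on M U (\<lambda>y. nabla M y (X y) Y)) \<and>
     (\<forall>U V x Y Y' u. open U \<and> open V \<and> V \<subseteq> U \<and> x \<in> V \<and> u \<in> tangent_space M x \<and>
        smooth_field_on M U Y \<and> smooth_field_on M V Y' \<and> (\<forall>y\<in>V. Y y = Y' y) \<longrightarrow>
        nabla M x u Y = nabla M x u Y') \<and>
     (\<forall>U x Y u v a b. open U \<and> x \<in> U \<and> smooth_field_on M U Y \<and>
        u \<in> tangent_space M x \<and> v \<in> tangent_space M x \<longrightarrow>
        nabla M x (\<lambda>c. a *\<^sub>R u c + b *\<^sub>R v c) Y =
          (\<lambda>c. a *\<^sub>R nabla M x u Y c + b *\<^sub>R nabla M x v Y c)) \<and>
     (\<forall>U x Y Z u. open U \<and> x \<in> U \<and> smooth_field_on M U Y \<and> smooth_field_on M U Z \<and>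
        u \<in> tangent_space M x \<longrightarrow>
        nabla M x u (\<lambda>y c. Y y c + Z y c) = (\<lambda>c. nabla M x u Y c + nabla M x u Z c)) \<and>
     (\<forall>U x g Y u. open U \<and> x \<in> U \<and> smooth_fun_on M U g \<and> smooth_field_on M U Y \<and>
        u \<in> tangent_space M x \<longrightarrow>
        nabla M x u (\<lambda>y c. g y *\<^sub>R Y y c) =
          (\<lambda>c. differential M g x u *\<^sub>R Y x c + g x *\<^sub>R nabla M x u Y c))"

text \<open>\<open>\<nabla>\<^sub>X Y - \<nabla>\<^sub>Y X = [X,Y]\<close>, where the bracket is given by its action
  \<open>[X,Y]f = X(Yf) - Y(Xf)\<close> on functions.\<close>

definition torsion_free ::
  "('m::{t2_space,second_countable_topology}, 'e::euclidean_space) affine_manifold \<Rightarrow> bool" where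
  "torsion_free M \<longleftrightarrow>
     (\<forall>U X Y f. open U \<and> smooth_field_on M U X \<and> smooth_field_on M U Y \<and> smooth_fun_on M U f \<longrightarrow>
        (\<forall>x\<in>U. differential M f x (\<lambda>c. nabla M x (X x) Y c - nabla M x (Y x) X c) =
           differential M (\<lambda>y. differential M f y (Y y)) x (X x) -
           differential M (\<lambda>y. differential M f y (X y)) x (Y x)))"

text \<open>Christoffel symbols: \<open>christoffel M c x u v\<close> is \<open>\<Gamma>\<^sub>x(u,v)\<close> in the chart \<open>c\<close>.\<close>

definition christoffel ::
  "('m, 'e::euclidean_space) affine_manifold \<Rightarrow> ('m, 'e) chart \<Rightarrow> 'm \<Rightarrow> 'e \<Rightarrow> 'e \<Rightarrow> 'e" where
  "christoffel M c x u v = nabla M x (coord_field M c u x) (coord_field M c v) c"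


section \<open>Geodesics and the exponential map\<close>

text \<open>Affinely parametrized geodesics, \<open>\<nabla>\<^bsub>\<gamma>'\<^esub>\<gamma>' = 0\<close>: in each chart
  \<open>\<gamma>'' + \<Gamma>(\<gamma>',\<gamma>') = 0\<close>.\<close>

definition geodesic ::
  "('m::{t2_space,second_countable_topology}, 'e::euclidean_space) affine_manifold \<Rightarrow>
   real set \<Rightarrow> (real \<Rightarrow> 'm) \<Rightarrow> bool" where
  "geodesic M I \<gamma> \<longleftrightarrow> continuous_on I \<gamma> \<and>
     (\<forall>c\<in>atlas M. \<exists>\<gamma>'. \<forall>t\<in>I. \<gamma> t \<in> dom_of c \<longrightarrow>
        ((coord c \<circ> \<gamma>) has_vector_derivative \<gamma>' t) (at t within I) \<and>
        (\<gamma>' has_vector_derivative - christoffel M c (\<gamma> t) (\<gamma>' t) (\<gamma>' t)) (at t within I))"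

definition has_velocity ::
  "('m, 'e::euclidean_space) affine_manifold \<Rightarrow>
   (real \<Rightarrow> 'm) \<Rightarrow> ('m, 'e) tangent \<Rightarrow> real \<Rightarrow> real set \<Rightarrow> bool" where
  "has_velocity M \<gamma> v t I \<longleftrightarrow>
     (\<forall>c\<in>charts_at M (\<gamma> t). ((coord c \<circ> \<gamma>) has_vector_derivative v c) (at t within I))"

definition geodesic_from ::
  "('m::{t2_space,second_countable_topology}, 'e::euclidean_space) affine_manifold \<Rightarrow>
   'm \<Rightarrow> ('m, 'e) tangent \<Rightarrow> (real \<Rightarrow> 'm) \<Rightarrow> bool" where
  "geodesic_from M x v \<gamma> \<longleftrightarrow> geodesic M {0..1} \<gamma> \<and> \<gamma> 0 = x \<and> has_velocity M \<gamma> v 0 {0..1}"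

definition exp_map ::
  "('m::{t2_space,second_countable_topology}, 'e::euclidean_space) affine_manifold \<Rightarrow>
   'm \<Rightarrow> ('m, 'e) tangent \<Rightarrow> 'm" where
  "exp_map M x v = (THE y. \<exists>\<gamma>. geodesic_from M x v \<gamma> \<and> \<gamma> 1 = y)"

text \<open>The standing assumptions: torsion-free, and every \<open>exp\<^sub>x\<close> is defined on all of \<open>T\<^sub>x\<close> and
  maps onto \<open>M\<close>.\<close>

definition admissible_manifold ::
  "('m::{t2_space,second_countable_topology}, 'e::euclidean_space) affine_manifold \<Rightarrow> bool" where
  "admissible_manifold M \<longleftrightarrow>
     smooth_manifold M \<and> is_connection M \<and> torsion_free M \<and>
     (\<forall>x. \<forall>v\<in>tangent_space M x. \<exists>\<gamma>. geodesic_from M x v \<gamma>) \<and>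
     (\<forall>x. exp_map M x ` tangent_space M x = UNIV)"


section \<open>Hessian and its covariant derivative\<close>

text \<open>A local vector field extending \<open>v \<in> T\<^sub>x\<close>. The Hessian and its covariant derivative are
  tensors, so any other choice of extension gives the same values below.\<close>

definition extend ::
  "('m, 'e::euclidean_space) affine_manifold \<Rightarrow> 'm \<Rightarrow> ('m, 'e) tangent \<Rightarrow>
   'm \<Rightarrow> ('m, 'e) tangent" where
  "extend M x v = coord_field M (chart_at M x) (v (chart_at M x))"

text \<open>\<open>Hf(X,Y) = X(Df(Y)) - Df(\<nabla>\<^sub>X Y)\<close>\<close>

definition Hess ::
  "('m, 'e::euclidean_space) affine_manifold \<Rightarrow> ('m \<Rightarrow> real) \<Rightarrow> 'm \<Rightarrow>
   ('m, 'e) tangent \<Rightarrow> ('m, 'e) tangent \<Rightarrow> real" where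
  "Hess M f x u v =
     (let V = extend M x v in
        differential M (\<lambda>y. differential M f y (V y)) x u - differential M f x (nabla M x u V))"

text \<open>\<open>(\<nabla>\<^sub>v Hf)(U,W) = v(Hf(U,W)) - Hf(\<nabla>\<^sub>v U, W) - Hf(U, \<nabla>\<^sub>v W)\<close>\<close>

definition nabla_Hess ::
  "('m, 'e::euclidean_space) affine_manifold \<Rightarrow> ('m \<Rightarrow> real) \<Rightarrow> 'm \<Rightarrow>
   ('m, 'e) tangent \<Rightarrow> ('m, 'e) tangent \<Rightarrow> ('m, 'e) tangent \<Rightarrow> real" where
  "nabla_Hess M f x v u w =
     (let U = extend M x u; W = extend M x w in
        differential M (\<lambda>y. Hess M f y (U y) (W y)) x v
        - Hess M f x (nabla M x v U) w - Hess M f x u (nabla M x v W))"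


section \<open>Convexity and affine functions\<close>

definition geo_convex_set ::
  "('m::{t2_space,second_countable_topology}, 'e::euclidean_space) affine_manifold \<Rightarrow>
   'm set \<Rightarrow> bool" where
  "geo_convex_set M C \<longleftrightarrow>
     (\<forall>\<gamma> a b. a \<le> b \<and> geodesic M {a..b} \<gamma> \<and> \<gamma> a \<in> C \<and> \<gamma> b \<in> C \<longrightarrow> \<gamma> ` {a..b} \<subseteq> C)"

definition geo_convex_on ::
  "('m::{t2_space,second_countable_topology}, 'e::euclidean_space) affine_manifold \<Rightarrow>
   'm set \<Rightarrow> ('m \<Rightarrow> real) \<Rightarrow> bool" where
  "geo_convex_on M C f \<longleftrightarrow>
     (\<forall>\<gamma> a b. a \<le> b \<and> geodesic M {a..b} \<gamma> \<and> \<gamma> ` {a..b} \<subseteq> C \<longrightarrow> convex_on {a..b} (f \<circ> \<gamma>))"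

text \<open>Affine functions on \<open>Q\<close>, \<open>(l \<circ> \<gamma>)'' = 0\<close> for all geodesics \<open>\<gamma>\<close> in \<open>Q\<close>; \<open>C\<^sup>3\<close> is the
  smoothness required throughout of functions on open sets.\<close>

definition geo_affine_on ::
  "('m::{t2_space,second_countable_topology}, 'e::euclidean_space) affine_manifold \<Rightarrow>
   'm set \<Rightarrow> ('m \<Rightarrow> real) \<Rightarrow> bool" where
  "geo_affine_on M Q l \<longleftrightarrow> continuous_on Q l \<and> Ck_fun_on M 3 (interior Q) l \<and>
     (\<forall>\<gamma> a b. a \<le> b \<and> geodesic M {a..b} \<gamma> \<and> \<gamma> ` {a..b} \<subseteq> Q \<longrightarrow>
        (\<exists>g. \<forall>t\<in>{a..b}. ((l \<circ> \<gamma>) has_real_derivative g t) (at t within {a..b}) \<and>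
                         (g has_real_derivative 0) (at t within {a..b})))"


section \<open>Self-concordance and barriers\<close>

definition nondegenerate_on ::
  "('m, 'e::euclidean_space) affine_manifold \<Rightarrow> 'm set \<Rightarrow> ('m \<Rightarrow> real) \<Rightarrow> bool" where
  "nondegenerate_on M C f \<longleftrightarrow>
     (\<forall>x\<in>C. \<forall>u\<in>tangent_space M x. u \<noteq> (\<lambda>c. 0) \<longrightarrow> 0 < Hess M f x u u)"

definition closed_fun_on :: "'m::topological_space set \<Rightarrow> ('m \<Rightarrow> real) \<Rightarrow> bool" where
  "closed_fun_on C f \<longleftrightarrow> closed {(x, y). x \<in> C \<and> f x \<le> y}"

definition self_concordant ::
  "('m::{t2_space,second_countable_topology}, 'e::euclidean_space) affine_manifold \<Rightarrow>
   real \<Rightarrow> 'm set \<Rightarrow> ('m \<Rightarrow> real) \<Rightarrow> bool" where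
  "self_concordant M \<sigma> C f \<longleftrightarrow>
     0 \<le> \<sigma> \<and> open C \<and> geo_convex_set M C \<and> Ck_fun_on M 3 C f \<and>
     geo_convex_on M C f \<and> closed_fun_on C f \<and> nondegenerate_on M C f \<and>
     (\<forall>x\<in>C. \<forall>u\<in>tangent_space M x. \<forall>v\<in>tangent_space M x.
        \<bar>nabla_Hess M f x v u u\<bar> \<le> 2 * \<sigma> * sqrt (Hess M f x v v) * Hess M f x u u)"

definition sc_barrier ::
  "('m::{t2_space,second_countable_topology}, 'e::euclidean_space) affine_manifold \<Rightarrow>
   real \<Rightarrow> 'm set \<Rightarrow> ('m \<Rightarrow> real) \<Rightarrow> bool" where
  "sc_barrier M \<nu> Q F \<longleftrightarrow>
     0 < \<nu> \<and> closure (interior Q) = Q \<and> self_concordant M 1 (interior Q) F \<and>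
     (\<forall>x\<in>interior Q. \<forall>u\<in>tangent_space M x. (differential M F x u)\<^sup>2 \<le> \<nu> * Hess M F x u u)"

text \<open>\<open>\<parallel>p\<parallel>\<^sup>*\<^bsub>F,x\<^esub> = sqrt (p (HF\<^sub>x\<^sup>-\<^sup>1 p))\<close>; here \<open>HF\<^sub>x\<^sup>-\<^sup>1 p\<close> is the \<open>w \<in> T\<^sub>x\<close> with
  \<open>HF\<^sub>x(w,\<cdot>) = p\<close>.\<close>

definition dual_norm ::
  "('m, 'e::euclidean_space) affine_manifold \<Rightarrow> ('m \<Rightarrow> real) \<Rightarrow> 'm \<Rightarrow>
   (('m, 'e) tangent \<Rightarrow> real) \<Rightarrow> real" where
  "dual_norm M F x p =
     sqrt (p (THE w. w \<in> tangent_space M x \<and> (\<forall>v\<in>tangent_space M x. Hess M F x w v = p v)))"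

definition newton_direction ::
  "('m, 'e::euclidean_space) affine_manifold \<Rightarrow> ('m \<Rightarrow> real) \<Rightarrow> 'm \<Rightarrow> ('m, 'e) tangent" where
  "newton_direction M f x =
     (THE u. u \<in> tangent_space M x \<and>
        (\<forall>v\<in>tangent_space M x. differential M f x v + Hess M f x u v = 0))"


section \<open>The path-following method\<close>

definition path_fun :: "('m \<Rightarrow> real) \<Rightarrow> ('m \<Rightarrow> real) \<Rightarrow> real \<Rightarrow> 'm \<Rightarrow> real" where
  "path_fun l F t = (\<lambda>x. t * l x + F x)"

definition path_alpha :: "real \<Rightarrow> real" where
  "path_alpha \<beta> = sqrt \<beta> / (1 + sqrt \<beta>) - \<beta>"

definition t_plus ::
  "('m, 'e::euclidean_space) affine_manifold \<Rightarrow> ('m \<Rightarrow> real) \<Rightarrow> ('m \<Rightarrow> real) \<Rightarrow> real \<Rightarrow>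
   'm \<Rightarrow> real \<Rightarrow> real" where
  "t_plus M l F \<beta> x t = t + path_alpha \<beta> / dual_norm M F x (differential M l x)"

definition x_plus ::
  "('m::{t2_space,second_countable_topology}, 'e::euclidean_space) affine_manifold \<Rightarrow>
   ('m \<Rightarrow> real) \<Rightarrow> ('m \<Rightarrow> real) \<Rightarrow> real \<Rightarrow> 'm \<Rightarrow> real \<Rightarrow> 'm" where
  "x_plus M l F \<beta> x t = exp_map M x (newton_direction M (path_fun l F (t_plus M l F \<beta> x t)) x)"

definition path_step ::
  "('m::{t2_space,second_countable_topology}, 'e::euclidean_space) affine_manifold \<Rightarrow>
   ('m \<Rightarrow> real) \<Rightarrow> ('m \<Rightarrow> real) \<Rightarrow> real \<Rightarrow> 'm \<times> real \<Rightarrow> 'm \<times> real" where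
  "path_step M l F \<beta> = (\<lambda>(x, t). (x_plus M l F \<beta> x t, t_plus M l F \<beta> x t))"

text \<open>The constant in the iteration bound has to depend on \<open>\<beta>\<close> only. A constant bound by an
  existential quantifier inside a theorem could still depend on the types of the theorem, that is
  on the space underlying \<open>M\<close> and on its dimension, so it is given as a function of \<open>\<beta>\<close>.
  With \<open>t\<^sub>1 = \<alpha> / \<parallel>Dl\<parallel>\<^sup>*\<close> at the starting point, each later step multiplies \<open>t\<close> by at
  least \<open>1 + \<alpha> / (\<beta> + sqrt \<nu>)\<close>, and \<open>ln (1 + \<alpha> / (\<beta> + sqrt \<nu>)) \<ge> \<alpha> / (2 * sqrt \<nu>)\<close>
  because \<open>\<alpha> + \<beta> < 1 \<le> \<nu>\<close>; the gap is at most \<open>\<nu> * (1 + \<beta>\<^sup>2) / ((1 - \<beta>) * t)\<close>.\<close>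

definition path_const :: "real \<Rightarrow> real" where
  "path_const \<beta> =
     2 + 2 / path_alpha \<beta> * (1 + ln ((1 + \<beta>\<^sup>2) / ((1 - \<beta>) * path_alpha \<beta>)))"


section \<open>The differential does not depend on the chart\<close>

lemma transition_differentiable:
  assumes M: "smooth_manifold M" and c: "c \<in> charts_at M x" and d: "d \<in> charts_at M x"
  shows "(coord d \<circ> coord_inv c) differentiable (at (coord c x))"
proof -
  have cd: "c \<in> atlas M" "d \<in> atlas M" "x \<in> dom_of c" "x \<in> dom_of d"
    using c d by (auto simp: charts_at_def)
  have "Ck_on (Suc 0) (coord c ` (dom_of c \<inter> dom_of d)) (coord d \<circ> coord_inv c)"
    using M cd(1,2) by (simp only: smooth_manifold_def smooth_map_on_def)
  then show ?thesis
    using cd by auto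
qed

lemma differential_eq_chart:
  fixes M :: "('m::{t2_space,second_countable_topology}, 'e::euclidean_space) affine_manifold"
  assumes M: "smooth_manifold M" and v: "v \<in> tangent_space M x" and c: "c \<in> charts_at M x"
    and f: "\<And>d. d \<in> charts_at M x \<Longrightarrow> (f \<circ> coord_inv d) differentiable (at (coord d x))"
  shows "differential M f x v = frechet_derivative (f \<circ> coord_inv c) (at (coord c x)) (v c)"
proof -
  define d where "d = chart_at M x"
  have d: "d \<in> charts_at M x"
    unfolding d_def chart_at_def using c by (rule someI)
  have cd: "c \<in> atlas M" "d \<in> atlas M" "x \<in> dom_of c" "x \<in> dom_of d"
    using c d by (auto simp: charts_at_def)
  have hc: "homeomorphism (dom_of c) (coord c ` dom_of c) (coord c) (coord_inv c)"
    and oc: "open (coord c ` dom_of c)" and od: "open (dom_of d)"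
    and hd: "homeomorphism (dom_of d) (coord d ` dom_of d) (coord d) (coord_inv d)"
    using M cd(1,2) by (simp_all only: smooth_manifold_def)
  have inv_c: "coord_inv c (coord c y) = y" if "y \<in> dom_of c" for y
    using hc that by (simp add: homeomorphism_def)
  have inv_d: "coord_inv d (coord d y) = y" if "y \<in> dom_of d" for y
    using hd that by (simp add: homeomorphism_def)
  define W where "W = coord c ` (dom_of c \<inter> dom_of d)"
  have "openin (top_of_set (coord c ` dom_of c)) W"
    unfolding W_def using od by (intro homeomorphism_imp_open_map[OF hc] openin_open_Int)
  then have oW: "open W"
    using oc openin_open_trans by blast
  have xW: "coord c x \<in> W"
    using cd by (auto simp: W_def)
  let ?T = "coord d \<circ> coord_inv c"
  have T: "(?T has_derivative trans_deriv c d x) (at (coord c x))"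
    unfolding trans_deriv_def using transition_differentiable[OF M c d]
    by (simp add: frechet_derivative_works)
  have "(f \<circ> coord_inv d has_derivative
      frechet_derivative (f \<circ> coord_inv d) (at (coord d x))) (at (?T (coord c x)))"
    using f[OF d] by (simp add: frechet_derivative_works inv_c cd)
  from diff_chain_at[OF T this]
  have "((f \<circ> coord_inv d) \<circ> ?T has_derivative
      frechet_derivative (f \<circ> coord_inv d) (at (coord d x)) \<circ> trans_deriv c d x)
      (at (coord c x))" .
  moreover have "((f \<circ> coord_inv d) \<circ> ?T) p = (f \<circ> coord_inv c) p" if "p \<in> W" for p
    using that by (auto simp: W_def inv_c inv_d)
  ultimately have "(f \<circ> coord_inv c has_derivative
      frechet_derivative (f \<circ> coord_inv d) (at (coord d x)) \<circ> trans_deriv c d x)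
      (at (coord c x))"
    by (rule has_derivative_transform_within_open[OF _ oW xW])
  then have "frechet_derivative (f \<circ> coord_inv c) (at (coord c x)) =
      frechet_derivative (f \<circ> coord_inv d) (at (coord d x)) \<circ> trans_deriv c d x"
    by (rule frechet_derivative_at[symmetric])
  moreover have "v d = trans_deriv c d x (v c)"
    using v c d unfolding tangent_space_def by blast
  ultimately show ?thesis
    by (simp add: differential_def d_def Let_def)
qed

end

theory Submission
  imports Defs
begin

text \<open>
  Along a geodesic \<open>\<gamma>\<close> the function \<open>(F \<circ> \<gamma>)''\<^sup>-\<^sup>1\<^sup>/\<^sup>2\<close> is 1-Lipschitz, which compares the local norms of the
  velocity at different times and shows that a geodesic whose initial speed has local norm less
  than 1 cannot leave the domain up to time 1: \<open>F\<close> stays bounded on it and has a closed epigraph.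
  For a Newton step \<open>u\<close> with \<open>r = \<parallel>u\<parallel> < 1\<close>, the covector \<open>Df + (1 - s) HF(\<gamma>', \<cdot>)\<close> vanishes at \<open>s = 0\<close>
  and equals \<open>Df\<close> at \<open>s = 1\<close>; integrating a differential inequality for its dual norm gives
  \<open>\<parallel>Df\<parallel>\<^sup>* \<le> (r / (1 - r))\<^sup>2\<close> at \<open>exp u\<close>. Since \<open>l\<close> has zero Hessian, the path functions all have the
  Hessian of \<open>F\<close>, and \<open>\<alpha>\<close> is chosen such that \<open>r \<le> \<alpha> + \<beta>\<close> implies \<open>(r / (1 - r))\<^sup>2 \<le> \<beta>\<close>. The gap to the
  minimum is split at the minimizer of the path function, where the semiboundedness
  \<open>DF(\<gamma>') \<le> \<nu>\<close> of a barrier applies. The iteration count also needs \<open>\<nu> \<ge> 1\<close>.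
\<close>

section \<open>Calculus of \<open>C\<^sup>k\<close> maps\<close>

text \<open>The connection need not be compatible with the form \<open>Hess M F\<close>, so the
  local norm of the velocity varies along a geodesic and only \<open>nabla_Hess\<close> controls it.
  All estimates are therefore reduced to real functions of the geodesic parameter. Self-concordance
  bounds (\<nabla>_v H)(u,u) with a repeated argument, but the Newton estimate also meets
  (\<nabla>_v H)(v,W); polarization gives the same bound there. Square roots of quantities that may
  vanish are regularised by a positive number that finally tends to 0.

  The threshold behind \<alpha> is the solution r = sqrt \<beta> / (1 + sqrt \<beta>) of r / (1 - r)
  = sqrt \<beta>. Raising t by \<alpha> divided by the dual norm of Dl changes the dual norm of the
  differential of the path function by at most \<alpha>, so the Newton direction has local norm at
  most \<alpha> + \<beta> = r.

  The bound \<nu> \<ge> 1 makes the terms sqrt \<nu> and \<beta> in the gap estimate comparable with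
  \<nu>, and lets sqrt \<nu> absorb the rounding of the iteration count.\<close>

abbreviation fderiv :: "('a::real_normed_vector \<Rightarrow> 'b::real_normed_vector) \<Rightarrow> 'a \<Rightarrow> 'a \<Rightarrow> 'b" where
  "fderiv f x \<equiv> frechet_derivative f (at x)"

lemma has_fderiv:
  assumes "Ck_on (Suc k) S f" "x \<in> S"
  shows "(f has_derivative fderiv f x) (at x)"
  using assms by (simp add: frechet_derivative_works)

lemma Ck_on_cong:
  assumes "open S" "\<And>x. x \<in> S \<Longrightarrow> f x = g x" "Ck_on k S f"
  shows "Ck_on k S g"
  using assms
proof (induction k arbitrary: f g)
  case 0
  then show ?case
    using continuous_on_cong[of S S f g] by simp
next
  case (Suc k)
  have *: "(g has_derivative fderiv f x) (at x)" if "x \<in> S" for x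
    by (rule has_derivative_transform_within_open[OF has_fderiv[OF Suc.prems(3) that] \<open>open S\<close> that])
      (use Suc.prems in auto)
  have "fderiv g x = fderiv f x" if "x \<in> S" for x
    using frechet_derivative_at[OF *[OF that]] by simp
  moreover have "g differentiable at x" if "x \<in> S" for x
    using * that differentiable_def by blast
  ultimately show ?case
    using Suc.IH[OF \<open>open S\<close>, of "\<lambda>x. fderiv f x v" "\<lambda>x. fderiv g x v" for v] Suc.prems by simp
qed

text \<open>\<open>Ck_on\<close> speaks of \<open>frechet_derivative\<close>, which is a choice.
  With this rule the inductions below may exhibit the derivative in whatever form the
  differentiation rules produce.\<close>

lemma Ck_on_SucI:
  assumes "open S" "\<And>x. x \<in> S \<Longrightarrow> (f has_derivative D x) (at x)" "\<And>v. Ck_on k S (\<lambda>x. D x v)"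
  shows "Ck_on (Suc k) S f"
proof -
  have "fderiv f x = D x" if "x \<in> S" for x
    using frechet_derivative_at[OF assms(2)[OF that]] by simp
  then have "Ck_on k S (\<lambda>x. fderiv f x v)" for v
    using Ck_on_cong[OF \<open>open S\<close> _ assms(3)[of v], of "\<lambda>x. fderiv f x v"] by simp
  moreover have "f differentiable at x" if "x \<in> S" for x
    using assms(2)[OF that] by (rule differentiableI)
  ultimately show ?thesis
    by simp
qed

lemma Ck_on_SucD: "Ck_on (Suc k) S f \<Longrightarrow> Ck_on k S f"
proof (induction k arbitrary: f)
  case 0
  then show ?case
    by (auto intro!: continuous_at_imp_continuous_on differentiable_imp_continuous_within)
next
  case (Suc k)
  from Suc.prems have "\<forall>x\<in>S. f differentiable at x" "\<forall>v. Ck_on (Suc k) S (\<lambda>x. fderiv f x v)"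
    by simp_all
  then show ?case using Suc.IH by simp
qed

lemma Ck_on_mono: "j \<le> k \<Longrightarrow> Ck_on k S f \<Longrightarrow> Ck_on j S f"
  by (induction k rule: dec_induct) (auto dest: Ck_on_SucD simp del: Ck_on.simps)

lemma Ck_on_subset: "Ck_on k S f \<Longrightarrow> T \<subseteq> S \<Longrightarrow> Ck_on k T f"
  by (induction k arbitrary: f) (auto intro: continuous_on_subset)

lemma Ck_on_imp_continuous_on: "Ck_on k S f \<Longrightarrow> continuous_on S f"
  using Ck_on_mono[of 0 k S f] by simp

lemma Ck_on_const: "Ck_on k S (\<lambda>x. c)"
  by (induction k arbitrary: c) (simp_all add: frechet_derivative_const)

lemma Ck_on_bounded_linear:
  assumes "open S" "bounded_linear h" "Ck_on k S f"
  shows "Ck_on k S (\<lambda>x. h (f x))"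
  using assms(3)
proof (induction k arbitrary: f)
  case 0
  then show ?case
    using bounded_linear.continuous_on[OF assms(2)] by simp
next
  case (Suc k)
  show ?case
  proof (rule Ck_on_SucI[OF \<open>open S\<close>])
    show "((\<lambda>x. h (f x)) has_derivative (\<lambda>v. h (fderiv f x v))) (at x)" if "x \<in> S" for x
      using bounded_linear.has_derivative[OF assms(2) has_fderiv[OF Suc.prems that]] .
    show "Ck_on k S (\<lambda>x. h (fderiv f x v))" for v
      using Suc by simp
  qed
qed

lemma Ck_on_add:
  assumes "open S" "Ck_on k S f" "Ck_on k S g"
  shows "Ck_on k S (\<lambda>x. f x + g x)"
  using assms(2,3)
proof (induction k arbitrary: f g)
  case 0
  then show ?case by (simp add: continuous_on_add)
next
  case (Suc k)
  show ?case
  proof (rule Ck_on_SucI[OF \<open>open S\<close>])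
    show "((\<lambda>x. f x + g x) has_derivative (\<lambda>v. fderiv f x v + fderiv g x v)) (at x)" if "x \<in> S" for x
      using has_derivative_add[OF has_fderiv[OF Suc.prems(1) that] has_fderiv[OF Suc.prems(2) that]] .
    show "Ck_on k S (\<lambda>x. fderiv f x v + fderiv g x v)" for v
      using Suc by simp
  qed
qed

lemma Ck_on_sum:
  assumes "open S" "finite I" "\<And>i. i \<in> I \<Longrightarrow> Ck_on k S (f i)"
  shows "Ck_on k S (\<lambda>x. \<Sum>i\<in>I. f i x)"
  using assms(2,3) by (induction I rule: finite_induct) (simp_all add: Ck_on_const Ck_on_add[OF assms(1)])

lemma Ck_on_scaleR:
  fixes f :: "'a::euclidean_space \<Rightarrow> real" and g :: "'a \<Rightarrow> 'b::real_normed_vector"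
  assumes "open S" "Ck_on k S f" "Ck_on k S g"
  shows "Ck_on k S (\<lambda>x. f x *\<^sub>R g x)"
  using assms(2,3)
proof (induction k arbitrary: f g)
  case 0
  then show ?case by (simp add: continuous_on_scaleR)
next
  case (Suc k)
  show ?case
  proof (rule Ck_on_SucI[OF \<open>open S\<close>])
    show "((\<lambda>x. f x *\<^sub>R g x) has_derivative (\<lambda>v. f x *\<^sub>R fderiv g x v + fderiv f x v *\<^sub>R g x)) (at x)"
      if "x \<in> S" for x
      using has_derivative_scaleR[OF has_fderiv[OF Suc.prems(1) that] has_fderiv[OF Suc.prems(2) that]] .
    show "Ck_on k S (\<lambda>x. f x *\<^sub>R fderiv g x v + fderiv f x v *\<^sub>R g x)" for v
      using Suc Ck_on_SucD[OF Suc.prems(1)] Ck_on_SucD[OF Suc.prems(2)]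
      by (intro Ck_on_add[OF \<open>open S\<close>]) simp_all
  qed
qed

lemma linear_euclidean_expansion:
  fixes h :: "'a::euclidean_space \<Rightarrow> 'b::real_vector"
  assumes "linear h"
  shows "h v = (\<Sum>b\<in>Basis. (v \<bullet> b) *\<^sub>R h b)"
proof -
  have "h v = h (\<Sum>b\<in>Basis. (v \<bullet> b) *\<^sub>R b)"
    by (simp add: euclidean_representation)
  also have "\<dots> = (\<Sum>b\<in>Basis. (v \<bullet> b) *\<^sub>R h b)"
    by (simp add: linear_sum[OF assms] linear_scale[OF assms])
  finally show ?thesis .
qed

lemma Ck_on_compose:
  fixes f :: "'b::euclidean_space \<Rightarrow> 'c::real_normed_vector" and g :: "'a::euclidean_space \<Rightarrow> 'b"
  assumes "open S" "open T" "g ` S \<subseteq> T" "Ck_on k S g" "Ck_on k T f"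
  shows "Ck_on k S (\<lambda>x. f (g x))"
  using assms(4,5)
proof (induction k arbitrary: f)
  case 0
  then show ?case
    using continuous_on_compose2[of T f S g] assms(3) by simp
next
  case (Suc k)
  show ?case
  proof (rule Ck_on_SucI[OF \<open>open S\<close>])
    show "((\<lambda>x. f (g x)) has_derivative (\<lambda>v. fderiv f (g x) (fderiv g x v))) (at x)" if "x \<in> S" for x
    proof -
      have "g x \<in> T" using that assms(3) by blast
      then show ?thesis
        by (intro has_derivative_compose[OF has_fderiv[OF Suc.prems(1) that]] has_fderiv[OF Suc.prems(2)])
    qed
    show "Ck_on k S (\<lambda>x. fderiv f (g x) (fderiv g x v))" for v
    proof -
      have "Ck_on k S (\<lambda>x. fderiv f (g x) b)" for b
        using Suc.IH[of "\<lambda>y. fderiv f y b"] Suc.prems Ck_on_SucD[OF Suc.prems(1)] by simp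
      moreover have "Ck_on k S (\<lambda>x. fderiv g x v \<bullet> b)" for b
        using Ck_on_bounded_linear[OF \<open>open S\<close> bounded_linear_inner_left, of k "\<lambda>x. fderiv g x v"]
          Suc.prems(1) by simp
      \<comment> \<open>The direction \<open>fderiv g x v\<close> moves with \<open>x\<close>,
        whereas the induction hypothesis concerns a fixed direction. It is applied to the basis
        directions, and the product rule does the rest.\<close>
      ultimately have *: "Ck_on k S (\<lambda>x. \<Sum>b\<in>Basis. (fderiv g x v \<bullet> b) *\<^sub>R fderiv f (g x) b)"
        by (intro Ck_on_sum[OF \<open>open S\<close>] Ck_on_scaleR[OF \<open>open S\<close>]) simp_all
      have "fderiv f (g x) (fderiv g x v) = (\<Sum>b\<in>Basis. (fderiv g x v \<bullet> b) *\<^sub>R fderiv f (g x) b)"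
        if "x \<in> S" for x
      proof (rule linear_euclidean_expansion)
        have "g x \<in> T" using that assms(3) by blast
        then show "linear (fderiv f (g x))"
          using has_fderiv[OF Suc.prems(2)] has_derivative_linear by blast
      qed
      then show ?thesis
        using Ck_on_cong[OF \<open>open S\<close> _ *] by simp
    qed
  qed
qed

lemma fderiv_linear:
  assumes "Ck_on (Suc k) S f" "x \<in> S"
  shows "linear (fderiv f x)"
  using has_fderiv[OF assms] has_derivative_linear by blast

text \<open>The derivative is bounded in operator norm on \<open>K\<close> because its values on the
  finitely many basis vectors are; convexity of \<open>K\<close> then permits the mean value
  inequality. This is the source of the Lipschitz bound for the geodesic equation.\<close>

lemma Ck_on_lipschitz:
  fixes f :: "'a::euclidean_space \<Rightarrow> 'b::real_normed_vector"
  assumes "Ck_on (Suc 0) S f" "compact K" "convex K" "K \<subseteq> S"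
  obtains L where "0 \<le> L" "\<And>x y. x \<in> K \<Longrightarrow> y \<in> K \<Longrightarrow> norm (f x - f y) \<le> L * norm (x - y)"
proof -
  have c: "continuous_on K (\<lambda>x. \<Sum>b\<in>Basis. norm (fderiv f x b))"
    using assms(1,4) by (auto intro!: continuous_intros intro: continuous_on_subset)
  obtain B where B: "\<And>x. x \<in> K \<Longrightarrow> (\<Sum>b\<in>Basis. norm (fderiv f x b)) \<le> B"
    using compact_imp_bounded[OF compact_continuous_image[OF c \<open>compact K\<close>]]
    unfolding bounded_real by (meson abs_le_D1 imageI)
  have on: "onorm (fderiv f x) \<le> \<bar>B\<bar>" if "x \<in> K" for x
  proof (rule onorm_le)
    fix v :: 'a
    have "fderiv f x v = (\<Sum>b\<in>Basis. (v \<bullet> b) *\<^sub>R fderiv f x b)"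
      using that assms(4) by (intro linear_euclidean_expansion fderiv_linear[OF assms(1)]) auto
    also have "norm \<dots> \<le> (\<Sum>b\<in>Basis. norm (fderiv f x b) * norm v)"
      by (rule sum_norm_le) (simp add: Basis_le_norm mult.commute mult_right_mono)
    also have "\<dots> \<le> \<bar>B\<bar> * norm v"
      unfolding sum_distrib_right[symmetric] using B[OF that] by (intro mult_right_mono) auto
    finally show "norm (fderiv f x v) \<le> \<bar>B\<bar> * norm v" .
  qed
  have "norm (f x - f y) \<le> \<bar>B\<bar> * norm (x - y)" if "x \<in> K" "y \<in> K" for x y
    using that assms(4)
    by (intro differentiable_bound[OF \<open>convex K\<close> has_derivative_at_withinI[OF has_fderiv[OF assms(1)]] on])
      auto
  then show ?thesis
    using that[of "\<bar>B\<bar>"] by simp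
qed

section \<open>Symmetry of second derivatives\<close>

lemma line_in_ball:
  fixes a b p :: "'a::real_normed_vector"
  assumes "\<bar>x\<bar> * norm a + \<bar>y\<bar> * norm b < r"
  shows "p + x *\<^sub>R a + y *\<^sub>R b \<in> ball p r"
proof -
  have "norm (x *\<^sub>R a + y *\<^sub>R b) \<le> \<bar>x\<bar> * norm a + \<bar>y\<bar> * norm b"
    using norm_triangle_ineq[of "x *\<^sub>R a" "y *\<^sub>R b"] by simp
  moreover have "dist p (p + x *\<^sub>R a + y *\<^sub>R b) = norm (x *\<^sub>R a + y *\<^sub>R b)"
    by (metis add.assoc add_diff_cancel_left' dist_commute dist_norm)
  ultimately show ?thesis using assms by simp
qed

text \<open>Two mean value theorems, first in the direction \<open>a\<close> for the difference over
  \<open>s *\<^sub>R b\<close>, then in the direction \<open>b\<close>. The second difference does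
  not change when \<open>a\<close> and \<open>b\<close> are exchanged, so both mixed derivatives
  compute it.\<close>

lemma second_difference_mean_value:
  fixes f :: "'a::euclidean_space \<Rightarrow> real"
  assumes f: "Ck_on (Suc (Suc 0)) S f" and r: "ball p r \<subseteq> S"
    and s: "0 < s" "s * (norm a + norm b) < r"
  obtains x y where "0 < x" "x < s" "0 < y" "y < s"
    "f (p + s *\<^sub>R a + s *\<^sub>R b) - f (p + s *\<^sub>R a) - f (p + s *\<^sub>R b) + f p =
       s * s * fderiv (\<lambda>q. fderiv f q a) (p + x *\<^sub>R a + y *\<^sub>R b) b"
proof -
  have inS: "p + x *\<^sub>R a + y *\<^sub>R b \<in> S" if "0 \<le> x" "x \<le> s" "0 \<le> y" "y \<le> s" for x y
  proof -
    have "\<bar>x\<bar> * norm a + \<bar>y\<bar> * norm b \<le> s * norm a + s * norm b"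
      using that by (intro add_mono mult_right_mono) auto
    then show ?thesis
      using line_in_ball[of x a y b r p] s r by (auto simp: algebra_simps)
  qed
  have d1: "(f has_derivative fderiv f q) (at q)" if "q \<in> S" for q
    using has_fderiv[OF f that] .
  have f1: "Ck_on (Suc 0) S (\<lambda>q. fderiv f q a)"
    using f by simp
  define h where "h x = f (p + x *\<^sub>R a + s *\<^sub>R b) - f (p + x *\<^sub>R a + 0 *\<^sub>R b)" for x
  have h': "(h has_real_derivative fderiv f (p + x *\<^sub>R a + s *\<^sub>R b) a - fderiv f (p + x *\<^sub>R a + 0 *\<^sub>R b) a) (at x)"
    if "0 \<le> x" "x \<le> s" for x
  proof -
    have *: "((\<lambda>x. f (p + x *\<^sub>R a + y *\<^sub>R b)) has_real_derivative fderiv f (p + x *\<^sub>R a + y *\<^sub>R b) a) (at x)"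
      if "0 \<le> y" "y \<le> s" for y
    proof -
      have i: "p + x *\<^sub>R a + y *\<^sub>R b \<in> S" using inS \<open>0 \<le> x\<close> \<open>x \<le> s\<close> that by blast
      have "((\<lambda>x. f (p + x *\<^sub>R a + y *\<^sub>R b)) has_derivative
          (\<lambda>t. fderiv f (p + x *\<^sub>R a + y *\<^sub>R b) (t *\<^sub>R a))) (at x)"
        by (rule has_derivative_compose[where g=f and f="\<lambda>x. p + x *\<^sub>R a + y *\<^sub>R b"])
          (auto intro!: derivative_eq_intros d1 i)
      then show ?thesis
        by (rule has_derivative_imp_has_field_derivative)
          (simp only: linear_scale[OF fderiv_linear[OF f i]] real_scaleR_def)
    qed
    show ?thesis
      unfolding h_def using *[of s] *[of 0] s(1) by (intro DERIV_diff) auto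
  qed
  obtain x where x: "0 < x" "x < s"
    "h s - h 0 = (s - 0) * (fderiv f (p + x *\<^sub>R a + s *\<^sub>R b) a - fderiv f (p + x *\<^sub>R a + 0 *\<^sub>R b) a)"
    using MVT2[OF s(1) h'] by blast
  define k where "k y = fderiv f (p + x *\<^sub>R a + y *\<^sub>R b) a" for y
  have k': "(k has_real_derivative fderiv (\<lambda>q. fderiv f q a) (p + x *\<^sub>R a + y *\<^sub>R b) b) (at y)"
    if "0 \<le> y" "y \<le> s" for y
  proof -
    have i: "p + x *\<^sub>R a + y *\<^sub>R b \<in> S" using inS x that by simp
    have "((\<lambda>y. (\<lambda>q. fderiv f q a) (p + x *\<^sub>R a + y *\<^sub>R b)) has_derivative
        (\<lambda>t. fderiv (\<lambda>q. fderiv f q a) (p + x *\<^sub>R a + y *\<^sub>R b) (t *\<^sub>R b))) (at y)"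
      by (rule has_derivative_compose[where g="\<lambda>q. fderiv f q a" and f="\<lambda>y. p + x *\<^sub>R a + y *\<^sub>R b"])
        (auto intro!: derivative_eq_intros has_fderiv[OF f1 i])
    then show ?thesis
      unfolding k_def
      by (rule has_derivative_imp_has_field_derivative)
        (simp only: linear_scale[OF fderiv_linear[OF f1 i]] real_scaleR_def)
  qed
  obtain y where y: "0 < y" "y < s"
    "k s - k 0 = (s - 0) * fderiv (\<lambda>q. fderiv f q a) (p + x *\<^sub>R a + y *\<^sub>R b) b"
    using MVT2[OF s(1) k'] by blast
  have "h s - h 0 = s * (s * fderiv (\<lambda>q. fderiv f q a) (p + x *\<^sub>R a + y *\<^sub>R b) b)"
    using x(3) y(3) by (simp add: k_def)
  then show ?thesis
    using that[OF x(1,2) y(1,2)] by (simp add: h_def)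
qed

lemma second_derivative_symmetric:
  fixes f :: "'a::euclidean_space \<Rightarrow> real"
  assumes "open S" and f: "Ck_on (Suc (Suc 0)) S f" and p: "p \<in> S"
  shows "fderiv (\<lambda>q. fderiv f q a) p b = fderiv (\<lambda>q. fderiv f q b) p a"
proof (rule ccontr)
  let ?A = "\<lambda>q. fderiv (\<lambda>q. fderiv f q a) q b" and ?B = "\<lambda>q. fderiv (\<lambda>q. fderiv f q b) q a"
  assume "?A p \<noteq> ?B p"
  \<comment> \<open>Half the supposed gap: one number cannot lie within \<open>e\<close> of both
    \<open>?A p\<close> and \<open>?B p\<close>.\<close>
  define e where "e = \<bar>?A p - ?B p\<bar> / 2"
  have e: "e > 0" using \<open>?A p \<noteq> ?B p\<close> by (simp add: e_def)
  have "isCont ?A p" "isCont ?B p"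
    using f p \<open>open S\<close> by (auto simp: continuous_on_eq_continuous_at)
  then obtain d1 d2 where d: "d1 > 0" "\<And>q. dist q p < d1 \<Longrightarrow> dist (?A q) (?A p) < e"
      "d2 > 0" "\<And>q. dist q p < d2 \<Longrightarrow> dist (?B q) (?B p) < e"
    unfolding continuous_at_eps_delta using e by metis
  obtain d3 where d3: "d3 > 0" "ball p d3 \<subseteq> S"
    using \<open>open S\<close> p open_contains_ball by blast
  define r where "r = min d1 (min d2 d3)"
  have r: "r > 0" "ball p r \<subseteq> S" using d d3 by (auto simp: r_def)
  \<comment> \<open>The summand 1 keeps the denominator positive and makes the bound
    \<open>s * (norm a + norm b) < r\<close> strict.\<close>
  define s where "s = r / (norm a + norm b + 1)"
  have den: "norm a + norm b + 1 > 0" by (simp add: add_nonneg_pos)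
  have s: "0 < s" "s * (norm a + norm b) < r"
    using r den unfolding s_def by (simp, simp add: field_simps)
  then have s': "s * (norm b + norm a) < r" by (simp add: add.commute)
  obtain x y where xy: "0 < x" "x < s" "0 < y" "y < s"
    "f (p + s *\<^sub>R a + s *\<^sub>R b) - f (p + s *\<^sub>R a) - f (p + s *\<^sub>R b) + f p = s * s * ?A (p + x *\<^sub>R a + y *\<^sub>R b)"
    using second_difference_mean_value[OF f r(2) s] .
  obtain x' y' where xy': "0 < x'" "x' < s" "0 < y'" "y' < s"
    "f (p + s *\<^sub>R b + s *\<^sub>R a) - f (p + s *\<^sub>R b) - f (p + s *\<^sub>R a) + f p = s * s * ?B (p + x' *\<^sub>R b + y' *\<^sub>R a)"
    using second_difference_mean_value[OF f r(2) s(1) s'] .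
  have "s * s * ?A (p + x *\<^sub>R a + y *\<^sub>R b) = s * s * ?B (p + x' *\<^sub>R b + y' *\<^sub>R a)"
    using xy(5) xy'(5) by (simp add: algebra_simps)
  then have eq: "?A (p + x *\<^sub>R a + y *\<^sub>R b) = ?B (p + x' *\<^sub>R b + y' *\<^sub>R a)"
    using s by simp
  have b1: "x * norm a + y * norm b < r" "x' * norm b + y' * norm a < r"
  proof -
    have "x * norm a + y * norm b \<le> s * norm a + s * norm b"
      using xy by (intro add_mono mult_right_mono) auto
    then show "x * norm a + y * norm b < r" using s by (simp add: algebra_simps)
    have "x' * norm b + y' * norm a \<le> s * norm b + s * norm a"
      using xy' by (intro add_mono mult_right_mono) auto
    then show "x' * norm b + y' * norm a < r" using s by (simp add: algebra_simps)
  qed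
  have "dist (p + x *\<^sub>R a + y *\<^sub>R b) p < r" "dist (p + x' *\<^sub>R b + y' *\<^sub>R a) p < r"
    using line_in_ball[of x a y b r p] line_in_ball[of x' b y' a r p] b1 xy xy'
    by (auto simp: dist_commute)
  then have "dist (?A (p + x *\<^sub>R a + y *\<^sub>R b)) (?A p) < e" "dist (?B (p + x' *\<^sub>R b + y' *\<^sub>R a)) (?B p) < e"
    using d by (auto simp: r_def)
  then show False
    using eq e_def by (simp add: dist_real_def abs_if split: if_splits)
qed

section \<open>Charts and tangent vectors\<close>

locale smooth_mfd =
  fixes M :: "('m::{t2_space,second_countable_topology}, 'e::euclidean_space) affine_manifold"
  assumes smooth: "smooth_manifold M"
begin

lemma charts_atD: "c \<in> charts_at M x \<Longrightarrow> c \<in> atlas M" "c \<in> charts_at M x \<Longrightarrow> x \<in> dom_of c"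
  by (auto simp: charts_at_def)

lemma charts_atI: "c \<in> atlas M \<Longrightarrow> x \<in> dom_of c \<Longrightarrow> c \<in> charts_at M x"
  by (auto simp: charts_at_def)

lemma open_dom: "c \<in> atlas M \<Longrightarrow> open (dom_of c)"
  using smooth by (simp only: smooth_manifold_def)

lemma coord_homeo:
  "c \<in> atlas M \<Longrightarrow> homeomorphism (dom_of c) (coord c ` dom_of c) (coord c) (coord_inv c)"
  using smooth by (simp only: smooth_manifold_def)

lemma coord_inv_coord [simp]: "c \<in> atlas M \<Longrightarrow> y \<in> dom_of c \<Longrightarrow> coord_inv c (coord c y) = y"
  using coord_homeo by (simp add: homeomorphism_def)

lemma continuous_on_coord: "c \<in> atlas M \<Longrightarrow> continuous_on (dom_of c) (coord c)"
  using coord_homeo by (simp add: homeomorphism_def)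

lemma open_coord_image:
  assumes "c \<in> atlas M" "open U"
  shows "open (coord c ` (U \<inter> dom_of c))"
proof -
  have "openin (top_of_set (coord c ` dom_of c)) (coord c ` (dom_of c \<inter> U))"
    using assms(2) by (intro homeomorphism_imp_open_map[OF coord_homeo[OF assms(1)]] openin_open_Int)
  moreover have "open (coord c ` dom_of c)"
    using smooth assms(1) by (simp only: smooth_manifold_def)
  ultimately show ?thesis
    using openin_open_trans by (metis Int_commute)
qed

lemma open_coord_dom: "c \<in> atlas M \<Longrightarrow> open (coord c ` dom_of c)"
  using open_coord_image[of c UNIV] by simp

lemma ex_chart: "\<exists>c. c \<in> charts_at M x"
proof -
  have "x \<in> (\<Union>c\<in>atlas M. dom_of c)"
    using smooth unfolding smooth_manifold_def by blast
  then show ?thesis by (auto simp: charts_at_def)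
qed

lemma chart_at: "chart_at M x \<in> charts_at M x"
  unfolding chart_at_def using ex_chart by (rule someI_ex)

lemma transition_smooth:
  assumes "c \<in> atlas M" "d \<in> atlas M"
  shows "Ck_on k (coord c ` (dom_of c \<inter> dom_of d)) (\<lambda>p. coord d (coord_inv c p))"
proof -
  have "Ck_on k (coord c ` (dom_of c \<inter> dom_of d)) (coord d \<circ> coord_inv c)"
    using smooth assms by (simp only: smooth_manifold_def smooth_map_on_def)
  then show ?thesis by (simp add: o_def)
qed

lemma trans_deriv:
  assumes "c \<in> charts_at M x" "d \<in> charts_at M x"
  shows "((\<lambda>p. coord d (coord_inv c p)) has_derivative trans_deriv c d x) (at (coord c x))"
  using transition_differentiable[OF smooth assms]
  unfolding trans_deriv_def o_def by (simp add: frechet_derivative_works)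

lemma linear_trans_deriv:
  "c \<in> charts_at M x \<Longrightarrow> d \<in> charts_at M x \<Longrightarrow> linear (trans_deriv c d x)"
  using trans_deriv has_derivative_linear by blast

lemma trans_deriv_trans:
  assumes "c \<in> charts_at M x" "d \<in> charts_at M x" "e \<in> charts_at M x"
  shows "trans_deriv d e x (trans_deriv c d x w) = trans_deriv c e x w"
proof -
  let ?S = "coord c ` ((dom_of d \<inter> dom_of e) \<inter> dom_of c)"
  have S: "open ?S" "coord c x \<in> ?S"
    using assms by (auto simp: charts_at_def open_dom intro!: open_coord_image)
  have "((\<lambda>p. coord e (coord_inv d p)) has_derivative trans_deriv d e x)
      (at (coord d (coord_inv c (coord c x))))"
    using trans_deriv[OF assms(2,3)] assms by (simp add: charts_at_def)
  from has_derivative_compose[OF trans_deriv[OF assms(1,2)] this]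
  have "((\<lambda>p. coord e (coord_inv d (coord d (coord_inv c p)))) has_derivative
      (\<lambda>w. trans_deriv d e x (trans_deriv c d x w))) (at (coord c x))" .
  then have "((\<lambda>p. coord e (coord_inv c p)) has_derivative
      (\<lambda>w. trans_deriv d e x (trans_deriv c d x w))) (at (coord c x))"
    by (rule has_derivative_transform_within_open[OF _ S]) (use assms in \<open>auto simp: charts_at_def\<close>)
  from has_derivative_unique[OF trans_deriv[OF assms(1,3)] this] show ?thesis
    by simp
qed

lemma trans_deriv_self:
  assumes "c \<in> charts_at M x"
  shows "trans_deriv c c x w = w"
proof -
  have S: "open (coord c ` dom_of c)" "coord c x \<in> coord c ` dom_of c"
    using assms by (auto simp: charts_at_def open_coord_dom)
  have "((\<lambda>p. coord c (coord_inv c p)) has_derivative (\<lambda>w. w)) (at (coord c x))"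
    by (rule has_derivative_transform_within_open[OF has_derivative_ident S])
      (use assms in \<open>auto simp: charts_at_def\<close>)
  from has_derivative_unique[OF trans_deriv[OF assms assms] this] show ?thesis
    by simp
qed

lemma coord_field_tangent:
  "c \<in> charts_at M x \<Longrightarrow> coord_field M c w x \<in> tangent_space M x"
  by (simp add: coord_field_def tangent_space_def trans_deriv_trans)

lemma coord_field_self: "c \<in> charts_at M x \<Longrightarrow> coord_field M c w x c = w"
  by (simp add: coord_field_def trans_deriv_self)

lemma coord_field_tangent_coord:
  assumes "v \<in> tangent_space M x" "c \<in> charts_at M x"
  shows "coord_field M c (v c) x = v"
proof
  fix d
  have "d \<in> charts_at M x \<Longrightarrow> v d = trans_deriv c d x (v c)" "d \<notin> charts_at M x \<Longrightarrow> v d = 0"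
    using assms unfolding tangent_space_def by blast+
  then show "coord_field M c (v c) x d = v d"
    unfolding coord_field_def by presburger
qed

lemma coord_field_linear:
  "c \<in> charts_at M x \<Longrightarrow>
    coord_field M c (a *\<^sub>R u + b *\<^sub>R v) x = (\<lambda>d. a *\<^sub>R coord_field M c u x d + b *\<^sub>R coord_field M c v x d)"
  by (auto simp: coord_field_def fun_eq_iff linear_add[OF linear_trans_deriv]
      linear_scale[OF linear_trans_deriv])

lemma tangent_linear_comb:
  assumes "u \<in> tangent_space M x" "v \<in> tangent_space M x"
  shows "(\<lambda>c. a *\<^sub>R u c + b *\<^sub>R v c) \<in> tangent_space M x"
proof -
  let ?c = "chart_at M x"
  have "(\<lambda>c. a *\<^sub>R u c + b *\<^sub>R v c) = coord_field M ?c (a *\<^sub>R u ?c + b *\<^sub>R v ?c) x"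
    using assms by (simp only: coord_field_linear[OF chart_at] coord_field_tangent_coord[OF _ chart_at])
  then show ?thesis
    using coord_field_tangent[OF chart_at] by simp
qed

lemma tangent_scaleR: "u \<in> tangent_space M x \<Longrightarrow> (\<lambda>c. a *\<^sub>R u c) \<in> tangent_space M x"
  using tangent_linear_comb[of u x u a 0] by simp

lemma Ck_fun_onD:
  "Ck_fun_on M k U f \<Longrightarrow> c \<in> atlas M \<Longrightarrow>
    Ck_on k (coord c ` (U \<inter> dom_of c)) (\<lambda>p. f (coord_inv c p))"
  by (simp add: Ck_fun_on_def o_def)

lemma Ck_fun_on_mono: "j \<le> k \<Longrightarrow> Ck_fun_on M k U f \<Longrightarrow> Ck_fun_on M j U f"
  unfolding Ck_fun_on_def using Ck_on_mono by blast

lemma Ck_fun_on_continuous: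
  assumes "Ck_fun_on M k U f" "open U"
  shows "continuous_on U f"
proof -
  have "continuous (at x) f" if "x \<in> U" for x
  proof -
    define c where "c = chart_at M x"
    have c: "c \<in> atlas M" "x \<in> dom_of c"
      using chart_at[of x] by (auto simp: c_def charts_at_def)
    have "continuous_on (coord c ` (U \<inter> dom_of c)) (\<lambda>p. f (coord_inv c p))"
      using Ck_on_imp_continuous_on[OF Ck_fun_onD[OF assms(1) c(1)]] .
    then have "continuous_on (U \<inter> dom_of c) (\<lambda>y. f (coord_inv c (coord c y)))"
      by (rule continuous_on_compose2[OF _ continuous_on_subset[OF continuous_on_coord[OF c(1)]]]) auto
    moreover have "continuous_on (U \<inter> dom_of c) (\<lambda>y. f (coord_inv c (coord c y))) \<longleftrightarrow>
        continuous_on (U \<inter> dom_of c) f"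
      by (rule continuous_on_cong) (use c in auto)
    ultimately have "continuous_on (U \<inter> dom_of c) f"
      by simp
    then show ?thesis
      using that c assms open_dom by (simp add: continuous_on_eq_continuous_at open_Int)
  qed
  then show ?thesis
    by (simp add: continuous_at_imp_continuous_on)
qed

text \<open>The two functions have the same derivatives at \<open>x\<close> in the sense of the
  predicate \<open>has_derivative\<close>, so the choice behind \<open>frechet_derivative\<close>
  returns the same value.\<close>

lemma differential_cong:
  assumes "open U" "x \<in> U" "\<And>y. y \<in> U \<Longrightarrow> f y = g y"
  shows "differential M f x v = differential M g x v"
proof -
  let ?c = "chart_at M x"
  have c: "?c \<in> atlas M" "x \<in> dom_of ?c"
    using chart_at[of x] by (auto simp: charts_at_def)
  have S: "open (coord ?c ` (U \<inter> dom_of ?c))" "coord ?c x \<in> coord ?c ` (U \<inter> dom_of ?c)"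
    using c assms by (auto intro!: open_coord_image)
  have "(f \<circ> coord_inv ?c has_derivative D) (at (coord ?c x)) \<longleftrightarrow>
      (g \<circ> coord_inv ?c has_derivative D) (at (coord ?c x))" for D
  proof
    assume "(f \<circ> coord_inv ?c has_derivative D) (at (coord ?c x))"
    then show "(g \<circ> coord_inv ?c has_derivative D) (at (coord ?c x))"
      by (rule has_derivative_transform_within_open[OF _ S]) (use c assms(3) in auto)
  next
    assume "(g \<circ> coord_inv ?c has_derivative D) (at (coord ?c x))"
    then show "(f \<circ> coord_inv ?c has_derivative D) (at (coord ?c x))"
      by (rule has_derivative_transform_within_open[OF _ S]) (use c assms(3) in auto)
  qed
  then show ?thesis
    by (simp add: differential_def Let_def frechet_derivative_def)
qed

lemma differential_chart:
  assumes f: "Ck_fun_on M (Suc k) U f" and x: "x \<in> U" and v: "v \<in> tangent_space M x"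
    and c: "c \<in> charts_at M x"
  shows "differential M f x v = fderiv (\<lambda>p. f (coord_inv c p)) (coord c x) (v c)"
proof -
  have "(\<lambda>p. f (coord_inv d p)) differentiable at (coord d x)" if "d \<in> charts_at M x" for d
    using Ck_fun_onD[OF f, of d] that x by (auto simp: charts_at_def)
  then show ?thesis
    using differential_eq_chart[OF smooth v c, of f] by (simp add: o_def)
qed

lemma differential_linear:
  assumes f: "Ck_fun_on M (Suc k) U f" and x: "x \<in> U"
  shows "differential M f x (\<lambda>c. a *\<^sub>R u c + b *\<^sub>R v c) = a * differential M f x u + b * differential M f x v"
proof -
  let ?c = "chart_at M x"
  have c: "?c \<in> atlas M" "x \<in> dom_of ?c"
    using chart_at[of x] by (auto simp: charts_at_def)
  have "linear (fderiv (\<lambda>p. f (coord_inv ?c p)) (coord ?c x))"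
    using fderiv_linear[OF Ck_fun_onD[OF f c(1)]] c x by blast
  then show ?thesis
    by (simp add: differential_def Let_def o_def linear_add linear_scale)
qed

text \<open>In another chart \<open>d\<close> the field is represented by the derivative of the
  transition map from \<open>c\<close> to \<open>d\<close> in the fixed direction \<open>w\<close>,
  evaluated along the transition map from \<open>d\<close> to \<open>c\<close>. Both are
  smooth.\<close>

lemma smooth_field_coord_field:
  assumes c: "c \<in> atlas M"
  shows "smooth_field_on M (dom_of c) (coord_field M c w)"
  unfolding smooth_field_on_def
proof (intro conjI ballI)
  show "coord_field M c w y \<in> tangent_space M y" if "y \<in> dom_of c" for y
    using coord_field_tangent[OF charts_atI[OF c that]] .
  fix d assume d: "d \<in> atlas M"
  let ?S = "coord d ` (dom_of c \<inter> dom_of d)" and ?T = "coord c ` (dom_of c \<inter> dom_of d)"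
  have S: "open ?S" and T: "open ?T"
    using open_coord_image[OF d open_dom[OF c]] open_coord_image[OF c open_dom[OF d]]
    by (simp_all add: Int_commute)
  have "Ck_on k ?S (\<lambda>p. coord_field M c w (coord_inv d p) d)" for k
  proof (rule Ck_on_cong[OF S])
    show "Ck_on k ?S (\<lambda>p. fderiv (\<lambda>q. coord d (coord_inv c q)) (coord c (coord_inv d p)) w)"
    proof (rule Ck_on_compose[where f="\<lambda>q. fderiv (\<lambda>q. coord d (coord_inv c q)) q w", OF S T])
      show "(\<lambda>p. coord c (coord_inv d p)) ` ?S \<subseteq> ?T"
        using d by auto
      show "Ck_on k ?S (\<lambda>p. coord c (coord_inv d p))"
        using transition_smooth[OF d c] by (simp add: Int_commute)
      show "Ck_on k ?T (\<lambda>q. fderiv (\<lambda>q. coord d (coord_inv c q)) q w)"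
        using transition_smooth[OF c d, of "Suc k"] by simp
    qed
    show "fderiv (\<lambda>q. coord d (coord_inv c q)) (coord c (coord_inv d p)) w =
        coord_field M c w (coord_inv d p) d" if "p \<in> ?S" for p
      using that c d by (auto simp: coord_field_def trans_deriv_def charts_at_def o_def)
  qed
  then show "smooth_map_on ?S (\<lambda>p. coord_field M c w (coord_inv d p) d)"
    by (simp add: smooth_map_on_def)
qed

lemma smooth_field_on_cong:
  assumes "open U" "\<And>y. y \<in> U \<Longrightarrow> X y = Y y" "smooth_field_on M U X"
  shows "smooth_field_on M U Y"
  unfolding smooth_field_on_def smooth_map_on_def
proof (intro conjI ballI allI)
  show "Y y \<in> tangent_space M y" if "y \<in> U" for y
    using assms that by (auto simp: smooth_field_on_def)
  fix c k assume c: "c \<in> atlas M"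
  show "Ck_on k (coord c ` (U \<inter> dom_of c)) (\<lambda>p. Y (coord_inv c p) c)"
    by (rule Ck_on_cong[of _ "\<lambda>p. X (coord_inv c p) c"])
      (use assms c open_coord_image in \<open>auto simp: smooth_field_on_def smooth_map_on_def\<close>)
qed

lemma smooth_fun_const: "smooth_fun_on M U (\<lambda>y. r)"
  by (simp add: smooth_fun_on_def Ck_fun_on_def o_def Ck_on_const)

lemma differential_const: "differential M (\<lambda>y. r) x v = 0"
  by (simp add: differential_def o_def frechet_derivative_const)

text \<open>Torsion-freeness is formulated through the action of fields on functions; the coordinate
  functions are the ones on which it is tested in \<open>christoffel_symmetric\<close>.\<close>

lemma smooth_fun_coord:
  assumes c: "c \<in> atlas M"
  shows "smooth_fun_on M (dom_of c) (\<lambda>y. coord c y \<bullet> e)"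
  unfolding smooth_fun_on_def Ck_fun_on_def o_def
proof (intro allI ballI)
  fix k d assume d: "d \<in> atlas M"
  show "Ck_on k (coord d ` (dom_of c \<inter> dom_of d)) (\<lambda>p. coord c (coord_inv d p) \<bullet> e)"
    using open_coord_image[OF d open_dom[OF c]] transition_smooth[OF d c, of k]
    by (intro Ck_on_bounded_linear[OF _ bounded_linear_inner_left]) (simp_all add: Int_commute)
qed

lemma differential_coord:
  assumes c: "c \<in> charts_at M x" and v: "v \<in> tangent_space M x"
  shows "differential M (\<lambda>y. coord c y \<bullet> e) x v = v c \<bullet> e"
proof -
  have "Ck_fun_on M (Suc 0) (dom_of c) (\<lambda>y. coord c y \<bullet> e)"
    using smooth_fun_coord[OF charts_atD(1)[OF c]] by (simp only: smooth_fun_on_def)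
  then have *: "differential M (\<lambda>y. coord c y \<bullet> e) x v =
      fderiv (\<lambda>p. coord c (coord_inv c p) \<bullet> e) (coord c x) (v c)"
    using differential_chart[OF _ charts_atD(2)[OF c] v c] by blast
  have "((\<lambda>p. coord c (coord_inv c p) \<bullet> e) has_derivative (\<lambda>w. w \<bullet> e)) (at (coord c x))"
  proof (rule has_derivative_transform_within_open)
    show "((\<lambda>p. p \<bullet> e) has_derivative (\<lambda>w. w \<bullet> e)) (at (coord c x))"
      by (auto intro!: derivative_eq_intros)
    show "open (coord c ` dom_of c)" "coord c x \<in> coord c ` dom_of c"
      using c by (auto simp: charts_at_def open_coord_dom)
  qed (use c in \<open>auto simp: charts_at_def\<close>)
  then show ?thesis
    using frechet_derivative_at[of "\<lambda>p. coord c (coord_inv c p) \<bullet> e"] * by metis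
qed

end


section \<open>Christoffel symbols\<close>

locale connection_mfd = smooth_mfd M
  for M :: "('m::{t2_space,second_countable_topology}, 'e::euclidean_space) affine_manifold" +
  assumes conn: "is_connection M" and tf: "torsion_free M"
begin

lemma nabla_smooth_field:
  "open U \<Longrightarrow> smooth_field_on M U X \<Longrightarrow> smooth_field_on M U Y \<Longrightarrow>
    smooth_field_on M U (\<lambda>y. nabla M y (X y) Y)"
  using conn[unfolded is_connection_def, THEN conjunct1, rule_format, of U X Y] by simp

lemma christoffel_smooth:
  assumes c: "c \<in> atlas M"
  shows "Ck_on k (coord c ` dom_of c) (\<lambda>p. christoffel M c (coord_inv c p) a b)"
proof -
  have "smooth_field_on M (dom_of c) (\<lambda>y. nabla M y (coord_field M c a y) (coord_field M c b))"
    using nabla_smooth_field[OF open_dom[OF c] smooth_field_coord_field[OF c] smooth_field_coord_field[OF c]] .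
  then show ?thesis
    using c by (auto simp: smooth_field_on_def smooth_map_on_def christoffel_def)
qed

lemma nabla_coord_field:
  assumes c: "c \<in> charts_at M x"
  shows "nabla M x (coord_field M c a x) (coord_field M c b) = coord_field M c (christoffel M c x a b) x"
proof -
  have a: "c \<in> atlas M" "x \<in> dom_of c" using c by (auto simp: charts_at_def)
  have "smooth_field_on M (dom_of c) (\<lambda>y. nabla M y (coord_field M c a y) (coord_field M c b))"
    using nabla_smooth_field[OF open_dom smooth_field_coord_field smooth_field_coord_field] a by blast
  then have "nabla M x (coord_field M c a x) (coord_field M c b) \<in> tangent_space M x"
    using a by (auto simp: smooth_field_on_def)
  then show ?thesis
    using coord_field_tangent_coord[OF _ c] by (simp add: christoffel_def)
qed

lemma nabla_linear_direction:
  "open U \<Longrightarrow> x \<in> U \<Longrightarrow> smooth_field_on M U Y \<Longrightarrow> u \<in> tangent_space M x \<Longrightarrow> v \<in> tangent_space M x \<Longrightarrow>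
    nabla M x (\<lambda>c. a *\<^sub>R u c + b *\<^sub>R v c) Y = (\<lambda>c. a *\<^sub>R nabla M x u Y c + b *\<^sub>R nabla M x v Y c)"
  using conn[unfolded is_connection_def, THEN conjunct2, THEN conjunct2, THEN conjunct1, rule_format, of U x Y u v a b] by simp

lemma nabla_add:
  "open U \<Longrightarrow> x \<in> U \<Longrightarrow> smooth_field_on M U Y \<Longrightarrow> smooth_field_on M U Z \<Longrightarrow> u \<in> tangent_space M x \<Longrightarrow>
    nabla M x u (\<lambda>y c. Y y c + Z y c) = (\<lambda>c. nabla M x u Y c + nabla M x u Z c)"
  using conn[unfolded is_connection_def, THEN conjunct2, THEN conjunct2, THEN conjunct2, THEN conjunct1, rule_format, of U x Y Z u] by simp

lemma nabla_cong:
  "open U \<Longrightarrow> x \<in> U \<Longrightarrow> smooth_field_on M U Y \<Longrightarrow> smooth_field_on M U Y' \<Longrightarrow>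
    u \<in> tangent_space M x \<Longrightarrow> (\<And>y. y \<in> U \<Longrightarrow> Y y = Y' y) \<Longrightarrow> nabla M x u Y = nabla M x u Y'"
  using conn[unfolded is_connection_def, THEN conjunct2, THEN conjunct1, rule_format, of U U x u Y Y'] by simp

lemma nabla_scaleR:
  assumes "open U" "x \<in> U" "smooth_field_on M U Y" "u \<in> tangent_space M x"
  shows "nabla M x u (\<lambda>y c. r *\<^sub>R Y y c) = (\<lambda>c. r *\<^sub>R nabla M x u Y c)"
proof -
  show ?thesis
    using conn[unfolded is_connection_def, THEN conjunct2, THEN conjunct2, THEN conjunct2, THEN conjunct2,
        rule_format, of U x "\<lambda>y. r" Y u] assms
    by (simp add: smooth_fun_const differential_const)
qed

lemma linear_christoffel_1:
  assumes c: "c \<in> charts_at M x"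
  shows "linear (\<lambda>a. christoffel M c x a b)"
proof -
  have a: "c \<in> atlas M" "x \<in> dom_of c" using c by (auto simp: charts_at_def)
  have *: "christoffel M c x (r *\<^sub>R u + s *\<^sub>R v) b = r *\<^sub>R christoffel M c x u b + s *\<^sub>R christoffel M c x v b"
    for r s u v
    using nabla_linear_direction[OF open_dom[OF a(1)] a(2) smooth_field_coord_field[OF a(1)]
        coord_field_tangent[OF c] coord_field_tangent[OF c], of r u s v b]
    by (simp add: christoffel_def coord_field_linear[OF c])
  show ?thesis
    using *[of 1 _ 1] *[of _ _ 0] by (intro linearI) auto
qed

text \<open>The dependence of \<open>coord_field M c b\<close> on \<open>b\<close> is known to be
  linear on the domain of \<open>c\<close>, so locality of the connection has to be combined with
  its additivity and homogeneity.\<close>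

lemma linear_christoffel_2:
  assumes c: "c \<in> charts_at M x"
  shows "linear (\<lambda>b. christoffel M c x a b)"
proof (rule linearI)
  have A: "c \<in> atlas M" "x \<in> dom_of c" using c by (auto simp: charts_at_def)
  note sf = smooth_field_coord_field[OF A(1)] and od = open_dom[OF A(1)] and tg = coord_field_tangent[OF c]
  have cf: "coord_field M c (r *\<^sub>R u + s *\<^sub>R v) y = (\<lambda>d. r *\<^sub>R coord_field M c u y d + s *\<^sub>R coord_field M c v y d)"
    if "y \<in> dom_of c" for r s u v y
    using coord_field_linear[OF charts_atI[OF A(1) that]] .
  have cf1: "coord_field M c (u + v) y = (\<lambda>d. coord_field M c u y d + coord_field M c v y d)"
    if "y \<in> dom_of c" for u v y
    using cf[OF that, of 1 u 1 v] by simp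
  have cf2: "coord_field M c (r *\<^sub>R u) y = (\<lambda>d. r *\<^sub>R coord_field M c u y d)"
    if "y \<in> dom_of c" for r u y
    using cf[OF that, of r u 0 u] by simp
  show "christoffel M c x a (u + v) = christoffel M c x a u + christoffel M c x a v" for u v
  proof -
    have "smooth_field_on M (dom_of c) (\<lambda>y d. coord_field M c u y d + coord_field M c v y d)"
      by (rule smooth_field_on_cong[OF od cf1 sf])
    then have "nabla M x (coord_field M c a x) (coord_field M c (u + v)) =
        nabla M x (coord_field M c a x) (\<lambda>y d. coord_field M c u y d + coord_field M c v y d)"
      by (intro nabla_cong[OF od A(2) sf _ tg]) (auto simp: cf1)
    then show ?thesis
      using nabla_add[OF od A(2) sf sf tg] by (simp add: christoffel_def)
  qed
  show "christoffel M c x a (r *\<^sub>R u) = r *\<^sub>R christoffel M c x a u" for r u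
  proof -
    have "smooth_field_on M (dom_of c) (\<lambda>y d. r *\<^sub>R coord_field M c u y d)"
      by (rule smooth_field_on_cong[OF od cf2 sf])
    then have "nabla M x (coord_field M c a x) (coord_field M c (r *\<^sub>R u)) =
        nabla M x (coord_field M c a x) (\<lambda>y d. r *\<^sub>R coord_field M c u y d)"
      by (intro nabla_cong[OF od A(2) sf _ tg]) (auto simp: cf2)
    then show ?thesis
      using nabla_scaleR[OF od A(2) sf tg] by (simp add: christoffel_def)
  qed
qed

text \<open>Coordinate fields have vanishing bracket: the derivative of a coordinate function along
  one of them is constant, so both iterated derivatives in the torsion identity are zero.\<close>

lemma christoffel_symmetric:
  assumes c: "c \<in> charts_at M x"
  shows "christoffel M c x a b = christoffel M c x b a"
proof (rule euclidean_eqI)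
  fix e :: 'e
  have A: "c \<in> atlas M" "x \<in> dom_of c" using c by (auto simp: charts_at_def)
  let ?f = "\<lambda>y. coord c y \<bullet> e" and ?A = "coord_field M c a" and ?B = "coord_field M c b"
  have d0: "differential M (\<lambda>y. differential M ?f y (coord_field M c w y)) x v = 0" for w v
  proof -
    have "differential M (\<lambda>y. differential M ?f y (coord_field M c w y)) x v =
        differential M (\<lambda>y. w \<bullet> e) x v"
      by (rule differential_cong[OF open_dom[OF A(1)] A(2)])
        (use A in \<open>simp add: differential_coord coord_field_tangent coord_field_self charts_atI\<close>)
    then show ?thesis by (simp add: differential_const)
  qed
  have "differential M ?f x (\<lambda>c'. nabla M x (?A x) ?B c' - nabla M x (?B x) ?A c') =
      differential M (\<lambda>y. differential M ?f y (?B y)) x (?A x) -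
      differential M (\<lambda>y. differential M ?f y (?A y)) x (?B x)"
    using tf open_dom[OF A(1)] smooth_field_coord_field[OF A(1)] smooth_fun_coord[OF A(1)] A(2)
    unfolding torsion_free_def by blast
  also have "\<dots> = 0" by (simp add: d0)
  finally have *: "differential M ?f x (\<lambda>c'. nabla M x (?A x) ?B c' - nabla M x (?B x) ?A c') = 0" .
  have "(\<lambda>c'. nabla M x (?A x) ?B c' - nabla M x (?B x) ?A c') \<in> tangent_space M x"
    using tangent_linear_comb[OF coord_field_tangent[OF c] coord_field_tangent[OF c], of 1 _ "-1"]
    by (simp add: nabla_coord_field[OF c])
  from differential_coord[OF c this, of e]
  show "christoffel M c x a b \<bullet> e = christoffel M c x b a \<bullet> e"
    using * by (simp add: nabla_coord_field[OF c] coord_field_self[OF c] inner_diff_left)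
qed

end

section \<open>Calculus on intervals\<close>

lemma at_within_Icc_interior: "a < x \<Longrightarrow> x < b \<Longrightarrow> at x within {a..b} = at (x::real)"
  by (rule at_within_interior) simp

lemma deriv_nonneg_Icc_imp_le:
  fixes f :: "real \<Rightarrow> real"
  assumes "a \<le> b" "\<And>t. t \<in> {a..b} \<Longrightarrow> (f has_real_derivative f' t) (at t within {a..b})"
    and "\<And>t. t \<in> {a..b} \<Longrightarrow> 0 \<le> f' t"
  shows "f a \<le> f b"
proof (rule DERIV_nonneg_imp_increasing_open[OF assms(1)])
  show "\<exists>y. (f has_real_derivative y) (at x) \<and> 0 \<le> y" if "a < x" "x < b" for x
    using assms(2,3)[of x] that at_within_Icc_interior[OF that] by auto
  show "continuous_on {a..b} f"
    using assms(2) DERIV_continuous_on by blast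
qed

lemma deriv_le_Icc_imp_diff_le:
  fixes f g :: "real \<Rightarrow> real"
  assumes "a \<le> b" "\<And>t. t \<in> {a..b} \<Longrightarrow> (f has_real_derivative f' t) (at t within {a..b})"
    and "\<And>t. t \<in> {a..b} \<Longrightarrow> (g has_real_derivative g' t) (at t within {a..b})"
    and "\<And>t. t \<in> {a..b} \<Longrightarrow> f' t \<le> g' t"
  shows "f b - f a \<le> g b - g a"
proof -
  have "g a - f a \<le> g b - f b"
    by (rule deriv_nonneg_Icc_imp_le[OF assms(1) DERIV_diff[OF assms(3,2)]]) (use assms(4) in auto)
  then show ?thesis by simp
qed

lemma deriv_zero_Icc_imp_eq:
  fixes f :: "real \<Rightarrow> real"
  assumes "a \<le> b" "\<And>t. t \<in> {a..b} \<Longrightarrow> (f has_real_derivative 0) (at t within {a..b})"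
  shows "f b = f a"
  using deriv_le_Icc_imp_diff_le[of a b f "\<lambda>_. 0" "\<lambda>_. 0" "\<lambda>_. 0"]
    deriv_le_Icc_imp_diff_le[of a b "\<lambda>_. 0" "\<lambda>_. 0" f "\<lambda>_. 0"] assms by auto

lemma has_real_derivative_transform_Icc:
  fixes f g :: "real \<Rightarrow> real"
  assumes "(f has_real_derivative f') (at t within I)" "0 < d" "t \<in> I"
    and "\<And>s. s \<in> I \<Longrightarrow> dist s t < d \<Longrightarrow> f s = g s"
  shows "(g has_real_derivative f') (at t within I)"
  using assms unfolding has_field_derivative_def
  by (rule has_derivative_transform_within)

text \<open>A product rule that only asks for the derivative of \<open>P\<close> at each fixed
  vector: in a basis, \<open>P s (a s)\<close> is a finite sum of products of real functions.
  Expanding the increment \<open>a s - a t\<close> makes the sum vanish at \<open>t\<close>, so only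
  \<open>a'\<close> survives in its derivative.\<close>

lemma has_real_derivative_linear_family:
  fixes P :: "real \<Rightarrow> 'a::euclidean_space \<Rightarrow> real"
  assumes "0 < d" "t \<in> I" and lin: "\<And>s. s \<in> I \<Longrightarrow> dist s t < d \<Longrightarrow> linear (P s)"
    and P': "\<And>a. ((\<lambda>s. P s a) has_real_derivative P' a) (at t within I)"
    and a': "(a has_vector_derivative a') (at t within I)"
  shows "((\<lambda>s. P s (a s)) has_real_derivative P' (a t) + P t a') (at t within I)"
proof -
  have c: "((\<lambda>s. (a s - a t) \<bullet> i) has_real_derivative a' \<bullet> i) (at t within I)" for i
    unfolding has_real_derivative_iff_has_vector_derivative
    using bounded_linear.has_vector_derivative[OF bounded_linear_inner_left a', of i]
    by (auto simp: inner_diff_left intro!: derivative_eq_intros)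
  have "((\<lambda>s. P s (a t) + (\<Sum>i\<in>Basis. ((a s - a t) \<bullet> i) * P s i)) has_real_derivative
      P' (a t) + (\<Sum>i\<in>Basis. (a' \<bullet> i) * P t i)) (at t within I)"
    by (rule derivative_eq_intros P' c refl | simp)+
  moreover have "(\<Sum>i\<in>Basis. (a' \<bullet> i) * P t i) = P t a'"
    using linear_euclidean_expansion[OF lin[of t], of a'] assms(1,2) by simp
  moreover have "P s (a t) + (\<Sum>i\<in>Basis. ((a s - a t) \<bullet> i) * P s i) = P s (a s)"
    if "s \<in> I" "dist s t < d" for s
  proof -
    have "(\<Sum>i\<in>Basis. ((a s - a t) \<bullet> i) * P s i) = P s (a s - a t)"
      using linear_euclidean_expansion[OF lin[OF that], of "a s - a t"] by simp
    then show ?thesis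
      using linear_diff[OF lin[OF that]] by simp
  qed
  ultimately show ?thesis
    using has_real_derivative_transform_Icc[OF _ assms(1,2)] by (metis (mono_tags, lifting))
qed

lemma has_real_derivative_bilinear_family:
  fixes B :: "real \<Rightarrow> 'a::euclidean_space \<Rightarrow> 'a \<Rightarrow> real"
  assumes "0 < d" "t \<in> I"
    and lin1: "\<And>s b. s \<in> I \<Longrightarrow> dist s t < d \<Longrightarrow> linear (\<lambda>a. B s a b)"
    and lin2: "\<And>s a. s \<in> I \<Longrightarrow> dist s t < d \<Longrightarrow> linear (B s a)"
    and B': "\<And>a b. ((\<lambda>s. B s a b) has_real_derivative B' a b) (at t within I)"
    and a': "(a has_vector_derivative a') (at t within I)"
    and b': "(b has_vector_derivative b') (at t within I)"
  shows "((\<lambda>s. B s (a s) (b s)) has_real_derivative B' (a t) (b t) + B t a' (b t) + B t (a t) b')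
    (at t within I)"
proof -
  have 1: "((\<lambda>s. B s (a s) v) has_real_derivative B' (a t) v + B t a' v) (at t within I)" for v
    by (rule has_real_derivative_linear_family[where P="\<lambda>s a. B s a v", OF assms(1,2) lin1 B' a'])
  have "((\<lambda>s. B s (a s) (b s)) has_real_derivative (B' (a t) (b t) + B t a' (b t)) + B t (a t) b')
    (at t within I)"
    by (rule has_real_derivative_linear_family[where P="\<lambda>s. B s (a s)" and P'="\<lambda>v. B' (a t) v + B t a' v",
        OF assms(1,2) lin2 1 b'])
  then show ?thesis .
qed

text \<open>Gronwall's argument for the squared distance \<open>z\<close> of positions and
  velocities: its derivative is at most \<open>K * z\<close>, so \<open>z t * exp (- K * t)\<close>
  starts at 0 and cannot increase.\<close>

lemma second_order_ode_unique:
  fixes q1 q2 v1 v2 :: "real \<Rightarrow> 'a::real_inner"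
  assumes L: "0 \<le> L"
    and q: "\<And>t. t \<in> {a..b} \<Longrightarrow> (q1 has_vector_derivative v1 t) (at t within {a..b})"
      "\<And>t. t \<in> {a..b} \<Longrightarrow> (q2 has_vector_derivative v2 t) (at t within {a..b})"
    and v: "\<And>t. t \<in> {a..b} \<Longrightarrow> (v1 has_vector_derivative g1 t) (at t within {a..b})"
      "\<And>t. t \<in> {a..b} \<Longrightarrow> (v2 has_vector_derivative g2 t) (at t within {a..b})"
    and lip: "\<And>t. t \<in> {a..b} \<Longrightarrow> norm (g1 t - g2 t) \<le> L * (norm (q1 t - q2 t) + norm (v1 t - v2 t))"
    and init: "q1 a = q2 a" "v1 a = v2 a" and s: "s \<in> {a..b}"
  shows "q1 s = q2 s"
proof -
  define Q where "Q = (\<lambda>t. q1 t - q2 t)"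
  define V where "V = (\<lambda>t. v1 t - v2 t)"
  define z where "z = (\<lambda>t. Q t \<bullet> Q t + V t \<bullet> V t)"
  \<comment> \<open>With q and v the norms of \<open>Q\<close> and \<open>V\<close>, the first term
    of the derivative is at most q^2 + v^2 and the second at most 2 L (q v + v^2), hence at most 3 L
    (q^2 + v^2).\<close>
  define K where "K = 1 + 3 * L"
  have Q': "(Q has_vector_derivative V t) (at t within {a..s})"
    and V': "(V has_vector_derivative g1 t - g2 t) (at t within {a..s})" if "t \<in> {a..s}" for t
  proof -
    have "(Q has_vector_derivative V t) (at t within {a..b})"
      "(V has_vector_derivative g1 t - g2 t) (at t within {a..b})"
      unfolding Q_def V_def using that s by (intro has_vector_derivative_diff q v; simp)+
    then show "(Q has_vector_derivative V t) (at t within {a..s})"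
      "(V has_vector_derivative g1 t - g2 t) (at t within {a..s})"
      using s by (auto intro: has_vector_derivative_within_subset)
  qed
  have inner': "((\<lambda>t. X t \<bullet> X t) has_real_derivative 2 * (X t \<bullet> x)) (at t within {a..s})"
    if "(X has_vector_derivative x) (at t within {a..s})" for X x and t :: real
    using has_derivative_inner[OF that[unfolded has_vector_derivative_def] that[unfolded has_vector_derivative_def]]
    unfolding has_field_derivative_def
    by (rule has_derivative_eq_rhs) (auto simp: fun_eq_iff inner_commute algebra_simps)
  have z': "(z has_real_derivative 2 * (Q t \<bullet> V t) + 2 * (V t \<bullet> (g1 t - g2 t))) (at t within {a..s})"
    if "t \<in> {a..s}" for t
    unfolding z_def by (intro DERIV_add inner' Q' V' that)
  have bound: "2 * (Q t \<bullet> V t) + 2 * (V t \<bullet> (g1 t - g2 t)) \<le> K * z t" if "t \<in> {a..s}" for t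
  proof -
    let ?q = "norm (Q t)" and ?v = "norm (V t)"
    have "V t \<bullet> (g1 t - g2 t) \<le> ?v * (L * (?q + ?v))"
      unfolding Q_def V_def
      by (rule order_trans[OF norm_cauchy_schwarz mult_left_mono[OF lip]]) (use that s in auto)
    moreover have "Q t \<bullet> V t \<le> ?q * ?v" by (rule norm_cauchy_schwarz)
    moreover have qv: "2 * (?q * ?v) \<le> ?q\<^sup>2 + ?v\<^sup>2"
      using sum_squares_bound[of ?q ?v] by (simp add: mult.assoc)
    moreover have "L * (2 * (?q * ?v)) \<le> L * (?q\<^sup>2 + ?v\<^sup>2)"
      by (rule mult_left_mono[OF qv L])
    moreover have "z t = ?q\<^sup>2 + ?v\<^sup>2" by (simp add: z_def power2_norm_eq_inner)
    moreover have "0 \<le> L * ?q\<^sup>2" using L by simp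
    ultimately show ?thesis
      unfolding K_def by (simp add: algebra_simps power2_eq_square)
  qed
  have "- (z s * exp (- K * s)) \<ge> - (z a * exp (- K * a))"
  proof (rule deriv_nonneg_Icc_imp_le[where f="\<lambda>t. - (z t * exp (- K * t))"])
    show "a \<le> s" using s by simp
    fix t assume t: "t \<in> {a..s}"
    show "((\<lambda>t. - (z t * exp (- K * t))) has_real_derivative
        (K * z t - (2 * (Q t \<bullet> V t) + 2 * (V t \<bullet> (g1 t - g2 t)))) * exp (- K * t)) (at t within {a..s})"
      by (rule derivative_eq_intros z'[OF t] refl | simp add: algebra_simps)+
    show "0 \<le> (K * z t - (2 * (Q t \<bullet> V t) + 2 * (V t \<bullet> (g1 t - g2 t)))) * exp (- K * t)"
      using bound[OF t] by simp
  qed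
  moreover have "z a = 0" by (simp add: z_def Q_def V_def init)
  ultimately have "z s \<le> 0" by (simp add: mult_le_0_iff)
  moreover have "z s \<ge> Q s \<bullet> Q s" by (simp add: z_def)
  ultimately have "(norm (Q s))\<^sup>2 \<le> 0" by (simp add: power2_norm_eq_inner)
  then show ?thesis by (simp add: Q_def)
qed

lemma bilinear_euclidean_expansion:
  fixes f :: "'a::euclidean_space \<Rightarrow> 'a \<Rightarrow> 'b::real_vector"
  assumes "\<And>b. linear (\<lambda>a. f a b)" "\<And>a. linear (f a)"
  shows "f a b = (\<Sum>i\<in>Basis. \<Sum>j\<in>Basis. ((a \<bullet> i) * (b \<bullet> j)) *\<^sub>R f i j)"
proof -
  have "f a b = (\<Sum>i\<in>Basis. (a \<bullet> i) *\<^sub>R f i b)"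
    by (rule linear_euclidean_expansion[OF assms(1)])
  also have "\<dots> = (\<Sum>i\<in>Basis. (a \<bullet> i) *\<^sub>R (\<Sum>j\<in>Basis. (b \<bullet> j) *\<^sub>R f i j))"
    using linear_euclidean_expansion[OF assms(2), of _ b] by simp
  finally show ?thesis
    by (simp add: scaleR_sum_right)
qed

lemma bilinear_norm_le:
  fixes f :: "'a::euclidean_space \<Rightarrow> 'a \<Rightarrow> 'b::real_normed_vector"
  assumes "\<And>b. linear (\<lambda>a. f a b)" "\<And>a. linear (f a)"
    and "\<And>i j. i \<in> Basis \<Longrightarrow> j \<in> Basis \<Longrightarrow> norm (f i j) \<le> C i j"
  shows "norm (f a b) \<le> (\<Sum>i\<in>Basis. \<Sum>j\<in>Basis. C i j) * (norm a * norm b)"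
proof -
  have "norm (((a \<bullet> i) * (b \<bullet> j)) *\<^sub>R f i j) \<le> C i j * (norm a * norm b)"
    if "i \<in> Basis" "j \<in> Basis" for i j
  proof -
    have "\<bar>a \<bullet> i\<bar> * \<bar>b \<bullet> j\<bar> * norm (f i j) \<le> norm a * norm b * C i j"
      using that assms(3)[OF that] by (intro mult_mono) (auto simp: Basis_le_norm)
    then show ?thesis by (simp add: abs_mult algebra_simps)
  qed
  then show ?thesis
    unfolding bilinear_euclidean_expansion[OF assms(1,2), of a b] sum_distrib_right
    by (intro order_trans[OF norm_sum] sum_mono order_trans[OF norm_sum])
qed

text \<open>The difference splits into a change of the base point, controlled by L0 R^2, and a
  change of the vector, controlled by 2 B0 R through \<open>G q (u - v) u + G q v (u - v)\<close>.
  In the application \<open>G\<close> is the family of Christoffel symbols in a chart.\<close>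

lemma quadratic_family_lipschitz:
  fixes G :: "'a::euclidean_space \<Rightarrow> 'a \<Rightarrow> 'a \<Rightarrow> 'b::real_normed_vector"
  assumes K: "compact K" "convex K" "K \<subseteq> S"
    and l: "\<And>q b. q \<in> S \<Longrightarrow> linear (\<lambda>a. G q a b)" "\<And>q a. q \<in> S \<Longrightarrow> linear (G q a)"
    and G: "\<And>a b. Ck_on (Suc 0) S (\<lambda>q. G q a b)" and R: "0 \<le> R"
  obtains L where "0 \<le> L" "\<And>p q u v. p \<in> K \<Longrightarrow> q \<in> K \<Longrightarrow> norm u \<le> R \<Longrightarrow> norm v \<le> R \<Longrightarrow>
    norm (G p u u - G q v v) \<le> L * (norm (p - q) + norm (u - v))"
proof -
  have "\<exists>L\<ge>0. \<forall>x\<in>K. \<forall>y\<in>K. norm (G x i j - G y i j) \<le> L * norm (x - y)" for i j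
    using Ck_on_lipschitz[OF G[of i j] K] by metis
  then obtain L1 where L1: "\<And>i j. 0 \<le> L1 i j"
      "\<And>i j x y. x \<in> K \<Longrightarrow> y \<in> K \<Longrightarrow> norm (G x i j - G y i j) \<le> L1 i j * norm (x - y)"
    by metis
  have "\<exists>B\<ge>0. \<forall>x\<in>K. norm (G x i j) \<le> B" for i j
  proof -
    have "continuous_on K (\<lambda>q. G q i j)"
      using Ck_on_imp_continuous_on[OF Ck_on_subset[OF G K(3)]] .
    then have "bounded ((\<lambda>q. G q i j) ` K)"
      using compact_continuous_image K(1) compact_imp_bounded by blast
    then show ?thesis
      unfolding bounded_pos by (meson imageI less_imp_le)
  qed
  then obtain B1 where B1: "\<And>i j. 0 \<le> B1 i j" "\<And>i j x. x \<in> K \<Longrightarrow> norm (G x i j) \<le> B1 i j"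
    by metis
  define L0 where "L0 = (\<Sum>i\<in>Basis. \<Sum>j\<in>Basis. L1 i j)"
  define B0 where "B0 = (\<Sum>i\<in>Basis. \<Sum>j\<in>Basis. B1 i j)"
  have nn: "0 \<le> L0" "0 \<le> B0" by (auto simp: L0_def B0_def L1 B1 intro!: sum_nonneg)
  define L where "L = L0 * R\<^sup>2 + 2 * B0 * R"
  have "norm (G p u u - G q v v) \<le> L * (norm (p - q) + norm (u - v))"
    if pq: "p \<in> K" "q \<in> K" and uv: "norm u \<le> R" "norm v \<le> R" for p q u v
  proof -
    have S: "p \<in> S" "q \<in> S" using pq K by auto
    have "norm (G p u u - G q u u) \<le> (\<Sum>i\<in>Basis. \<Sum>j\<in>Basis. L1 i j * norm (p - q)) * (norm u * norm u)"
      by (rule bilinear_norm_le[where f="\<lambda>a b. G p a b - G q a b"])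
        (auto intro!: linear_compose_sub l S L1 pq)
    also have "\<dots> = (L0 * norm (p - q)) * (norm u * norm u)"
      by (simp add: L0_def sum_distrib_right)
    also have "\<dots> \<le> (L0 * norm (p - q)) * (R * R)"
      using uv nn R by (intro mult_left_mono mult_mono) auto
    finally have 1: "norm (G p u u - G q u u) \<le> L0 * R\<^sup>2 * norm (p - q)"
      by (simp add: power2_eq_square algebra_simps)
    have b: "norm (G q a b) \<le> B0 * (norm a * norm b)" for a b
      unfolding B0_def by (rule bilinear_norm_le) (auto intro: l S B1 pq)
    have "G q u u - G q v v = G q (u - v) u + G q v (u - v)"
      using linear_diff[OF l(1)[OF S(2)]] linear_diff[OF l(2)[OF S(2)]] by simp
    also have "norm \<dots> \<le> B0 * (norm (u - v) * norm u) + B0 * (norm v * norm (u - v))"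
      by (intro order_trans[OF norm_triangle_ineq] add_mono b)
    also have "\<dots> \<le> B0 * (norm (u - v) * R) + B0 * (R * norm (u - v))"
      using uv nn by (intro add_mono mult_left_mono mult_right_mono) auto
    finally have 2: "norm (G q u u - G q v v) \<le> 2 * B0 * R * norm (u - v)"
      by (simp add: algebra_simps)
    have "norm (G p u u - G q v v) \<le> norm (G p u u - G q u u) + norm (G q u u - G q v v)"
      by (metis norm_triangle_ineq diff_add_cancel add_diff_eq)
    also have "\<dots> \<le> L0 * R\<^sup>2 * norm (p - q) + 2 * B0 * R * norm (u - v)"
      using 1 2 by simp
    also have "\<dots> \<le> L * norm (p - q) + L * norm (u - v)"
      unfolding L_def using nn R by (intro add_mono mult_right_mono) auto
    finally show ?thesis by (simp add: algebra_simps)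
  qed
  moreover have "0 \<le> L" using nn R by (simp add: L_def)
  ultimately show ?thesis using that by blast
qed


text \<open>Continuous induction: at the supremum T of the times up to which \<open>P\<close> holds,
  \<open>limit\<close> gives P at T, and \<open>step\<close> would lead beyond T if T < 1. It serves
  both for uniqueness of geodesics and for showing that a geodesic stays in the domain.\<close>

lemma unit_interval_continuation:
  fixes P :: "real \<Rightarrow> bool"
  assumes 0: "P 0"
    and limit: "\<And>T. 0 < T \<Longrightarrow> T \<le> 1 \<Longrightarrow> (\<And>r. r \<in> {0..<T} \<Longrightarrow> P r) \<Longrightarrow> P T"
    and step: "\<And>T. 0 \<le> T \<Longrightarrow> T < 1 \<Longrightarrow> (\<And>r. r \<in> {0..T} \<Longrightarrow> P r) \<Longrightarrow>
      \<exists>d>0. \<forall>r\<in>{T..T + d}. r \<le> 1 \<longrightarrow> P r"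
    and t: "t \<in> {0..1}"
  shows "P t"
proof -
  define A where "A = {s \<in> {0..1}. \<forall>r\<in>{0..s}. P r}"
  define T where "T = Sup A"
  have A0: "0 \<in> A" using 0 by (auto simp: A_def)
  have bdd: "bdd_above A" by (rule bdd_aboveI[of _ 1]) (auto simp: A_def)
  have T01: "0 \<le> T" "T \<le> 1"
  proof -
    show "0 \<le> T" unfolding T_def by (rule cSup_upper[OF A0 bdd])
    show "T \<le> 1" unfolding T_def using A0 by (intro cSup_least) (blast, auto simp: A_def)
  qed
  have below: "P r" if r: "r \<in> {0..<T}" for r
  proof -
    obtain s where "s \<in> A" "r < s"
      using r less_cSupD[of A r] A0 unfolding T_def by auto
    then show ?thesis using r by (auto simp: A_def)
  qed
  have "P T"
    using 0 limit[OF _ T01(2) below] T01(1) by (cases "T = 0") auto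
  then have TA: "P r" if "r \<in> {0..T}" for r
    using that below[of r] by (cases "r = T") auto
  have "T = 1"
  proof (rule ccontr)
    assume "T \<noteq> 1"
    then have T1: "T < 1" using T01 by simp
    obtain d where d: "0 < d" "\<And>r. r \<in> {T..T + d} \<Longrightarrow> r \<le> 1 \<Longrightarrow> P r"
      using step[OF T01(1) T1 TA] by blast
    define e where "e = min d (1 - T)"
    have e: "0 < e" "e \<le> d" "T + e \<le> 1" using d(1) T1 by (auto simp: e_def)
    have "P r" if "r \<in> {0..T + e}" for r
      using that TA[of r] d(2)[of r] e by (cases "r \<le> T") auto
    then have "T + e \<in> A" using e T01 by (simp add: A_def)
    then show False
      using cSup_upper[OF _ bdd, of "T + e"] e(1) by (simp add: T_def)
  qed
  then show ?thesis using TA t by simp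
qed


section \<open>Geodesics\<close>

text \<open>The derivative is taken within \<open>I\<close>, which makes it one-sided at the end
  points of an interval. The value 0 in the other charts follows the convention of
  \<open>tangent_space\<close>.\<close>

definition velocity ::
  "('m, 'e::euclidean_space) affine_manifold \<Rightarrow> (real \<Rightarrow> 'm) \<Rightarrow> real set \<Rightarrow> real \<Rightarrow> ('m, 'e) tangent" where
  "velocity M \<gamma> I t =
     (\<lambda>c. if c \<in> charts_at M (\<gamma> t) then vector_derivative (\<lambda>s. coord c (\<gamma> s)) (at t within I) else 0)"

lemma has_vector_derivative_unique_Icc:
  fixes f :: "real \<Rightarrow> 'a::euclidean_space"
  assumes "a < b" "t \<in> {a..b}" "(f has_vector_derivative f') (at t within {a..b})"
    "(f has_vector_derivative f'') (at t within {a..b})"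
  shows "f' = f''"
  using assms vector_derivative_unique_within_closed_interval[of a b t f f' f''] by (simp add: cbox_interval)

lemma has_vector_derivative_chain:
  assumes "(f has_vector_derivative f') (at t within I)" "(g has_derivative g') (at (f t))"
  shows "((\<lambda>s. g (f s)) has_vector_derivative g' f') (at t within I)"
  using vector_derivative_diff_chain_within[OF assms(1) has_derivative_at_withinI[OF assms(2)]]
  by (simp add: o_def)

lemma geodesic_subinterval:
  assumes "geodesic M {a..b} \<gamma>" "a \<le> a'" "b' \<le> b"
  shows "geodesic M {a'..b'} \<gamma>"
proof -
  have sub: "{a'..b'} \<subseteq> {a..b}" using assms by auto
  show ?thesis
    unfolding geodesic_def
  proof (intro conjI ballI)
    show "continuous_on {a'..b'} \<gamma>"
      using assms(1) sub continuous_on_subset[of "{a..b}" \<gamma>] unfolding geodesic_def by blast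
    fix c assume "c \<in> atlas M"
    then obtain g where "\<forall>t\<in>{a..b}. \<gamma> t \<in> dom_of c \<longrightarrow>
        ((coord c \<circ> \<gamma>) has_vector_derivative g t) (at t within {a..b}) \<and>
        (g has_vector_derivative - christoffel M c (\<gamma> t) (g t) (g t)) (at t within {a..b})"
      using assms(1) unfolding geodesic_def by meson
    then show "\<exists>g. \<forall>t\<in>{a'..b'}. \<gamma> t \<in> dom_of c \<longrightarrow>
        ((coord c \<circ> \<gamma>) has_vector_derivative g t) (at t within {a'..b'}) \<and>
        (g has_vector_derivative - christoffel M c (\<gamma> t) (g t) (g t)) (at t within {a'..b'})"
      using sub has_vector_derivative_within_subset by (intro exI[of _ g]) blast
  qed
qed

context smooth_mfd
begin

lemma geodesic_near:
  assumes "geodesic M I \<gamma>" "t \<in> I" "open U" "\<gamma> t \<in> U"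
  obtains d where "0 < d" "\<And>s. s \<in> I \<Longrightarrow> dist s t < d \<Longrightarrow> \<gamma> s \<in> U"
proof -
  have "(\<gamma> \<longlongrightarrow> \<gamma> t) (at t within I)"
    using assms by (auto simp: geodesic_def continuous_on_def)
  then have "eventually (\<lambda>s. \<gamma> s \<in> U) (at t within I)"
    using assms(3,4) topological_tendstoD by blast
  then obtain d where "0 < d" "\<forall>s\<in>I. s \<noteq> t \<and> dist s t < d \<longrightarrow> \<gamma> s \<in> U"
    unfolding eventually_at by blast
  then show ?thesis
    using that[of d] assms(4) by metis
qed

text \<open>\<open>geodesic\<close> provides a derivative for each chart separately; uniqueness of
  derivatives on an interval of positive length identifies it with the single family
  \<open>velocity\<close>.\<close>

lemma geodesic_velocity:
  assumes g: "geodesic M {a..b} \<gamma>" and ab: "a < b" and t: "t \<in> {a..b}" and c: "c \<in> charts_at M (\<gamma> t)"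
  shows "((\<lambda>s. coord c (\<gamma> s)) has_vector_derivative velocity M \<gamma> {a..b} t c) (at t within {a..b})" (is ?v)
    and "((\<lambda>s. velocity M \<gamma> {a..b} s c) has_vector_derivative
      - christoffel M c (\<gamma> t) (velocity M \<gamma> {a..b} t c) (velocity M \<gamma> {a..b} t c)) (at t within {a..b})" (is ?a)
proof -
  have A: "c \<in> atlas M" "\<gamma> t \<in> dom_of c" using c by (auto simp: charts_at_def)
  obtain g where g': "\<And>t. t \<in> {a..b} \<Longrightarrow> \<gamma> t \<in> dom_of c \<Longrightarrow>
        ((\<lambda>s. coord c (\<gamma> s)) has_vector_derivative g t) (at t within {a..b}) \<and>
        (g has_vector_derivative - christoffel M c (\<gamma> t) (g t) (g t)) (at t within {a..b})"
    using g A(1) unfolding geodesic_def o_def by meson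
  have eq: "velocity M \<gamma> {a..b} s c = g s" if "s \<in> {a..b}" "\<gamma> s \<in> dom_of c" for s
    unfolding velocity_def
    using vector_derivative_within_closed_interval[OF ab that(1) conjunct1[OF g'[OF that]]]
      charts_atI[OF A(1) that(2)]
    by simp
  show ?v using g'[OF t A(2)] eq[OF t A(2)] by simp
  obtain d where d: "0 < d" "\<And>s. s \<in> {a..b} \<Longrightarrow> dist s t < d \<Longrightarrow> \<gamma> s \<in> dom_of c"
    using geodesic_near[OF g t open_dom[OF A(1)] A(2)] by blast
  have "(g has_vector_derivative - christoffel M c (\<gamma> t) (g t) (g t)) (at t within {a..b})"
    using g'[OF t A(2)] by simp
  then have "((\<lambda>s. velocity M \<gamma> {a..b} s c) has_vector_derivative - christoffel M c (\<gamma> t) (g t) (g t)) (at t within {a..b})"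
    by (rule has_vector_derivative_transform_within[OF _ d(1) t]) (use eq d in simp)
  then show ?a using eq[OF t A(2)] by simp
qed

lemma velocity_eqI:
  assumes "a < b" "t \<in> {a..b}" "v \<in> tangent_space M (\<gamma> t)"
    and "\<And>c. c \<in> charts_at M (\<gamma> t) \<Longrightarrow> ((\<lambda>s. coord c (\<gamma> s)) has_vector_derivative v c) (at t within {a..b})"
  shows "velocity M \<gamma> {a..b} t = v"
proof
  fix c
  show "velocity M \<gamma> {a..b} t c = v c"
  proof (cases "c \<in> charts_at M (\<gamma> t)")
    case True
    then show ?thesis
      using vector_derivative_within_closed_interval[OF assms(1,2) assms(4)[OF True]]
      by (simp add: velocity_def)
  next
    case False
    then have "v c = 0"
      using assms(3) unfolding tangent_space_def by blast
    then show ?thesis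
      using False by (simp add: velocity_def)
  qed
qed

lemma velocity_tangent:
  assumes g: "geodesic M {a..b} \<gamma>" and ab: "a < b" and t: "t \<in> {a..b}"
  shows "velocity M \<gamma> {a..b} t \<in> tangent_space M (\<gamma> t)"
proof -
  have "velocity M \<gamma> {a..b} t d = trans_deriv c d (\<gamma> t) (velocity M \<gamma> {a..b} t c)"
    if c: "c \<in> charts_at M (\<gamma> t)" and d: "d \<in> charts_at M (\<gamma> t)" for c d
  proof -
    have A: "c \<in> atlas M" "\<gamma> t \<in> dom_of c" using c by (auto simp: charts_at_def)
    obtain e where e: "0 < e" "\<And>s. s \<in> {a..b} \<Longrightarrow> dist s t < e \<Longrightarrow> \<gamma> s \<in> dom_of c"
      using geodesic_near[OF g t open_dom[OF A(1)] A(2)] by blast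
    have "((\<lambda>s. coord d (coord_inv c (coord c (\<gamma> s)))) has_vector_derivative
        trans_deriv c d (\<gamma> t) (velocity M \<gamma> {a..b} t c)) (at t within {a..b})"
      by (rule has_vector_derivative_chain[where g="\<lambda>p. coord d (coord_inv c p)",
            OF geodesic_velocity(1)[OF g ab t c] trans_deriv[OF c d]])
    then have "((\<lambda>s. coord d (\<gamma> s)) has_vector_derivative
        trans_deriv c d (\<gamma> t) (velocity M \<gamma> {a..b} t c)) (at t within {a..b})"
      by (rule has_vector_derivative_transform_within[OF _ e(1) t]) (use A e in simp)
    then show ?thesis
      using has_vector_derivative_unique_Icc[OF ab t geodesic_velocity(1)[OF g ab t d]] by simp
  qed
  moreover have "velocity M \<gamma> {a..b} t c = 0" if "c \<notin> charts_at M (\<gamma> t)" for c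
    using that by (simp add: velocity_def)
  ultimately show ?thesis
    unfolding tangent_space_def by blast
qed

lemma velocity_subinterval:
  assumes g: "geodesic M {a..b} \<gamma>" and ab: "a \<le> a'" "a' < b'" "b' \<le> b" and t: "t \<in> {a'..b'}"
  shows "velocity M \<gamma> {a'..b'} t = velocity M \<gamma> {a..b} t"
proof (rule velocity_eqI[OF ab(2) t])
  have t': "t \<in> {a..b}" "a < b" using ab t by auto
  show "velocity M \<gamma> {a..b} t \<in> tangent_space M (\<gamma> t)"
    using velocity_tangent[OF g t'(2,1)] .
  show "((\<lambda>s. coord c (\<gamma> s)) has_vector_derivative velocity M \<gamma> {a..b} t c) (at t within {a'..b'})"
    if "c \<in> charts_at M (\<gamma> t)" for c
    using geodesic_velocity(1)[OF g t'(2,1) that] ab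
    by (auto intro: has_vector_derivative_within_subset)
qed

lemma geodesic_chain:
  assumes g: "geodesic M {a..b} \<gamma>" and ab: "a < b" and t: "t \<in> {a..b}"
    and f: "Ck_fun_on M (Suc k) U f" and U: "\<gamma> t \<in> U"
  shows "((\<lambda>s. f (\<gamma> s)) has_real_derivative differential M f (\<gamma> t) (velocity M \<gamma> {a..b} t)) (at t within {a..b})"
proof -
  define c where "c = chart_at M (\<gamma> t)"
  have c: "c \<in> charts_at M (\<gamma> t)" by (simp add: c_def chart_at)
  have A: "c \<in> atlas M" "\<gamma> t \<in> dom_of c" using c by (auto simp: charts_at_def)
  obtain e where e: "0 < e" "\<And>s. s \<in> {a..b} \<Longrightarrow> dist s t < e \<Longrightarrow> \<gamma> s \<in> dom_of c"
    using geodesic_near[OF g t open_dom[OF A(1)] A(2)] by blast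
  have "((\<lambda>p. f (coord_inv c p)) has_derivative fderiv (\<lambda>p. f (coord_inv c p)) (coord c (\<gamma> t))) (at (coord c (\<gamma> t)))"
    using has_fderiv[OF Ck_fun_onD[OF f A(1)]] U A by blast
  from has_vector_derivative_chain[where g="\<lambda>p. f (coord_inv c p)", OF geodesic_velocity(1)[OF g ab t c] this]
  have "((\<lambda>s. f (coord_inv c (coord c (\<gamma> s)))) has_vector_derivative
      fderiv (\<lambda>p. f (coord_inv c p)) (coord c (\<gamma> t)) (velocity M \<gamma> {a..b} t c)) (at t within {a..b})" .
  then have "((\<lambda>s. f (\<gamma> s)) has_vector_derivative
      fderiv (\<lambda>p. f (coord_inv c p)) (coord c (\<gamma> t)) (velocity M \<gamma> {a..b} t c)) (at t within {a..b})"
    by (rule has_vector_derivative_transform_within[OF _ e(1) t]) (use A e in simp)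
  then show ?thesis
    using differential_chart[OF f U velocity_tangent[OF g ab t] c]
    by (simp add: has_real_derivative_iff_has_vector_derivative)
qed

end

context connection_mfd
begin

text \<open>The geodesic equation is quadratic in the velocity, so its right-hand side is Lipschitz
  only on bounded sets. Near \<open>T\<close> both curves stay over a closed coordinate ball with
  velocities bounded by \<open>R\<close>, and there \<open>second_order_ode_unique\<close>
  applies.\<close>

lemma geodesic_local_unique:
  assumes g: "geodesic M {a..b} \<gamma>" "geodesic M {a..b} \<eta>" and T: "a \<le> T" "T < b"
    and eq: "\<gamma> T = \<eta> T" "velocity M \<gamma> {a..b} T = velocity M \<eta> {a..b} T"
  obtains d where "0 < d" "T + d \<le> b" "\<And>s. s \<in> {T..T + d} \<Longrightarrow> \<gamma> s = \<eta> s"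
proof -
  define c where "c = chart_at M (\<gamma> T)"
  have c: "c \<in> charts_at M (\<gamma> T)" by (simp add: c_def chart_at)
  have A: "c \<in> atlas M" "\<gamma> T \<in> dom_of c" using c by (auto simp: charts_at_def)
  have ab: "a < b" "T \<in> {a..b}" using T by auto
  define S where "S = coord c ` dom_of c"
  have oS: "open S" using open_coord_dom[OF A(1)] by (simp add: S_def)
  define p where "p = coord c (\<gamma> T)"
  obtain r where r: "0 < r" "cball p r \<subseteq> S"
    using oS A(2) open_contains_cball by (metis S_def image_eqI p_def)
  define V where "V \<equiv> \<lambda>\<gamma> s. velocity M \<gamma> {a..b} s c"
  \<comment> \<open>The common velocity at \<open>T\<close> lies strictly below \<open>R\<close>, so
    by continuity both velocities remain below it for a short time.\<close>
  define R where "R = norm (V \<gamma> T) + 1"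
  obtain L where L: "0 \<le> L" "\<And>p' q u v. p' \<in> cball p r \<Longrightarrow> q \<in> cball p r \<Longrightarrow> norm u \<le> R \<Longrightarrow> norm v \<le> R \<Longrightarrow>
      norm (christoffel M c (coord_inv c p') u u - christoffel M c (coord_inv c q) v v)
        \<le> L * (norm (p' - q) + norm (u - v))"
  proof (rule quadratic_family_lipschitz[where G="\<lambda>q. christoffel M c (coord_inv c q)"
        and K="cball p r" and S=S and R=R])
    show "linear (\<lambda>a. christoffel M c (coord_inv c q) a b)" "linear (christoffel M c (coord_inv c q) b)"
      if "q \<in> S" for q b
      using that A by (auto simp: S_def intro!: linear_christoffel_1 linear_christoffel_2 charts_atI)
    show "Ck_on (Suc 0) S (\<lambda>q. christoffel M c (coord_inv c q) a b)" for a b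
      unfolding S_def by (rule christoffel_smooth[OF A(1)])
  qed (use r in \<open>auto simp: R_def\<close>)
  have near: "\<exists>d>0. \<forall>s\<in>{a..b}. dist s T < d \<longrightarrow>
      \<gamma> s \<in> dom_of c \<and> coord c (\<gamma> s) \<in> cball p r \<and> norm (V \<gamma> s) \<le> R"
    if g: "geodesic M {a..b} \<gamma>" and cT: "c \<in> charts_at M (\<gamma> T)" "coord c (\<gamma> T) = p" "norm (V \<gamma> T) + 1 = R" for \<gamma>
  proof -
    have "((\<lambda>s. coord c (\<gamma> s)) \<longlongrightarrow> p) (at T within {a..b})"
      using has_vector_derivative_continuous[OF geodesic_velocity(1)[OF g ab cT(1)]] cT(2)
      by (simp add: continuous_within)
    then have e1: "eventually (\<lambda>s. dist (coord c (\<gamma> s)) p < r) (at T within {a..b})"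
      using r(1) tendstoD by blast
    have "((\<lambda>s. norm (V \<gamma> s)) \<longlongrightarrow> norm (V \<gamma> T)) (at T within {a..b})"
      using has_vector_derivative_continuous[OF geodesic_velocity(2)[OF g ab cT(1)]]
      by (auto simp: continuous_within V_def intro: tendsto_norm)
    then have e2: "eventually (\<lambda>s. norm (V \<gamma> s) < R) (at T within {a..b})"
      using cT(3) by (intro order_tendstoD(2)) auto
    have "\<gamma> T \<in> dom_of c" using cT by (simp add: charts_at_def)
    obtain d1 where d1: "0 < d1" "\<And>s. s \<in> {a..b} \<Longrightarrow> dist s T < d1 \<Longrightarrow> \<gamma> s \<in> dom_of c"
      using geodesic_near[OF g ab(2) open_dom[OF A(1)] \<open>\<gamma> T \<in> dom_of c\<close>] by blast
    obtain d2 where d2: "0 < d2" "\<And>s. s \<in> {a..b} \<Longrightarrow> s \<noteq> T \<Longrightarrow> dist s T < d2 \<Longrightarrow>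
        dist (coord c (\<gamma> s)) p < r \<and> norm (V \<gamma> s) < R"
      using eventually_conj[OF e1 e2] unfolding eventually_at by auto
    have "\<gamma> s \<in> dom_of c \<and> coord c (\<gamma> s) \<in> cball p r \<and> norm (V \<gamma> s) \<le> R"
      if "s \<in> {a..b}" "dist s T < min d1 d2" for s
      using that d1(2)[of s] d2(2)[of s] cT r(1) by (cases "s = T") (auto simp: dist_commute)
    then show ?thesis
      using d1 d2 by (intro exI[of _ "min d1 d2"]) auto
  qed
  have VV: "V \<eta> T = V \<gamma> T" using eq by (simp add: V_def)
  obtain d1 where d1: "d1 > 0" "\<And>s. s \<in> {a..b} \<Longrightarrow> dist s T < d1 \<Longrightarrow>
      \<gamma> s \<in> dom_of c \<and> coord c (\<gamma> s) \<in> cball p r \<and> norm (V \<gamma> s) \<le> R"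
    using near[OF g(1)] c by (auto simp: p_def R_def)
  obtain d2 where d2: "d2 > 0" "\<And>s. s \<in> {a..b} \<Longrightarrow> dist s T < d2 \<Longrightarrow>
      \<eta> s \<in> dom_of c \<and> coord c (\<eta> s) \<in> cball p r \<and> norm (V \<eta> s) \<le> R"
    using near[OF g(2)] c eq VV by (auto simp: p_def R_def)
  \<comment> \<open>Halving makes the distances to \<open>T\<close> strictly smaller than
    \<open>d1\<close> and \<open>d2\<close>; the other bound keeps the interval inside
    \<open>{a..b}\<close>.\<close>
  define d where "d = min (min d1 d2 / 2) (b - T)"
  have d: "0 < d" "T + d \<le> b" using d1 d2 T by (auto simp: d_def)
  have inI: "s \<in> {a..b}" "dist s T < d1" "dist s T < d2" if "s \<in> {T..T + d}" for s
    using that T d1(1) d2(1) by (auto simp: d_def dist_real_def min_def split: if_splits)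
  have "coord c (\<gamma> s) = coord c (\<eta> s)" if s: "s \<in> {T..T + d}" for s
  proof (rule second_order_ode_unique[where ?v1.0="V \<gamma>" and ?v2.0="V \<eta>" and L=L and a=T and b="T + d"
        and ?g1.0="\<lambda>t. - christoffel M c (\<gamma> t) (V \<gamma> t) (V \<gamma> t)"
        and ?g2.0="\<lambda>t. - christoffel M c (\<eta> t) (V \<eta> t) (V \<eta> t)"])
    have sub: "{T..T + d} \<subseteq> {a..b}" using T d by auto
    fix t assume t: "t \<in> {T..T + d}"
    have cg: "c \<in> charts_at M (\<gamma> t)" "c \<in> charts_at M (\<eta> t)"
      using d1(2)[OF inI(1,2)[OF t]] d2(2)[OF inI(1,3)[OF t]] A(1) by (auto simp: charts_at_def)
    show "((\<lambda>s. coord c (\<gamma> s)) has_vector_derivative V \<gamma> t) (at t within {T..T + d})"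
      "((\<lambda>s. coord c (\<eta> s)) has_vector_derivative V \<eta> t) (at t within {T..T + d})"
      "(V \<gamma> has_vector_derivative - christoffel M c (\<gamma> t) (V \<gamma> t) (V \<gamma> t)) (at t within {T..T + d})"
      "(V \<eta> has_vector_derivative - christoffel M c (\<eta> t) (V \<eta> t) (V \<eta> t)) (at t within {T..T + d})"
      unfolding V_def
      using geodesic_velocity[OF g(1) ab(1) inI(1)[OF t] cg(1)] geodesic_velocity[OF g(2) ab(1) inI(1)[OF t] cg(2)]
        has_vector_derivative_within_subset[OF _ sub] by blast+
    have "norm (christoffel M c (coord_inv c (coord c (\<gamma> t))) (V \<gamma> t) (V \<gamma> t)
        - christoffel M c (coord_inv c (coord c (\<eta> t))) (V \<eta> t) (V \<eta> t))
      \<le> L * (norm (coord c (\<gamma> t) - coord c (\<eta> t)) + norm (V \<gamma> t - V \<eta> t))"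
      using d1(2)[OF inI(1,2)[OF t]] d2(2)[OF inI(1,3)[OF t]] by (intro L(2)) auto
    then show "norm (- christoffel M c (\<gamma> t) (V \<gamma> t) (V \<gamma> t) - - christoffel M c (\<eta> t) (V \<eta> t) (V \<eta> t))
      \<le> L * (norm (coord c (\<gamma> t) - coord c (\<eta> t)) + norm (V \<gamma> t - V \<eta> t))"
      using cg A by (simp add: charts_at_def norm_minus_commute)
  qed (use L(1) eq VV s in auto)
  then have "\<gamma> s = \<eta> s" if "s \<in> {T..T + d}" for s
    using d1(2)[OF inI(1,2)[OF that]] d2(2)[OF inI(1,3)[OF that]] coord_inv_coord[OF A(1)] that by metis
  then show ?thesis using that d by blast
qed

text \<open>Agreement before T passes to T because the space is Hausdorff, and beyond T by local
  uniqueness.\<close>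

lemma geodesic_unique:
  assumes g: "geodesic M {0..1} \<gamma>" "geodesic M {0..1} \<eta>"
    and eq: "\<gamma> 0 = \<eta> 0" "velocity M \<gamma> {0..1} 0 = velocity M \<eta> {0..1} 0"
    and s: "s \<in> {0..1}"
  shows "\<gamma> s = \<eta> s"
proof (rule unit_interval_continuation[where P="\<lambda>s. \<gamma> s = \<eta> s", OF eq(1) _ _ s])
  fix T :: real assume T: "0 < T" "T \<le> 1" and below: "\<And>r. r \<in> {0..<T} \<Longrightarrow> \<gamma> r = \<eta> r"
  have nt: "at T within {0..<T} \<noteq> bot"
    using T by (simp add: at_within_eq_bot_iff)
  have lim0: "(\<gamma> \<longlongrightarrow> \<gamma> T) (at T within {0..1})" "(\<eta> \<longlongrightarrow> \<eta> T) (at T within {0..1})"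
    using g T by (auto simp: geodesic_def continuous_on_def)
  have sub: "{0..<T} \<subseteq> {0..1}" using T by auto
  note lim = tendsto_within_subset[OF lim0(1) sub] tendsto_within_subset[OF lim0(2) sub]
  have "eventually (\<lambda>s. \<gamma> s = \<eta> s) (at T within {0..<T})"
    using below by (auto simp: eventually_at intro!: exI[of _ 1])
  then have "(\<eta> \<longlongrightarrow> \<gamma> T) (at T within {0..<T})"
    by (rule Lim_transform_eventually[OF lim(1)])
  then show "\<gamma> T = \<eta> T" using lim(2) nt tendsto_unique by blast
next
  fix T :: real assume T01: "0 \<le> T" "T < 1" and TA: "\<And>r. r \<in> {0..T} \<Longrightarrow> \<gamma> r = \<eta> r"
  have atT: "\<gamma> T = \<eta> T" using TA T01 by simp
  \<comment> \<open>For T > 0 the velocity at T is already determined by the curves on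
    \<open>{0..T}\<close>, where they coincide; at T = 0 it is given.\<close>
  have vel: "velocity M \<gamma> {0..1} T = velocity M \<eta> {0..1} T"
  proof (cases "T = 0")
    case False
    then have T: "0 < T" using T01 by simp
    have "velocity M \<gamma> {0..T} T = velocity M \<eta> {0..T} T"
    proof (rule velocity_eqI)
      show "0 < T" "T \<in> {0..T}" using T by auto
      have ge: "geodesic M {0..T} \<eta>" using geodesic_subinterval[OF g(2)] T01 by simp
      show "velocity M \<eta> {0..T} T \<in> tangent_space M (\<gamma> T)"
        using velocity_tangent[OF ge] T atT by simp
      fix c assume "c \<in> charts_at M (\<gamma> T)"
      then have "((\<lambda>s. coord c (\<eta> s)) has_vector_derivative velocity M \<eta> {0..T} T c) (at T within {0..T})"
        using geodesic_velocity(1)[OF ge] T atT by simp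
      then show "((\<lambda>s. coord c (\<gamma> s)) has_vector_derivative velocity M \<eta> {0..T} T c) (at T within {0..T})"
        by (rule has_vector_derivative_transform_within[of _ _ _ _ 1]) (use TA T in auto)
    qed
    then show ?thesis
      using velocity_subinterval[OF g(1), of 0 T T] velocity_subinterval[OF g(2), of 0 T T] T T01 by simp
  qed (use eq in simp)
  show "\<exists>d>0. \<forall>r\<in>{T..T + d}. r \<le> 1 \<longrightarrow> \<gamma> r = \<eta> r"
    using geodesic_local_unique[OF g T01 atT vel] by metis
qed

end


section \<open>The exponential map\<close>

locale admissible_mfd = connection_mfd M
  for M :: "('m::{t2_space,second_countable_topology}, 'e::euclidean_space) affine_manifold" +
  assumes geodesics_exist: "v \<in> tangent_space M x \<Longrightarrow> \<exists>\<gamma>. geodesic_from M x v \<gamma>"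
    and exp_map_surj: "exp_map M x ` tangent_space M x = UNIV"
begin

lemma geodesic_from_velocity:
  assumes "geodesic_from M x v \<gamma>" "v \<in> tangent_space M x"
  shows "velocity M \<gamma> {0..1} 0 = v"
  using assms by (intro velocity_eqI[of 0 1 0]) (auto simp: geodesic_from_def has_velocity_def o_def)

text \<open>Uniqueness of geodesics is what gives the definite description in \<open>exp_map\<close>
  its value.\<close>

lemma exp_map_eq:
  assumes "geodesic_from M x v \<gamma>" "v \<in> tangent_space M x"
  shows "exp_map M x v = \<gamma> 1"
  unfolding exp_map_def
proof (rule the_equality)
  show "\<exists>\<gamma>'. geodesic_from M x v \<gamma>' \<and> \<gamma>' 1 = \<gamma> 1" using assms by blast
  show "y = \<gamma> 1" if "\<exists>\<gamma>. geodesic_from M x v \<gamma> \<and> \<gamma> 1 = y" for y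
  proof -
    from that obtain \<eta> where \<eta>: "geodesic_from M x v \<eta>" "\<eta> 1 = y" by blast
    have "\<eta> 1 = \<gamma> 1"
      using geodesic_unique[of \<eta> \<gamma> 1] \<eta>(1) assms
        geodesic_from_velocity[OF \<eta>(1) assms(2)] geodesic_from_velocity[OF assms]
      by (simp add: geodesic_from_def)
    then show ?thesis using \<eta> by simp
  qed
qed

lemma geodesic_exp:
  assumes "v \<in> tangent_space M x"
  obtains \<gamma> where "geodesic M {0..1} \<gamma>" "\<gamma> 0 = x" "\<gamma> 1 = exp_map M x v" "velocity M \<gamma> {0..1} 0 = v"
proof -
  obtain \<gamma> where \<gamma>: "geodesic_from M x v \<gamma>" using geodesics_exist[OF assms] by blast
  then show ?thesis
    using that[of \<gamma>] exp_map_eq[OF \<gamma> assms] geodesic_from_velocity[OF \<gamma> assms]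
    by (auto simp: geodesic_from_def)
qed

lemma geodesic_between:
  obtains \<gamma> where "geodesic M {0..1} \<gamma>" "\<gamma> 0 = x" "\<gamma> 1 = y"
proof -
  obtain v where "v \<in> tangent_space M x" "exp_map M x v = y"
    using exp_map_surj[of x] by (metis UNIV_I imageE)
  then show ?thesis using geodesic_exp[of v x] that by metis
qed

end

section \<open>Differentiating the dual of a quadratic form\<close>

lemma has_real_derivative_zero_squeeze:
  fixes f k :: "real \<Rightarrow> real"
  assumes k: "(k has_real_derivative 0) (at t within I)" "k t = 0" and f: "f t = 0"
    and d: "0 < d" "\<And>s. s \<in> I \<Longrightarrow> dist s t < d \<Longrightarrow> \<bar>f s\<bar> \<le> C * k s"
  shows "(f has_real_derivative 0) (at t within I)"
proof -
  have lim: "((\<lambda>s. \<bar>C\<bar> * \<bar>k s / (s - t)\<bar>) \<longlongrightarrow> \<bar>C\<bar> * \<bar>0\<bar>) (at t within I)"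
    using k unfolding has_field_derivative_iff by (intro tendsto_intros) simp
  have ev: "eventually (\<lambda>s. norm (f s / (s - t)) \<le> \<bar>C\<bar> * \<bar>k s / (s - t)\<bar>) (at t within I)"
    unfolding eventually_at
  proof (intro exI conjI ballI impI)
    fix s assume s: "s \<in> I" "s \<noteq> t \<and> dist s t < d"
    have "\<bar>f s\<bar> \<le> \<bar>C\<bar> * \<bar>k s\<bar>"
      using d(2)[of s] s abs_ge_self[of "C * k s"] by (simp add: abs_mult)
    then show "norm (f s / (s - t)) \<le> \<bar>C\<bar> * \<bar>k s / (s - t)\<bar>"
      by (simp add: abs_mult divide_right_mono)
  qed (rule d(1))
  have "((\<lambda>s. f s / (s - t)) \<longlongrightarrow> 0) (at t within I)"
    by (rule Lim_null_comparison[OF ev]) (use lim in simp)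
  then show ?thesis
    unfolding has_field_derivative_iff using f by simp
qed

text \<open>\<open>m\<close> is the minimum of the form on the unit sphere, attained by compactness;
  homogeneity of degree two carries the bound to all vectors.\<close>

lemma positive_definite_coercive:
  fixes B :: "'a::euclidean_space \<Rightarrow> 'a \<Rightarrow> real"
  assumes lin: "\<And>b. linear (\<lambda>a. B a b)" "\<And>a. linear (B a)" and pos: "\<And>a. a \<noteq> 0 \<Longrightarrow> 0 < B a a"
  obtains m where "0 < m" "\<And>a. m * (norm a)\<^sup>2 \<le> B a a"
proof -
  have B_eq: "B a a = (\<Sum>i\<in>Basis. \<Sum>j\<in>Basis. ((a \<bullet> i) * (a \<bullet> j)) * B i j)" for a
    using bilinear_euclidean_expansion[OF lin, of a a] by simp
  have "continuous_on (sphere 0 1) (\<lambda>a. B a a)"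
    unfolding B_eq by (intro continuous_intros)
  moreover have "(SOME b. b \<in> Basis) \<in> sphere (0::'a) 1"
    using SOME_Basis by simp
  ultimately obtain a0 where a0: "a0 \<in> sphere 0 1" "\<And>a. a \<in> sphere 0 1 \<Longrightarrow> B a0 a0 \<le> B a a"
    using continuous_attains_inf[of "sphere (0::'a) 1" "\<lambda>a. B a a"] compact_sphere by blast
  have "B a0 a0 * (norm a)\<^sup>2 \<le> B a a" for a
  proof (cases "a = 0")
    case True
    then show ?thesis using linear_0[OF lin(1), of 0] by simp
  next
    case False
    define b where "b = a /\<^sub>R norm a"
    have ab: "norm a *\<^sub>R b = a" using False by (simp add: b_def)
    have "B a a = B (norm a *\<^sub>R b) (norm a *\<^sub>R b)" by (simp only: ab)
    also have "\<dots> = norm a * (norm a * B b b)"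
      by (simp only: linear_scale[OF lin(1)] linear_scale[OF lin(2)] real_scaleR_def)
    finally have *: "B a a = B b b * (norm a)\<^sup>2"
      by (simp only: power2_eq_square ac_simps)
    show ?thesis
      unfolding * using a0(2)[of b] False by (intro mult_right_mono) (auto simp: b_def)
  qed
  moreover have "a0 \<noteq> 0" using a0(1) by auto
  ultimately show ?thesis using that pos by blast
qed

text \<open>With \<open>h = W s - W t\<close> one has \<open>P s (W s) = 2 P s (W t) - B s (W t) (W t) + B s h h\<close>, and
  coercivity of \<open>B\<close> near \<open>t\<close> makes the last term quadratically small; so \<open>W\<close> itself need not be
  differentiated.\<close>

lemma has_real_derivative_dual_quadratic:
  fixes B :: "real \<Rightarrow> 'a::euclidean_space \<Rightarrow> 'a \<Rightarrow> real"
  assumes d: "0 < d" "t \<in> I"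
    and lin: "\<And>s b. s \<in> I \<Longrightarrow> dist s t < d \<Longrightarrow> linear (\<lambda>a. B s a b)"
    and sym: "\<And>s a b. s \<in> I \<Longrightarrow> dist s t < d \<Longrightarrow> B s a b = B s b a"
    and pos: "\<And>s a. s \<in> I \<Longrightarrow> dist s t < d \<Longrightarrow> a \<noteq> 0 \<Longrightarrow> 0 < B s a a"
    and linP: "\<And>s. s \<in> I \<Longrightarrow> dist s t < d \<Longrightarrow> linear (P s)"
    and W: "\<And>s a. s \<in> I \<Longrightarrow> dist s t < d \<Longrightarrow> B s (W s) a = P s a"
    and B': "\<And>a b. ((\<lambda>s. B s a b) has_real_derivative B' a b) (at t within I)"
    and P': "\<And>a. ((\<lambda>s. P s a) has_real_derivative P' a) (at t within I)"
  shows "((\<lambda>s. P s (W s)) has_real_derivative 2 * P' (W t) - B' (W t) (W t)) (at t within I)"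
proof -
  have lin2: "linear (B s a)" if "s \<in> I" "dist s t < d" for s a
  proof -
    have "B s a = (\<lambda>b. B s b a)" using sym[OF that] by auto
    then show ?thesis using lin[OF that] by simp
  qed
  have t: "t \<in> I" "dist t t < d" using d by auto
  obtain m where m: "0 < m" "\<And>a. m * (norm a)\<^sup>2 \<le> B t a a"
    using positive_definite_coercive[OF lin[OF t] lin2[OF t] pos[OF t]] by blast
  \<comment> \<open>Entrywise distance of \<open>B s\<close> from \<open>B t\<close>: once it is at
    most m / 2, the form \<open>B s\<close> keeps half of the coercivity of
    \<open>B t\<close>.\<close>
  define N where "N s = (\<Sum>i\<in>Basis. \<Sum>j\<in>Basis. \<bar>B s i j - B t i j\<bar>)" for s
  have "((\<lambda>s. B s i j) \<longlongrightarrow> B t i j) (at t within I)" for i j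
    using DERIV_continuous[OF B'[of i j]] by (simp add: continuous_within)
  then have "(N \<longlongrightarrow> (\<Sum>i\<in>(Basis::'a set). \<Sum>j\<in>(Basis::'a set). \<bar>B t i j - B t i j\<bar>)) (at t within I)"
    unfolding N_def by (intro tendsto_intros)
  then have "eventually (\<lambda>s. N s < m / 2) (at t within I)"
    using m(1) by (intro order_tendstoD(2)) auto
  then obtain d1 where d1: "0 < d1" "\<And>s. s \<in> I \<Longrightarrow> s \<noteq> t \<Longrightarrow> dist s t < d1 \<Longrightarrow> N s < m / 2"
    unfolding eventually_at by blast
  define e where "e = min d d1"
  have e: "0 < e" "\<And>s. dist s t < e \<Longrightarrow> dist s t < d" using d d1 by (auto simp: e_def)
  have Nt: "N t = 0" by (simp add: N_def)
  have Ne: "N s \<le> m / 2" if "s \<in> I" "dist s t < e" for s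
    using that d1(2)[of s] m(1) Nt by (cases "s = t") (auto simp: e_def)
  have coercive: "m / 2 * (norm a)\<^sup>2 \<le> B s a a" if s: "s \<in> I" "dist s t < e" for s a
  proof -
    note s' = s(1) e(2)[OF s(2)]
    have "norm (B s a a - B t a a) \<le> N s * (norm a * norm a)"
      unfolding N_def
      by (rule bilinear_norm_le[where f="\<lambda>a b. B s a b - B t a b"])
        (auto intro!: linear_compose_sub lin lin2 s' t)
    also have "\<dots> \<le> m / 2 * (norm a * norm a)"
      using Ne[OF s] by (intro mult_right_mono) auto
    finally show ?thesis
      using m(2)[of a] by (simp add: power2_eq_square abs_if split: if_splits)
  qed
  define w where "w = W t"
  define h where "h s = W s - w" for s
  define R where "R s a = P s a - B s w a" for s a
  define k where "k s = (\<Sum>i\<in>Basis. R s i * R s i)" for s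
  have R': "((\<lambda>s. R s a) has_real_derivative P' a - B' w a) (at t within I)" for a
    unfolding R_def by (intro DERIV_diff P' B')
  have Rt: "R t a = 0" for a using W[OF t] by (simp add: R_def w_def)
  have k': "(k has_real_derivative 0) (at t within I)"
    unfolding k_def by (rule derivative_eq_intros R' refl | simp add: Rt)+
  have BR: "B s (h s) a = R s a" if "s \<in> I" "dist s t < d" for s a
    using linear_diff[OF lin[OF that]] W[OF that] by (simp add: h_def R_def)
  \<comment> \<open>The vector \<open>g\<close> represents \<open>R s\<close>. Coercivity and
    Cauchy-Schwarz bound the norm of \<open>h s\<close> by 2 / m times that of \<open>g\<close>, so
    the form at \<open>h s\<close> is at most 2 / m times the squared norm of \<open>g\<close>,
    which is \<open>k s\<close>.\<close>
  have small: "\<bar>B s (h s) (h s)\<bar> \<le> (2 / m) * k s" if s: "s \<in> I" "dist s t < e" for s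
  proof -
    note s' = s(1) e(2)[OF s(2)]
    define g where "g = (\<Sum>i\<in>Basis. R s i *\<^sub>R i)"
    have linR: "linear (R s)"
      unfolding R_def by (intro linear_compose_sub linP lin2 s')
    have "g \<bullet> h s = (\<Sum>i\<in>Basis. (h s \<bullet> i) *\<^sub>R R s i)"
      by (simp add: g_def inner_sum_left inner_commute[of "h s"] mult.commute)
    then have "B s (h s) (h s) = g \<bullet> h s"
      using BR[OF s'] linear_euclidean_expansion[OF linR, of "h s"] by simp
    then have Bg: "B s (h s) (h s) \<le> norm g * norm (h s)"
      using norm_cauchy_schwarz by simp
    have co: "m / 2 * (norm (h s))\<^sup>2 \<le> B s (h s) (h s)" by (rule coercive[OF s])
    have hg: "m / 2 * norm (h s) \<le> norm g"
    proof (cases "norm (h s) = 0")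
      case False
      then have "0 < norm (h s)" by simp
      moreover have "m / 2 * norm (h s) * norm (h s) \<le> norm g * norm (h s)"
        using Bg co by (simp add: power2_eq_square)
      ultimately show ?thesis by (simp only: mult_le_cancel_right_pos)
    qed simp
    have "g \<bullet> i = R s i" if "i \<in> Basis" for i
      unfolding g_def using that by (rule inner_sum_left_Basis)
    then have "k s = (norm g)\<^sup>2"
      unfolding power2_norm_eq_inner k_def euclidean_inner[of g g] by (intro sum.cong) simp_all
    moreover have "norm g * norm (h s) \<le> norm g * (2 / m * norm g)"
      using hg m(1) by (intro mult_left_mono) (auto simp: field_simps)
    moreover have "0 \<le> B s (h s) (h s)"
      using order_trans[OF _ co, of 0] m(1) by simp
    ultimately show ?thesis
      using Bg by (simp add: power2_eq_square algebra_simps)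
  qed
  have Bh': "((\<lambda>s. B s (h s) (h s)) has_real_derivative 0) (at t within I)"
  proof (rule has_real_derivative_zero_squeeze[OF k' _ _ e(1) small])
    show "k t = 0" by (simp add: k_def Rt)
    show "B t (h t) (h t) = 0" by (simp add: BR[OF t] Rt)
  qed auto
  have "((\<lambda>s. 2 * P s w - B s w w + B s (h s) (h s)) has_real_derivative 2 * P' w - B' w w + 0) (at t within I)"
    by (intro DERIV_add DERIV_diff DERIV_cmult P' B' Bh')
  then have "((\<lambda>s. P s (W s)) has_real_derivative 2 * P' w - B' w w + 0) (at t within I)"
  proof (rule has_real_derivative_transform_Icc[OF _ d])
    fix s assume s: "s \<in> I" "dist s t < d"
    have "B s (h s) (h s) = R s (W s) - R s w"
      using BR[OF s] linear_diff[OF linP[OF s]] linear_diff[OF lin2[OF s]] by (simp add: R_def h_def)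
    also have "R s (W s) = P s (W s) - P s w"
      using W[OF s, of w] sym[OF s, of w "W s"] by (simp add: R_def)
    finally show "2 * P s w - B s w w + B s (h s) (h s) = P s (W s)"
      by (simp add: R_def)
  qed
  then show ?thesis by (simp add: w_def)
qed


section \<open>The Hessian in coordinates\<close>

lemma fderiv_cong_open:
  assumes "open S" "x \<in> S" "\<And>y. y \<in> S \<Longrightarrow> f y = g y"
  shows "fderiv f x = fderiv g x"
proof -
  have "(f has_derivative D) (at x) \<longleftrightarrow> (g has_derivative D) (at x)" for D
    using has_derivative_transform_within_open[OF _ assms(1,2), of f D UNIV g]
      has_derivative_transform_within_open[OF _ assms(1,2), of g D UNIV f] assms(3) by auto
  then show ?thesis by (simp add: frechet_derivative_def)
qed

context connection_mfd
begin

abbreviation loc :: "('m \<Rightarrow> real) \<Rightarrow> ('m, 'e) chart \<Rightarrow> 'e \<Rightarrow> real" where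
  "loc f c \<equiv> (\<lambda>p. f (coord_inv c p))"

text \<open>The chart picked by \<open>chart_at\<close> may change from point to point along a
  geodesic, while derivatives in the parameter need one fixed chart; hence the component formula in
  an arbitrary chart.\<close>

definition coord_Hess :: "('m \<Rightarrow> real) \<Rightarrow> ('m, 'e) chart \<Rightarrow> 'm \<Rightarrow> 'e \<Rightarrow> 'e \<Rightarrow> real" where
  "coord_Hess f c x a b =
     fderiv (\<lambda>p. fderiv (loc f c) p b) (coord c x) a - fderiv (loc f c) (coord c x) (christoffel M c x a b)"

lemma coord_Hess_symmetric:
  assumes f: "Ck_fun_on M (Suc (Suc k)) U f" "open U" "x \<in> U" and c: "c \<in> charts_at M x"
  shows "coord_Hess f c x a b = coord_Hess f c x b a"
proof -
  have A: "c \<in> atlas M" "x \<in> dom_of c" using c by (auto simp: charts_at_def)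
  have "Ck_on (Suc (Suc 0)) (coord c ` (U \<inter> dom_of c)) (loc f c)"
    using Ck_fun_onD[OF Ck_fun_on_mono[OF _ f(1)] A(1), of "Suc (Suc 0)"] by (simp del: Ck_on.simps)
  then show ?thesis
    unfolding coord_Hess_def christoffel_symmetric[OF c, of a b]
    using second_derivative_symmetric[OF open_coord_image[OF A(1) f(2)], of "loc f c" "coord c x" b a] A f(3)
    by auto
qed

lemma linear_coord_Hess:
  assumes f: "Ck_fun_on M (Suc (Suc k)) U f" "open U" "x \<in> U" and c: "c \<in> charts_at M x"
  shows "linear (\<lambda>a. coord_Hess f c x a b)" "linear (coord_Hess f c x b)"
proof -
  have A: "c \<in> atlas M" "x \<in> dom_of c" using c by (auto simp: charts_at_def)
  note C = Ck_fun_onD[OF f(1) A(1)]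
  have xS: "coord c x \<in> coord c ` (U \<inter> dom_of c)" using A f(3) by auto
  have C2: "Ck_on (Suc k) (coord c ` (U \<inter> dom_of c)) (\<lambda>p. fderiv (loc f c) p b)" for b
    using C by simp
  show 1: "linear (\<lambda>a. coord_Hess f c x a b)" for b
    unfolding coord_Hess_def
    using linear_compose[OF linear_christoffel_1[OF c, of b] fderiv_linear[OF C xS]]
    by (intro linear_compose_sub fderiv_linear[OF C2 xS]) (simp add: o_def)
  have "coord_Hess f c x b = (\<lambda>a. coord_Hess f c x a b)"
    using coord_Hess_symmetric[OF f c] by auto
  then show "linear (coord_Hess f c x b)" using 1 by simp
qed

text \<open>In the chosen chart the extension in \<open>Hess\<close> has constant components, so
  differentiating produces only the second derivative of \<open>f\<close> and the Christoffel
  term.\<close>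

lemma Hess_chart_at:
  assumes f: "Ck_fun_on M (Suc (Suc k)) U f" "open U" "x \<in> U"
    and u: "u \<in> tangent_space M x"
  shows "Hess M f x u v = coord_Hess f (chart_at M x) x (u (chart_at M x)) (v (chart_at M x))"
proof -
  define c where "c = chart_at M x"
  have c: "c \<in> charts_at M x" by (simp add: c_def chart_at)
  have A: "c \<in> atlas M" "x \<in> dom_of c" using c by (auto simp: charts_at_def)
  have oS: "open (coord c ` (U \<inter> dom_of c))" by (rule open_coord_image[OF A(1) f(2)])
  have xS: "coord c x \<in> coord c ` (U \<inter> dom_of c)" using A f(3) by auto
  have 1: "differential M (\<lambda>y. differential M f y (coord_field M c (v c) y)) x u =
      fderiv (\<lambda>p. fderiv (loc f c) p (v c)) (coord c x) (u c)"
  proof -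
    have "differential M (\<lambda>y. differential M f y (coord_field M c (v c) y)) x u =
        fderiv (\<lambda>p. differential M f (coord_inv c p) (coord_field M c (v c) (coord_inv c p))) (coord c x) (u c)"
      by (simp add: differential_def[of M _ x] c_def[symmetric] Let_def o_def)
    also have "fderiv (\<lambda>p. differential M f (coord_inv c p) (coord_field M c (v c) (coord_inv c p))) (coord c x)
        = fderiv (\<lambda>p. fderiv (loc f c) p (v c)) (coord c x)"
    proof (rule fderiv_cong_open[OF oS xS])
      fix p assume "p \<in> coord c ` (U \<inter> dom_of c)"
      then obtain y where y: "p = coord c y" "y \<in> U" "y \<in> dom_of c" by blast
      then have cy: "c \<in> charts_at M y" using A by (simp add: charts_at_def)
      show "differential M f (coord_inv c p) (coord_field M c (v c) (coord_inv c p)) = fderiv (loc f c) p (v c)"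
        using differential_chart[OF f(1) y(2) coord_field_tangent[OF cy] cy] y A
        by (simp add: coord_field_self[OF cy])
    qed
    finally show ?thesis .
  qed
  have 2: "differential M f x (nabla M x u (coord_field M c (v c))) =
      fderiv (loc f c) (coord c x) (christoffel M c x (u c) (v c))"
    using coord_field_tangent_coord[OF u c]
    by (simp add: differential_def c_def[symmetric] Let_def o_def christoffel_def)
  show ?thesis
    unfolding Hess_def extend_def c_def[symmetric] Let_def 1 2 coord_Hess_def ..
qed

lemma geodesic_near_chart:
  assumes g: "geodesic M {a..b} \<gamma>" and t: "t \<in> {a..b}" and U: "open U" "\<gamma> t \<in> U" and c: "c \<in> charts_at M (\<gamma> t)"
  obtains d where "0 < d" "\<And>s. s \<in> {a..b} \<Longrightarrow> dist s t < d \<Longrightarrow>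
    \<gamma> s \<in> U \<and> c \<in> charts_at M (\<gamma> s) \<and> coord_inv c (coord c (\<gamma> s)) = \<gamma> s \<and> coord c (\<gamma> s) \<in> coord c ` (U \<inter> dom_of c)"
proof -
  have A: "c \<in> atlas M" "\<gamma> t \<in> dom_of c" using c by (auto simp: charts_at_def)
  have "open (U \<inter> dom_of c)" "\<gamma> t \<in> U \<inter> dom_of c"
    using A U by (simp_all add: open_Int open_dom)
  then obtain d where d: "0 < d" "\<And>s. s \<in> {a..b} \<Longrightarrow> dist s t < d \<Longrightarrow> \<gamma> s \<in> U \<inter> dom_of c"
    using geodesic_near[OF g t] by blast
  show ?thesis
    by (rule that[OF d(1)]) (use d(2) A in \<open>auto simp: charts_at_def\<close>)
qed

text \<open>Besides the second derivative of \<open>f\<close>, the product rule produces the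
  differential applied to the acceleration; the geodesic equation turns this into the Christoffel
  correction of the Hessian.\<close>

lemma geodesic_second_derivative_coord:
  assumes g: "geodesic M {a..b} \<gamma>" and ab: "a < b" and t: "t \<in> {a..b}"
    and f: "Ck_fun_on M (Suc (Suc k)) U f" and U: "open U" "\<gamma> t \<in> U" and c: "c \<in> charts_at M (\<gamma> t)"
  shows "((\<lambda>s. differential M f (\<gamma> s) (velocity M \<gamma> {a..b} s)) has_real_derivative
    coord_Hess f c (\<gamma> t) (velocity M \<gamma> {a..b} t c) (velocity M \<gamma> {a..b} t c)) (at t within {a..b})"
proof -
  have A: "c \<in> atlas M" "\<gamma> t \<in> dom_of c" using c by (auto simp: charts_at_def)
  obtain d where d: "0 < d" "\<And>s. s \<in> {a..b} \<Longrightarrow> dist s t < d \<Longrightarrow>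
    \<gamma> s \<in> U \<and> c \<in> charts_at M (\<gamma> s) \<and> coord_inv c (coord c (\<gamma> s)) = \<gamma> s \<and> coord c (\<gamma> s) \<in> coord c ` (U \<inter> dom_of c)"
    using geodesic_near_chart[OF g t U c] by blast
  note C = Ck_fun_onD[OF f A(1)]
  have C2: "Ck_on (Suc k) (coord c ` (U \<inter> dom_of c)) (\<lambda>p. fderiv (loc f c) p w)" for w
    using C by simp
  have tS: "coord c (\<gamma> t) \<in> coord c ` (U \<inter> dom_of c)" using A U by auto
  note v = geodesic_velocity[OF g ab t c]
  let ?v = "velocity M \<gamma> {a..b} t c"
  have "((\<lambda>s. fderiv (loc f c) (coord c (\<gamma> s)) (velocity M \<gamma> {a..b} s c)) has_real_derivative
      fderiv (\<lambda>p. fderiv (loc f c) p ?v) (coord c (\<gamma> t)) ?v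
      + fderiv (loc f c) (coord c (\<gamma> t)) (- christoffel M c (\<gamma> t) ?v ?v)) (at t within {a..b})"
  proof (rule has_real_derivative_linear_family[where P="\<lambda>s. fderiv (loc f c) (coord c (\<gamma> s))"
        and P'="\<lambda>w. fderiv (\<lambda>p. fderiv (loc f c) p w) (coord c (\<gamma> t)) ?v", OF d(1) t _ _ v(2)])
    show "linear (fderiv (loc f c) (coord c (\<gamma> s)))" if "s \<in> {a..b}" "dist s t < d" for s
      using fderiv_linear[OF C] d(2)[OF that] by blast
    show "((\<lambda>s. fderiv (loc f c) (coord c (\<gamma> s)) w) has_real_derivative
        fderiv (\<lambda>p. fderiv (loc f c) p w) (coord c (\<gamma> t)) ?v) (at t within {a..b})" for w
      unfolding has_real_derivative_iff_has_vector_derivative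
      by (rule has_vector_derivative_chain[where g="\<lambda>p. fderiv (loc f c) p w", OF v(1) has_fderiv[OF C2 tS]])
  qed
  moreover have "fderiv (loc f c) (coord c (\<gamma> t)) (- christoffel M c (\<gamma> t) ?v ?v) =
      - fderiv (loc f c) (coord c (\<gamma> t)) (christoffel M c (\<gamma> t) ?v ?v)"
    using linear_neg[OF fderiv_linear[OF C tS]] by blast
  ultimately have "((\<lambda>s. fderiv (loc f c) (coord c (\<gamma> s)) (velocity M \<gamma> {a..b} s c)) has_real_derivative
      coord_Hess f c (\<gamma> t) ?v ?v) (at t within {a..b})"
    by (simp add: coord_Hess_def)
  then show ?thesis
  proof (rule has_real_derivative_transform_Icc[OF _ d(1) t])
    fix s assume s: "s \<in> {a..b}" "dist s t < d"
    show "fderiv (loc f c) (coord c (\<gamma> s)) (velocity M \<gamma> {a..b} s c) =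
        differential M f (\<gamma> s) (velocity M \<gamma> {a..b} s)"
      using differential_chart[OF f _ velocity_tangent[OF g ab s(1)], of c] d(2)[OF s] by simp
  qed
qed

end

context admissible_mfd
begin

text \<open>Both sides are the second derivative of \<open>f\<close> along the geodesic with velocity \<open>v\<close>, so the
  transformation law of the Christoffel symbols is not needed.\<close>

lemma coord_Hess_diagonal_chart:
  assumes f: "Ck_fun_on M (Suc (Suc k)) U f" "open U" "x \<in> U" and v: "v \<in> tangent_space M x"
    and c: "c \<in> charts_at M x" and d: "d \<in> charts_at M x"
  shows "coord_Hess f c x (v c) (v c) = coord_Hess f d x (v d) (v d)"
proof -
  obtain \<gamma> where \<gamma>: "geodesic M {0..1} \<gamma>" "\<gamma> 0 = x" "velocity M \<gamma> {0..1} 0 = v"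
    using geodesic_exp[OF v] by metis
  show ?thesis
    using geodesic_second_derivative_coord[OF \<gamma>(1) _ _ f(1,2), of 0 c]
      geodesic_second_derivative_coord[OF \<gamma>(1) _ _ f(1,2), of 0 d] \<gamma> f(3) c d
      has_vector_derivative_unique_Icc[of 0 1 0
        "\<lambda>s. differential M f (\<gamma> s) (velocity M \<gamma> {0..1} s)"
        "coord_Hess f c x (v c) (v c)" "coord_Hess f d x (v d) (v d)"]
    unfolding has_real_derivative_iff_has_vector_derivative by simp
qed

text \<open>On the diagonal, chart independence comes from geodesics; polarization, which rests on
  symmetry and thus on torsion-freeness, extends it to pairs.\<close>

lemma Hess_chart:
  assumes f: "Ck_fun_on M (Suc (Suc k)) U f" "open U" "x \<in> U"
    and u: "u \<in> tangent_space M x" and v: "v \<in> tangent_space M x" and c: "c \<in> charts_at M x"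
  shows "Hess M f x u v = coord_Hess f c x (u c) (v c)"
proof -
  define d where "d = chart_at M x"
  have d: "d \<in> charts_at M x" by (simp add: d_def chart_at)
  have uv: "(\<lambda>c. u c + v c) \<in> tangent_space M x"
    using tangent_linear_comb[OF u v, of 1 1] by simp
  have pol: "2 * coord_Hess f c x (u c) (v c) = coord_Hess f c x (u c + v c) (u c + v c)
      - coord_Hess f c x (u c) (u c) - coord_Hess f c x (v c) (v c)" if c: "c \<in> charts_at M x" for c
    using linear_add[OF linear_coord_Hess(1)[OF f c]] linear_add[OF linear_coord_Hess(2)[OF f c]]
      coord_Hess_symmetric[OF f c, of "u c" "v c"] by simp
  have "2 * coord_Hess f c x (u c) (v c) = 2 * coord_Hess f d x (u d) (v d)"
    unfolding pol[OF c] pol[OF d]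
    using coord_Hess_diagonal_chart[OF f uv c d] coord_Hess_diagonal_chart[OF f u c d]
      coord_Hess_diagonal_chart[OF f v c d] by simp
  then show ?thesis
    using Hess_chart_at[OF f u] by (simp add: d_def)
qed

lemma Hess_symmetric:
  assumes f: "Ck_fun_on M (Suc (Suc k)) U f" "open U" "x \<in> U"
    and u: "u \<in> tangent_space M x" and v: "v \<in> tangent_space M x"
  shows "Hess M f x u v = Hess M f x v u"
  using Hess_chart[OF f u v chart_at] Hess_chart[OF f v u chart_at] coord_Hess_symmetric[OF f chart_at]
  by simp

lemma Hess_linear:
  assumes f: "Ck_fun_on M (Suc (Suc k)) U f" "open U" "x \<in> U"
    and u: "u \<in> tangent_space M x" and v: "v \<in> tangent_space M x" and w: "w \<in> tangent_space M x"
  shows "Hess M f x (\<lambda>c. r *\<^sub>R u c + s *\<^sub>R v c) w = r * Hess M f x u w + s * Hess M f x v w"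
  using Hess_chart[OF f tangent_linear_comb[OF u v] w chart_at] Hess_chart[OF f u w chart_at]
    Hess_chart[OF f v w chart_at] linear_add[OF linear_coord_Hess(1)[OF f chart_at]]
    linear_scale[OF linear_coord_Hess(1)[OF f chart_at]]
  by simp

lemma geodesic_second_derivative:
  assumes g: "geodesic M {a..b} \<gamma>" and ab: "a < b" and t: "t \<in> {a..b}"
    and f: "Ck_fun_on M (Suc (Suc k)) U f" and U: "open U" "\<gamma> t \<in> U"
  shows "((\<lambda>s. differential M f (\<gamma> s) (velocity M \<gamma> {a..b} s)) has_real_derivative
    Hess M f (\<gamma> t) (velocity M \<gamma> {a..b} t) (velocity M \<gamma> {a..b} t)) (at t within {a..b})"
  using geodesic_second_derivative_coord[OF g ab t f U chart_at]
    Hess_chart[OF f U velocity_tangent[OF g ab t] velocity_tangent[OF g ab t] chart_at] by simp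


section \<open>The covariant derivative of the Hessian\<close>

lemma Ck_on_coord_Hess:
  assumes f: "Ck_fun_on M (Suc (Suc (Suc 0))) U f" "open U" and c: "c \<in> atlas M"
  shows "Ck_on (Suc 0) (coord c ` (U \<inter> dom_of c)) (\<lambda>p. coord_Hess f c (coord_inv c p) a b)"
proof (rule Ck_on_cong)
  let ?S = "coord c ` (U \<inter> dom_of c)"
  \<comment> \<open>The Christoffel term is the derivative of \<open>f\<close> at a moving vector;
    in a basis it becomes a sum of products of C^1 functions. Three derivatives of \<open>f\<close>
    leave one for the Hessian.\<close>
  let ?G = "\<lambda>p. fderiv (\<lambda>p. fderiv (loc f c) p b) p a
      + (- 1) *\<^sub>R (\<Sum>i\<in>Basis. (christoffel M c (coord_inv c p) a b \<bullet> i) *\<^sub>R fderiv (loc f c) p i)"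
  show oS: "open ?S" by (rule open_coord_image[OF c f(2)])
  note C = Ck_fun_onD[OF f(1) c]
  have Gam: "Ck_on (Suc 0) ?S (\<lambda>p. christoffel M c (coord_inv c p) a b)"
    by (rule Ck_on_subset[OF christoffel_smooth[OF c]]) auto
  have D1: "Ck_on (Suc 0) ?S (\<lambda>p. fderiv (loc f c) p i)" for i
    using C Ck_on_SucD[of "Suc 0" ?S "\<lambda>p. fderiv (loc f c) p i"] by simp
  show "Ck_on (Suc 0) ?S ?G"
    using C
    by (intro Ck_on_add[OF oS] Ck_on_scaleR[OF oS] Ck_on_sum[OF oS] Ck_on_const D1
        Ck_on_bounded_linear[OF oS bounded_linear_inner_left] Gam) simp_all
  show "?G p = coord_Hess f c (coord_inv c p) a b" if "p \<in> ?S" for p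
  proof -
    have "coord c (coord_inv c p) = p" using that c by auto
    then show ?thesis
      unfolding coord_Hess_def
      using linear_euclidean_expansion[OF fderiv_linear[OF C that], of "christoffel M c (coord_inv c p) a b"]
      by simp
  qed
qed

definition coord_nabla_Hess :: "('m \<Rightarrow> real) \<Rightarrow> ('m, 'e) chart \<Rightarrow> 'm \<Rightarrow> 'e \<Rightarrow> 'e \<Rightarrow> 'e \<Rightarrow> real" where
  "coord_nabla_Hess f c x v a b =
     fderiv (\<lambda>p. coord_Hess f c (coord_inv c p) a b) (coord c x) v
     - coord_Hess f c x (christoffel M c x v a) b - coord_Hess f c x a (christoffel M c x v b)"

text \<open>At nearby points \<open>chart_at\<close> may pick another chart, so the inner Hessian is
  rewritten by \<open>Hess_chart\<close>. One chart at \<open>x\<close> is enough here, because the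
  tensor is evaluated at a single point of a geodesic and the chart can be adapted to it.\<close>

lemma nabla_Hess_chart_at:
  assumes f: "Ck_fun_on M (Suc (Suc (Suc 0))) U f" "open U" "x \<in> U"
    and v: "v \<in> tangent_space M x" and u: "u \<in> tangent_space M x" and w: "w \<in> tangent_space M x"
    and c_def: "c = chart_at M x"
  shows "nabla_Hess M f x v u w = coord_nabla_Hess f c x (v c) (u c) (w c)"
proof -
  have c: "c \<in> charts_at M x" by (simp add: c_def chart_at)
  have A: "c \<in> atlas M" "x \<in> dom_of c" using c by (auto simp: charts_at_def)
  have oS: "open (coord c ` (U \<inter> dom_of c))" by (rule open_coord_image[OF A(1) f(2)])
  have xS: "coord c x \<in> coord c ` (U \<inter> dom_of c)" using A f(3) by auto
  let ?U = "coord_field M c (u c)" and ?W = "coord_field M c (w c)"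
  have nab: "nabla M x v (coord_field M c z) = coord_field M c (christoffel M c x (v c) z) x" for z
    using nabla_coord_field[OF c, of "v c" z] coord_field_tangent_coord[OF v c] by simp
  have "differential M (\<lambda>y. Hess M f y (?U y) (?W y)) x v =
      fderiv (\<lambda>p. Hess M f (coord_inv c p) (?U (coord_inv c p)) (?W (coord_inv c p))) (coord c x) (v c)"
    by (simp add: differential_def c_def[symmetric] Let_def o_def)
  also have "fderiv (\<lambda>p. Hess M f (coord_inv c p) (?U (coord_inv c p)) (?W (coord_inv c p))) (coord c x)
      = fderiv (\<lambda>p. coord_Hess f c (coord_inv c p) (u c) (w c)) (coord c x)"
  proof (rule fderiv_cong_open[OF oS xS])
    fix p assume "p \<in> coord c ` (U \<inter> dom_of c)"
    then obtain y where y: "p = coord c y" "y \<in> U" "y \<in> dom_of c" by blast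
    then have cy: "c \<in> charts_at M y" using A by (simp add: charts_at_def)
    show "Hess M f (coord_inv c p) (?U (coord_inv c p)) (?W (coord_inv c p)) =
        coord_Hess f c (coord_inv c p) (u c) (w c)"
      using Hess_chart[OF f(1,2) y(2) coord_field_tangent[OF cy] coord_field_tangent[OF cy] cy] y A
      by (simp add: coord_field_self[OF cy])
  qed
  finally have 1: "differential M (\<lambda>y. Hess M f y (?U y) (?W y)) x v =
      fderiv (\<lambda>p. coord_Hess f c (coord_inv c p) (u c) (w c)) (coord c x) (v c)" .
  show ?thesis
    unfolding nabla_Hess_def extend_def c_def[symmetric] Let_def 1 nab coord_nabla_Hess_def
    using Hess_chart[OF f coord_field_tangent[OF c] w c] Hess_chart[OF f u coord_field_tangent[OF c] c]
    by (simp add: coord_field_self[OF c])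
qed

lemma coord_nabla_Hess_symmetric:
  assumes f: "Ck_fun_on M (Suc (Suc (Suc 0))) U f" "open U" "x \<in> U" and c: "c \<in> charts_at M x"
  shows "coord_nabla_Hess f c x v a b = coord_nabla_Hess f c x v b a"
proof -
  have A: "c \<in> atlas M" "x \<in> dom_of c" using c by (auto simp: charts_at_def)
  have oS: "open (coord c ` (U \<inter> dom_of c))" by (rule open_coord_image[OF A(1) f(2)])
  have xS: "coord c x \<in> coord c ` (U \<inter> dom_of c)" using A f(3) by auto
  have "fderiv (\<lambda>p. coord_Hess f c (coord_inv c p) a b) (coord c x) =
      fderiv (\<lambda>p. coord_Hess f c (coord_inv c p) b a) (coord c x)"
    by (rule fderiv_cong_open[OF oS xS])
      (use A in \<open>auto intro!: coord_Hess_symmetric[OF f(1,2)] charts_atI\<close>)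
  then show ?thesis
    unfolding coord_nabla_Hess_def
    using coord_Hess_symmetric[OF f c, of "christoffel M c x v a" b]
      coord_Hess_symmetric[OF f c, of a "christoffel M c x v b"] by simp
qed

lemma linear_coord_nabla_Hess:
  assumes f: "Ck_fun_on M (Suc (Suc (Suc 0))) U f" "open U" "x \<in> U" and c: "c \<in> charts_at M x"
  shows "linear (\<lambda>a. coord_nabla_Hess f c x v a b)"
proof -
  have A: "c \<in> atlas M" "x \<in> dom_of c" using c by (auto simp: charts_at_def)
  let ?S = "coord c ` (U \<inter> dom_of c)"
  have oS: "open ?S" by (rule open_coord_image[OF A(1) f(2)])
  have xS: "coord c x \<in> ?S" using A f(3) by auto
  let ?H = "\<lambda>a p. coord_Hess f c (coord_inv c p) a b"
  note D = has_fderiv[OF Ck_on_coord_Hess[OF f(1,2) A(1)] xS]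
  have linH: "linear (\<lambda>a. ?H a p)" if "p \<in> ?S" for p
    using that A by (auto intro!: linear_coord_Hess(1)[OF f(1,2)] charts_atI)
  have "linear (\<lambda>a. fderiv (?H a) (coord c x) v)"
  proof (rule linearI)
    fix a a' :: 'e and r :: real
    have "(?H (a + a') has_derivative (\<lambda>v. fderiv (?H a) (coord c x) v + fderiv (?H a') (coord c x) v)) (at (coord c x))"
      by (rule has_derivative_transform_within_open[OF has_derivative_add[OF D[of a b] D[of a' b]] oS xS])
        (simp add: linear_add[OF linH])
    from has_derivative_unique[OF D[of "a + a'" b] this]
    show "fderiv (?H (a + a')) (coord c x) v = fderiv (?H a) (coord c x) v + fderiv (?H a') (coord c x) v"
      by simp
    have "(?H (r *\<^sub>R a) has_derivative (\<lambda>v. r *\<^sub>R fderiv (?H a) (coord c x) v)) (at (coord c x))"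
      by (rule has_derivative_transform_within_open[OF has_derivative_scaleR_right[OF D[of a b]] oS xS])
        (simp add: linear_scale[OF linH])
    from has_derivative_unique[OF D[of "r *\<^sub>R a" b] this]
    show "fderiv (?H (r *\<^sub>R a)) (coord c x) v = r *\<^sub>R fderiv (?H a) (coord c x) v"
      by simp
  qed
  moreover have "linear (\<lambda>a. coord_Hess f c x (christoffel M c x v a) b)"
    using linear_compose[OF linear_christoffel_2[OF c, of v] linear_coord_Hess(1)[OF f c, of b]]
    by (simp add: o_def)
  ultimately show ?thesis
    unfolding coord_nabla_Hess_def by (intro linear_compose_sub linear_coord_Hess(1)[OF f c])
qed

lemma has_real_derivative_coord_Hess_geodesic:
  assumes g: "geodesic M {a..b} \<gamma>" and ab: "a < b" and t: "t \<in> {a..b}"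
    and f: "Ck_fun_on M (Suc (Suc (Suc 0))) U f" and U: "open U" "\<gamma> t \<in> U" and c: "c \<in> charts_at M (\<gamma> t)"
  shows "((\<lambda>s. coord_Hess f c (\<gamma> s) u w) has_real_derivative
    fderiv (\<lambda>p. coord_Hess f c (coord_inv c p) u w) (coord c (\<gamma> t)) (velocity M \<gamma> {a..b} t c)) (at t within {a..b})"
proof -
  have A: "c \<in> atlas M" "\<gamma> t \<in> dom_of c" using c by (auto simp: charts_at_def)
  obtain d where d: "0 < d" "\<And>s. s \<in> {a..b} \<Longrightarrow> dist s t < d \<Longrightarrow>
    \<gamma> s \<in> U \<and> c \<in> charts_at M (\<gamma> s) \<and> coord_inv c (coord c (\<gamma> s)) = \<gamma> s \<and> coord c (\<gamma> s) \<in> coord c ` (U \<inter> dom_of c)"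
    using geodesic_near_chart[OF g t U c] by blast
  have tS: "coord c (\<gamma> t) \<in> coord c ` (U \<inter> dom_of c)" using A U by auto
  have "((\<lambda>s. coord_Hess f c (coord_inv c (coord c (\<gamma> s))) u w) has_real_derivative
    fderiv (\<lambda>p. coord_Hess f c (coord_inv c p) u w) (coord c (\<gamma> t)) (velocity M \<gamma> {a..b} t c)) (at t within {a..b})"
    unfolding has_real_derivative_iff_has_vector_derivative
    by (rule has_vector_derivative_chain[where g="\<lambda>p. coord_Hess f c (coord_inv c p) u w",
          OF geodesic_velocity(1)[OF g ab t c] has_fderiv[OF Ck_on_coord_Hess[OF f U(1) A(1)] tS]])
  then show ?thesis
    by (rule has_real_derivative_transform_Icc[OF _ d(1) t]) (use d(2) in simp)
qed

text \<open>The product rule in one chart yields two acceleration terms, which the geodesic equation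
  turns into the two correction terms of \<open>nabla_Hess\<close>.\<close>

lemma geodesic_third_derivative:
  assumes g: "geodesic M {a..b} \<gamma>" and ab: "a < b" and t: "t \<in> {a..b}"
    and f: "Ck_fun_on M (Suc (Suc (Suc 0))) U f" and U: "open U" "\<gamma> t \<in> U"
  shows "((\<lambda>s. Hess M f (\<gamma> s) (velocity M \<gamma> {a..b} s) (velocity M \<gamma> {a..b} s)) has_real_derivative
    nabla_Hess M f (\<gamma> t) (velocity M \<gamma> {a..b} t) (velocity M \<gamma> {a..b} t) (velocity M \<gamma> {a..b} t)) (at t within {a..b})"
proof -
  define c where "c = chart_at M (\<gamma> t)"
  have c: "c \<in> charts_at M (\<gamma> t)" by (simp add: c_def chart_at)
  have A: "c \<in> atlas M" "\<gamma> t \<in> dom_of c" using c by (auto simp: charts_at_def)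
  obtain d where d: "0 < d" "\<And>s. s \<in> {a..b} \<Longrightarrow> dist s t < d \<Longrightarrow>
    \<gamma> s \<in> U \<and> c \<in> charts_at M (\<gamma> s) \<and> coord_inv c (coord c (\<gamma> s)) = \<gamma> s \<and> coord c (\<gamma> s) \<in> coord c ` (U \<inter> dom_of c)"
    using geodesic_near_chart[OF g t U c] by blast
  let ?V = "velocity M \<gamma> {a..b}"
  note v = geodesic_velocity[OF g ab t c]
  let ?B' = "\<lambda>u w. fderiv (\<lambda>p. coord_Hess f c (coord_inv c p) u w) (coord c (\<gamma> t)) (?V t c)"
  let ?G = "christoffel M c (\<gamma> t) (?V t c) (?V t c)"
  have "((\<lambda>s. coord_Hess f c (\<gamma> s) (?V s c) (?V s c)) has_real_derivative
      ?B' (?V t c) (?V t c) + coord_Hess f c (\<gamma> t) (- ?G) (?V t c)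
      + coord_Hess f c (\<gamma> t) (?V t c) (- ?G)) (at t within {a..b})"
    by (rule has_real_derivative_bilinear_family[where B="\<lambda>s. coord_Hess f c (\<gamma> s)" and B'="?B'", OF d(1) t _ _ _ v(2) v(2)])
      (use d(2) in \<open>blast intro: linear_coord_Hess[OF f U(1)] has_real_derivative_coord_Hess_geodesic[OF g ab t f U c]\<close>)+
  moreover have "coord_Hess f c (\<gamma> t) (- ?G) (?V t c) = - coord_Hess f c (\<gamma> t) ?G (?V t c)"
    "coord_Hess f c (\<gamma> t) (?V t c) (- ?G) = - coord_Hess f c (\<gamma> t) (?V t c) ?G"
    using linear_neg[OF linear_coord_Hess(1)[OF f U c]] linear_neg[OF linear_coord_Hess(2)[OF f U c]] by blast+
  ultimately have "((\<lambda>s. coord_Hess f c (\<gamma> s) (?V s c) (?V s c)) has_real_derivative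
      coord_nabla_Hess f c (\<gamma> t) (?V t c) (?V t c) (?V t c)) (at t within {a..b})"
    by (simp add: coord_nabla_Hess_def)
  then have "((\<lambda>s. Hess M f (\<gamma> s) (?V s) (?V s)) has_real_derivative
      coord_nabla_Hess f c (\<gamma> t) (?V t c) (?V t c) (?V t c)) (at t within {a..b})"
  proof (rule has_real_derivative_transform_Icc[OF _ d(1) t])
    fix s assume s: "s \<in> {a..b}" "dist s t < d"
    show "coord_Hess f c (\<gamma> s) (?V s c) (?V s c) = Hess M f (\<gamma> s) (?V s) (?V s)"
      using Hess_chart[OF f U(1) _ velocity_tangent[OF g ab s(1)] velocity_tangent[OF g ab s(1)], of c] d(2)[OF s]
      by simp
  qed
  then show ?thesis
    using nabla_Hess_chart_at[OF f U velocity_tangent[OF g ab t] velocity_tangent[OF g ab t]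
        velocity_tangent[OF g ab t] c_def] by simp
qed

text \<open>The covector \<open>Df + (1 - s) HF(\<gamma>', \<cdot>)\<close> along \<open>\<gamma>\<close> vanishes at \<open>s = 0\<close> for a Newton step and is
  \<open>Df\<close> at \<open>s = 1\<close>. Differentiating its squared dual norm avoids parallel transport.\<close>

lemma newton_defect_derivative:
  assumes g: "geodesic M {a..b} \<gamma>" and ab: "a < b" and t: "t \<in> {a..b}"
    and F: "Ck_fun_on M (Suc (Suc (Suc 0))) U F" and U: "open U" "\<gamma> t \<in> U"
    and f: "Ck_fun_on M (Suc (Suc 0)) U f"
    and pos: "\<And>x u. x \<in> U \<Longrightarrow> u \<in> tangent_space M x \<Longrightarrow> u \<noteq> (\<lambda>c. 0) \<Longrightarrow> 0 < Hess M F x u u"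
    and fF: "\<And>x u v. x \<in> U \<Longrightarrow> u \<in> tangent_space M x \<Longrightarrow> v \<in> tangent_space M x \<Longrightarrow> Hess M f x u v = Hess M F x u v"
    and V_def: "V = velocity M \<gamma> {a..b}"
    and W: "\<And>s. s \<in> {a..b} \<Longrightarrow> \<gamma> s \<in> U \<Longrightarrow> W s \<in> tangent_space M (\<gamma> s)"
    and WP: "\<And>s v. s \<in> {a..b} \<Longrightarrow> \<gamma> s \<in> U \<Longrightarrow> v \<in> tangent_space M (\<gamma> s) \<Longrightarrow>
      Hess M F (\<gamma> s) (W s) v = differential M f (\<gamma> s) v + (1 - s) * Hess M F (\<gamma> s) (V s) v"
  shows "((\<lambda>s. Hess M F (\<gamma> s) (W s) (W s)) has_real_derivative
    2 * (1 - t) * nabla_Hess M F (\<gamma> t) (V t) (V t) (W t) - nabla_Hess M F (\<gamma> t) (V t) (W t) (W t)) (at t within {a..b})"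
proof -
  define c where "c = chart_at M (\<gamma> t)"
  have c: "c \<in> charts_at M (\<gamma> t)" by (simp add: c_def chart_at)
  have A: "c \<in> atlas M" "\<gamma> t \<in> dom_of c" using c by (auto simp: charts_at_def)
  obtain d where d: "0 < d" "\<And>s. s \<in> {a..b} \<Longrightarrow> dist s t < d \<Longrightarrow>
    \<gamma> s \<in> U \<and> c \<in> charts_at M (\<gamma> s) \<and> coord_inv c (coord c (\<gamma> s)) = \<gamma> s \<and> coord c (\<gamma> s) \<in> coord c ` (U \<inter> dom_of c)"
    using geodesic_near_chart[OF g t U c] by blast
  have Vs: "V s \<in> tangent_space M (\<gamma> s)" if "s \<in> {a..b}" for s
    unfolding V_def by (rule velocity_tangent[OF g ab that])
  note v = geodesic_velocity[OF g ab t c, folded V_def]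
  have tS: "coord c (\<gamma> t) \<in> coord c ` (U \<inter> dom_of c)" using A U by auto
  note C = Ck_fun_onD[OF f A(1)]
  have C2: "Ck_on (Suc 0) (coord c ` (U \<inter> dom_of c)) (\<lambda>p. fderiv (loc f c) p w)" for w
    using C by simp
  define B where "B s = coord_Hess F c (\<gamma> s)" for s
  define G where "G = christoffel M c (\<gamma> t) (V t c)"
  define B' where "B' u w = fderiv (\<lambda>p. coord_Hess F c (coord_inv c p) u w) (coord c (\<gamma> t)) (V t c)" for u w
  define P where "P s w = fderiv (loc f c) (coord c (\<gamma> s)) w + (1 - s) * B s (V s c) w" for s w
  define P' where "P' w = fderiv (\<lambda>p. fderiv (loc f c) p w) (coord c (\<gamma> t)) (V t c)
      + ((1 - t) * (B' (V t c) w + B t (- G (V t c)) w) - B t (V t c) w)" for w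
  have linB: "linear (\<lambda>u. B s u w)" "linear (B s w)" if "s \<in> {a..b}" "dist s t < d" for s w
    unfolding B_def using linear_coord_Hess[OF F U(1)] d(2)[OF that] by blast+
  have symB: "B s u w = B s w u" if "s \<in> {a..b}" "dist s t < d" for s u w
    unfolding B_def using coord_Hess_symmetric[OF F U(1)] d(2)[OF that] by blast
  have HB: "Hess M F (\<gamma> s) u w = B s (u c) (w c)"
    if "s \<in> {a..b}" "dist s t < d" "u \<in> tangent_space M (\<gamma> s)" "w \<in> tangent_space M (\<gamma> s)" for s u w
    unfolding B_def using Hess_chart[OF F U(1) _ that(3,4)] d(2)[OF that(1,2)] by blast
  have cf: "coord_field M c w (\<gamma> s) \<in> tangent_space M (\<gamma> s)" "coord_field M c w (\<gamma> s) c = w"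
    if "s \<in> {a..b}" "dist s t < d" for s w
    using coord_field_tangent coord_field_self d(2)[OF that] by blast+
  have t0: "dist t t < d" using d(1) by simp
  have BB: "((\<lambda>s. B s u w) has_real_derivative B' u w) (at t within {a..b})" for u w
    unfolding B_def B'_def V_def by (rule has_real_derivative_coord_Hess_geodesic[OF g ab t F U c])
  have BV: "((\<lambda>s. B s (V s c) w) has_real_derivative B' (V t c) w + B t (- G (V t c)) w) (at t within {a..b})" for w
    unfolding G_def
    by (rule has_real_derivative_linear_family[where P="\<lambda>s u. B s u w", OF d(1) t linB(1) BB v(2)])
  have D2: "((\<lambda>s. fderiv (loc f c) (coord c (\<gamma> s)) w) has_real_derivative
        fderiv (\<lambda>p. fderiv (loc f c) p w) (coord c (\<gamma> t)) (V t c)) (at t within {a..b})" for w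
    unfolding has_real_derivative_iff_has_vector_derivative
    by (rule has_vector_derivative_chain[where g="\<lambda>p. fderiv (loc f c) p w", OF v(1) has_fderiv[OF C2 tS]])
  have PP: "((\<lambda>s. P s w) has_real_derivative P' w) (at t within {a..b})" for w
    unfolding P_def P'_def by (rule derivative_eq_intros D2 BV refl | simp)+
  have linP: "linear (P s)" if s: "s \<in> {a..b}" "dist s t < d" for s
  proof -
    have l1: "linear (fderiv (loc f c) (coord c (\<gamma> s)))"
      using fderiv_linear[OF C] d(2)[OF s] by blast
    show ?thesis
      unfolding P_def
      using linear_compose_add[OF l1 linear_compose_scale_right[OF linB(2)[OF s], of "1 - s" "V s c"]] by simp
  qed
  have WB: "B s (W s c) w = P s w" if s: "s \<in> {a..b}" "dist s t < d" for s w
  proof -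
    have gU: "\<gamma> s \<in> U" and cs: "c \<in> charts_at M (\<gamma> s)" using d(2)[OF s] by auto
    have "B s (W s c) w = Hess M F (\<gamma> s) (W s) (coord_field M c w (\<gamma> s))"
      using HB[OF s W[OF s(1) gU] cf(1)[OF s]] cf(2)[OF s] by simp
    also have "\<dots> = differential M f (\<gamma> s) (coord_field M c w (\<gamma> s))
        + (1 - s) * Hess M F (\<gamma> s) (V s) (coord_field M c w (\<gamma> s))"
      by (rule WP[OF s(1) gU cf(1)[OF s]])
    also have "\<dots> = P s w"
      using differential_chart[OF f gU cf(1)[OF s] cs] HB[OF s Vs[OF s(1)] cf(1)[OF s]] cf(2)[OF s]
      by (simp add: P_def)
    finally show ?thesis .
  qed
  have posB: "0 < B s u u" if s: "s \<in> {a..b}" "dist s t < d" and "u \<noteq> 0" for s u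
  proof -
    have "coord_field M c u (\<gamma> s) \<noteq> (\<lambda>c. 0)"
      using cf(2)[OF s, of u] \<open>u \<noteq> 0\<close> by metis
    then show ?thesis
      using pos[OF _ cf(1)[OF s]] HB[OF s cf(1)[OF s] cf(1)[OF s]] cf(2)[OF s] d(2)[OF s] by force
  qed
  let ?w = "W t c"
  have "((\<lambda>s. P s (W s c)) has_real_derivative 2 * P' ?w - B' ?w ?w) (at t within {a..b})"
    by (rule has_real_derivative_dual_quadratic[OF d(1) t linB(1) symB posB linP WB BB PP])
  then have main: "((\<lambda>s. Hess M F (\<gamma> s) (W s) (W s)) has_real_derivative 2 * P' ?w - B' ?w ?w) (at t within {a..b})"
  proof (rule has_real_derivative_transform_Icc[OF _ d(1) t])
    fix s assume s: "s \<in> {a..b}" "dist s t < d"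
    have "W s \<in> tangent_space M (\<gamma> s)" using W[OF s(1)] d(2)[OF s] by simp
    then show "P s (W s c) = Hess M F (\<gamma> s) (W s) (W s)"
      using HB[OF s] WB[OF s] by simp
  qed
  have Wt: "W t \<in> tangent_space M (\<gamma> t)" by (rule W[OF t U(2)])
  have n1: "nabla_Hess M F (\<gamma> t) (V t) (V t) (W t) =
      B' (V t c) ?w - B t (G (V t c)) ?w - B t (V t c) (G ?w)"
    unfolding nabla_Hess_chart_at[OF F U Vs[OF t] Vs[OF t] Wt c_def]
    by (simp add: coord_nabla_Hess_def B'_def B_def G_def)
  have n2: "nabla_Hess M F (\<gamma> t) (V t) (W t) (W t) = B' ?w ?w - 2 * B t ?w (G ?w)"
    unfolding nabla_Hess_chart_at[OF F U Vs[OF t] Wt Wt c_def]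
    using symB[OF t t0, of "G ?w" ?w] by (simp add: coord_nabla_Hess_def B'_def B_def G_def)
  \<comment> \<open>Here the equality of the two Hessians enters: differentiating the differential
    of \<open>f\<close> contributes \<open>B t (V t c) ?w\<close>, which is exactly what the
    derivative of the factor 1 - s takes away.\<close>
  have "Hess M f (\<gamma> t) (V t) (W t) = B t (V t c) ?w"
    using fF[OF U(2) Vs[OF t] Wt] HB[OF t t0 Vs[OF t] Wt] by simp
  then have h: "fderiv (\<lambda>p. fderiv (loc f c) p ?w) (coord c (\<gamma> t)) (V t c) =
      B t (V t c) ?w + fderiv (loc f c) (coord c (\<gamma> t)) (G ?w)"
    using Hess_chart[OF f U Vs[OF t] Wt c] by (simp add: coord_Hess_def G_def)
  \<comment> \<open>Evaluating the representation of the covector at \<open>G ?w\<close> exchanges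
    the remaining differential of \<open>f\<close> for the Christoffel terms of the two covariant
    derivatives.\<close>
  have w: "B t ?w (G ?w) = fderiv (loc f c) (coord c (\<gamma> t)) (G ?w) + (1 - t) * B t (V t c) (G ?w)"
    using WB[OF t t0, of "G ?w"] by (simp add: P_def)
  have neg: "B t (- G (V t c)) ?w = - B t (G (V t c)) ?w"
    using linear_neg[OF linB(1)[OF t t0]] by blast
  have "2 * P' ?w - B' ?w ?w =
      2 * (1 - t) * nabla_Hess M F (\<gamma> t) (V t) (V t) (W t) - nabla_Hess M F (\<gamma> t) (V t) (W t) (W t)"
    unfolding P'_def n1 n2 h w neg by (simp add: algebra_simps)
  then show ?thesis using main by simp
qed

end

section \<open>Bilinear forms\<close>

text \<open>Used with T = B for the Cauchy-Schwarz inequality, and with T a slice of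
  \<open>coord_nabla_Hess\<close> to carry the self-concordance bound to mixed arguments with the
  same constant.\<close>

lemma polarization_bound:
  fixes T B :: "'a::real_vector \<Rightarrow> 'a \<Rightarrow> real"
  assumes T: "\<And>b. linear (\<lambda>a. T a b)" "\<And>a b. T a b = T b a"
    and B: "\<And>b. linear (\<lambda>a. B a b)" "\<And>a b. B a b = B b a" "\<And>a. a \<noteq> 0 \<Longrightarrow> 0 < B a a"
    and bound: "\<And>a. \<bar>T a a\<bar> \<le> K * B a a"
  shows "\<bar>T u w\<bar> \<le> K * sqrt (B u u) * sqrt (B w w)"
proof (cases "u = 0 \<or> w = 0")
  case True
  then have "T u w = 0" "B u u = 0 \<or> B w w = 0"
    using linear_0[OF T(1)] linear_0[OF B(1)] T(2)[of u w] by auto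
  then show ?thesis by auto
next
  case False
  define a where "a = sqrt (B u u)"
  define b where "b = sqrt (B w w)"
  have ab: "0 < a" "0 < b" "a\<^sup>2 = B u u" "b\<^sup>2 = B w w"
    using B(3)[of u] B(3)[of w] False by (auto simp: a_def b_def)
  have T2: "linear (T x)" for x using T by (metis (no_types, lifting) ext)
  have B2: "linear (B x)" for x using B(1,2) by (metis (no_types, lifting) ext)
  \<comment> \<open>Each vector is scaled by the length of the other. Both then have the same
    B-length, so the sum of squares from the parallelogram identity equals twice their product and
    no constant is lost.\<close>
  define x where "x = b *\<^sub>R u"
  define y where "y = a *\<^sub>R w"
  have Bxy: "B x x = a\<^sup>2 * b\<^sup>2" "B y y = a\<^sup>2 * b\<^sup>2"
    unfolding x_def y_def linear_scale[OF B(1)] linear_scale[OF B2] by (simp_all add: ab power2_eq_square[of a] power2_eq_square[of b] flip: ab(3,4))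
  have Txy: "T x y = a * b * T u w"
    unfolding x_def y_def linear_scale[OF T(1)] linear_scale[OF T2] by simp
  have "4 * T x y = T (x + y) (x + y) - T (x - y) (x - y)"
    using T(2)[of y x]
    by (simp add: linear_add[OF T(1)] linear_add[OF T2] linear_diff[OF T(1)] linear_diff[OF T2])
  then have "4 * \<bar>T x y\<bar> \<le> K * B (x + y) (x + y) + K * B (x - y) (x - y)"
    using bound[of "x + y"] bound[of "x - y"] by linarith
  also have "\<dots> = 2 * K * (B x x + B y y)"
    using B(2)[of y x]
    by (simp add: linear_add[OF B(1)] linear_add[OF B2] linear_diff[OF B(1)] linear_diff[OF B2] algebra_simps)
  also have "\<dots> = 4 * K * (a\<^sup>2 * b\<^sup>2)" by (simp add: Bxy)
  finally have "\<bar>T x y\<bar> \<le> K * (a\<^sup>2 * b\<^sup>2)" by simp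
  then have "(a * b) * \<bar>T u w\<bar> \<le> (a * b) * (K * a * b)"
    using ab(1,2) by (simp add: Txy abs_mult power2_eq_square ac_simps)
  then have "\<bar>T u w\<bar> \<le> K * a * b"
    using ab(1,2) by simp
  then show ?thesis
    by (simp add: a_def b_def)
qed

text \<open>Definiteness makes the matrix \<open>A\<close> of the form injective, hence surjective
  in finite dimension; \<open>w\<close> solves the linear system with right-hand side
  \<open>p\<close>.\<close>

lemma positive_definite_represents:
  fixes B :: "'a::euclidean_space \<Rightarrow> 'a \<Rightarrow> real"
  assumes B: "\<And>b. linear (\<lambda>a. B a b)" "\<And>a. linear (B a)" "\<And>a. a \<noteq> 0 \<Longrightarrow> 0 < B a a" and p: "linear p"
  obtains w where "\<And>v. B w v = p v"
proof -
  define A where "A a = (\<Sum>i\<in>Basis. B a i *\<^sub>R i)" for a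
  have Ai: "A a \<bullet> i = B a i" if "i \<in> Basis" for a i
    unfolding A_def using that by (rule inner_sum_left_Basis)
  have Ab: "A a \<bullet> b = B a b" for a b
    using linear_euclidean_expansion[OF B(2)[of a], of b] by (simp add: A_def inner_sum_left inner_commute[of b] mult.commute)
  have linA: "linear A"
    by (rule linearI; rule euclidean_eqI)
      (simp_all add: Ai inner_add_left linear_add[OF B(1)] linear_scale[OF B(1)])
  have "inj A"
    unfolding linear_injective_0[OF linA]
    using Ab B(3) by (metis inner_zero_left less_irrefl)
  then obtain w where w: "A w = (\<Sum>i\<in>Basis. p i *\<^sub>R i)"
    using linear_injective_imp_surjective[OF linA] by (metis surjD)
  have "B w v = p v" for v
  proof -
    have "B w v = (\<Sum>i\<in>Basis. p i *\<^sub>R i) \<bullet> v" using Ab[of w v] w by simp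
    also have "\<dots> = p v"
      using linear_euclidean_expansion[OF p, of v] by (simp add: inner_sum_left inner_commute[of v] mult.commute)
    finally show ?thesis .
  qed
  then show ?thesis using that by blast
qed


section \<open>Local norms of a self-concordant function\<close>

text \<open>\<open>q\<close> plays the role of the squared speed: \<open>(q + \<epsilon>)\<^sup>-\<^sup>1\<^sup>/\<^sup>2\<close> is 1-Lipschitz.\<close>

lemma self_concordant_speed_bounds:
  fixes q :: "real \<Rightarrow> real"
  assumes q': "\<And>s. s \<in> {0..T} \<Longrightarrow> (q has_real_derivative q' s) (at s within {0..T})"
    and q0: "\<And>s. s \<in> {0..T} \<Longrightarrow> 0 \<le> q s"
    and b: "\<And>s. s \<in> {0..T} \<Longrightarrow> \<bar>q' s\<bar> \<le> 2 * sqrt (q s) * q s"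
    and t: "t \<in> {0..T}"
  shows "sqrt (q t) * (1 - sqrt (q 0) * t) \<le> sqrt (q 0)"
    and "sqrt (q 0) \<le> sqrt (q t) * (1 + sqrt (q 0) * t)"
proof -
  have T: "0 \<le> t" "t \<le> T" "0 \<in> {0..T}" using t by auto
  \<comment> \<open>The positive \<open>e\<close> keeps the square root away from zero, so that its
    reciprocal \<open>m\<close> is differentiable; the inequalities survive the limit as
    \<open>e\<close> tends to 0.\<close>
  have main: "sqrt (q t + e) * (1 - sqrt (q 0 + e) * t) \<le> sqrt (q 0 + e) \<and>
      sqrt (q 0 + e) \<le> sqrt (q t + e) * (1 + sqrt (q 0 + e) * t)" if e: "0 < e" for e
  proof -
    define m where "m s = inverse (sqrt (q s + e))" for s
    define m' where "m' s = - (q' s / (2 * sqrt (q s + e) * (q s + e)))" for s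
    have pos: "0 < q s + e" if "s \<in> {0..T}" for s using q0[OF that] e by simp
    have der: "(m has_real_derivative m' s) (at s within {0..t})" if s: "s \<in> {0..t}" for s
    proof -
      have sT: "s \<in> {0..T}" using s T by auto
      have qt: "(q has_real_derivative q' s) (at s within {0..t})"
        by (rule has_field_derivative_subset[OF q'[OF sT]]) (use T in auto)
      have "((\<lambda>s. sqrt (q s + e)) has_real_derivative inverse (sqrt (q s + e)) / 2 * (q' s + 0)) (at s within {0..t})"
        by (rule DERIV_chain2[where f=sqrt and g="\<lambda>s. q s + e", OF DERIV_real_sqrt[OF pos[OF sT]] DERIV_add[OF qt DERIV_const]])
      then have d1: "((\<lambda>s. sqrt (q s + e)) has_real_derivative q' s / (2 * sqrt (q s + e))) (at s within {0..t})"
        by (simp add: field_simps)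
      have "(m has_real_derivative - (inverse (sqrt (q s + e)) * (q' s / (2 * sqrt (q s + e))) * inverse (sqrt (q s + e)))) (at s within {0..t})"
        unfolding m_def using pos[OF sT] by (intro DERIV_inverse' d1) auto
      moreover have "inverse y * (q' s / (2 * y)) * inverse y = q' s / (2 * y * (y * y))" for y
        by (cases "y = 0") (simp_all add: divide_simps)
      moreover have "sqrt (q s + e) * sqrt (q s + e) = q s + e" using pos[OF sT] by simp
      ultimately show ?thesis
        unfolding m'_def by (simp only:)
    qed
    \<comment> \<open>The derivative of (q + e)^(-1/2) is -q' / (2 (q + e)^(3/2)), and the
      hypothesis bounds q' by 2 q^(3/2) in absolute value.\<close>
    have bd: "\<bar>m' s\<bar> \<le> 1" if s: "s \<in> {0..t}" for s
    proof -
      have sT: "s \<in> {0..T}" using s T by auto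
      have "\<bar>q' s\<bar> \<le> 2 * sqrt (q s) * q s" by (rule b[OF sT])
      also have "\<dots> \<le> 2 * sqrt (q s + e) * (q s + e)"
        using q0[OF sT] e by (intro mult_mono) auto
      finally show ?thesis
        using pos[OF sT] by (simp add: m'_def abs_mult)
    qed
    have lb: "- 1 \<le> m' s" if "s \<in> {0..t}" for s
      using bd[OF that] by linarith
    have "m t - m 0 \<le> (\<lambda>s. s) t - (\<lambda>s. s) 0"
      by (rule deriv_le_Icc_imp_diff_le[where f=m and g="\<lambda>s. s" and f'=m' and g'="\<lambda>_. 1"])
        (use der bd T in \<open>auto simp: abs_le_iff intro: derivative_intros\<close>)
    moreover have "(\<lambda>s. - s) t - (\<lambda>s. - s) 0 \<le> m t - m 0"
      by (rule deriv_le_Icc_imp_diff_le[where g=m and f="\<lambda>s. - s" and g'=m' and f'="\<lambda>_. - 1"])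
        (use der lb T DERIV_minus[OF DERIV_ident] in auto)
    ultimately have *: "m t - m 0 \<le> t" "m 0 - m t \<le> t" by simp_all
    define y where "y = sqrt (q t + e)"
    define z where "z = sqrt (q 0 + e)"
    have yz: "0 < y" "0 < z" using pos[OF t] pos[OF T(3)] by (auto simp: y_def z_def)
    have "z - y \<le> t * (y * z)" "y - z \<le> t * (y * z)"
      using * yz unfolding m_def y_def[symmetric] z_def[symmetric]
      by (simp_all add: field_simps)
    then show ?thesis
      unfolding y_def[symmetric] z_def[symmetric] by (simp add: algebra_simps)
  qed
  have nb: "at_right (0::real) \<noteq> bot" by (simp add: trivial_limit_at_right_real)
  have lim: "((\<lambda>e. sqrt (q s + e)) \<longlongrightarrow> sqrt (q s)) (at_right 0)" for s
    by (auto intro!: tendsto_eq_intros)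
  have ev: "eventually (\<lambda>e. sqrt (q t + e) * (1 - sqrt (q 0 + e) * t) \<le> sqrt (q 0 + e)) (at_right 0)"
    "eventually (\<lambda>e. sqrt (q 0 + e) \<le> sqrt (q t + e) * (1 + sqrt (q 0 + e) * t)) (at_right 0)"
    using main by (auto simp: eventually_at_filter)
  show "sqrt (q t) * (1 - sqrt (q 0) * t) \<le> sqrt (q 0)"
    by (rule tendsto_le[OF nb _ _ ev(1)]; intro tendsto_intros lim)
  show "sqrt (q 0) \<le> sqrt (q t) * (1 + sqrt (q 0) * t)"
    by (rule tendsto_le[OF nb _ _ ev(2)]; intro tendsto_intros lim)
qed

locale self_concordant_mfd = admissible_mfd M
  for M :: "('m::{t2_space,second_countable_topology}, 'e::euclidean_space) affine_manifold" +
  fixes C :: "'m set" and F :: "'m \<Rightarrow> real"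
  assumes sc: "self_concordant M 1 C F"
begin

lemma open_C: "open C"
  using sc by (simp add: self_concordant_def)

lemma convex_C: "geodesic M {0..1} \<gamma> \<Longrightarrow> \<gamma> 0 \<in> C \<Longrightarrow> \<gamma> 1 \<in> C \<Longrightarrow> t \<in> {0..1} \<Longrightarrow> \<gamma> t \<in> C"
  using sc unfolding self_concordant_def geo_convex_set_def
  by (metis image_subset_iff zero_le_one)

lemma F_C3: "Ck_fun_on M (Suc (Suc (Suc 0))) C F"
  using sc by (simp add: self_concordant_def numeral_3_eq_3)

lemma F_C2: "Ck_fun_on M (Suc (Suc 0)) C F"
  using Ck_fun_on_mono[OF _ F_C3] by simp

lemma closed_epigraph: "closed {(x, y). x \<in> C \<and> F x \<le> y}"
  using sc by (simp add: self_concordant_def closed_fun_on_def)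

text \<open>A horizontal slice of the closed epigraph. Closedness in the whole manifold is what
  keeps a curve on which \<open>F\<close> is bounded from converging to a boundary point.\<close>

lemma closed_sublevel: "closed {x \<in> C. F x \<le> K}"
proof -
  have "closed ((\<lambda>x. (x, K)) -` {(x, y). x \<in> C \<and> F x \<le> y})"
    by (intro closed_vimage closed_epigraph continuous_intros)
  then show ?thesis by (simp add: vimage_def)
qed

abbreviation H :: "'m \<Rightarrow> ('m, 'e) tangent \<Rightarrow> ('m, 'e) tangent \<Rightarrow> real" where
  "H \<equiv> Hess M F"

definition local_norm :: "'m \<Rightarrow> ('m, 'e) tangent \<Rightarrow> real" where
  "local_norm x u = sqrt (H x u u)"

lemma H_pos: "x \<in> C \<Longrightarrow> u \<in> tangent_space M x \<Longrightarrow> u \<noteq> (\<lambda>c. 0) \<Longrightarrow> 0 < H x u u"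
  using sc by (simp add: self_concordant_def nondegenerate_on_def)

lemma coord_H:
  assumes x: "x \<in> C" and c: "c \<in> charts_at M x"
  shows "linear (\<lambda>a. coord_Hess F c x a b)" "linear (coord_Hess F c x a)"
    and "coord_Hess F c x a b = coord_Hess F c x b a"
    and "a \<noteq> 0 \<Longrightarrow> 0 < coord_Hess F c x a a"
    and "u \<in> tangent_space M x \<Longrightarrow> v \<in> tangent_space M x \<Longrightarrow> H x u v = coord_Hess F c x (u c) (v c)"
proof -
  show "linear (\<lambda>a. coord_Hess F c x a b)" "linear (coord_Hess F c x a)"
    by (rule linear_coord_Hess[OF F_C2 open_C x c])+
  show "coord_Hess F c x a b = coord_Hess F c x b a"
    by (rule coord_Hess_symmetric[OF F_C2 open_C x c])
  show 1: "H x u v = coord_Hess F c x (u c) (v c)" if "u \<in> tangent_space M x" "v \<in> tangent_space M x" for u v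
    by (rule Hess_chart[OF F_C2 open_C x that c])
  show "0 < coord_Hess F c x a a" if "a \<noteq> 0"
  proof -
    have "coord_field M c a x \<noteq> (\<lambda>c. 0)"
      using coord_field_self[OF c, of a] that by metis
    from H_pos[OF x coord_field_tangent[OF c] this] show ?thesis
      using 1[OF coord_field_tangent[OF c] coord_field_tangent[OF c], of a a]
      by (simp add: coord_field_self[OF c])
  qed
qed

lemma H_nonneg: "x \<in> C \<Longrightarrow> u \<in> tangent_space M x \<Longrightarrow> 0 \<le> H x u u"
  using coord_H(5)[OF _ chart_at] coord_H(4)[OF _ chart_at] linear_0[OF coord_H(1)[OF _ chart_at]]
  by (cases "u (chart_at M x) = 0") (auto intro: less_imp_le)

lemma H_sym: "x \<in> C \<Longrightarrow> u \<in> tangent_space M x \<Longrightarrow> v \<in> tangent_space M x \<Longrightarrow> H x u v = H x v u"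
  by (rule Hess_symmetric[OF F_C2 open_C])

lemma local_norm_nonneg: "x \<in> C \<Longrightarrow> u \<in> tangent_space M x \<Longrightarrow> 0 \<le> local_norm x u"
  by (simp add: local_norm_def H_nonneg)

lemma local_norm_sq: "x \<in> C \<Longrightarrow> u \<in> tangent_space M x \<Longrightarrow> (local_norm x u)\<^sup>2 = H x u u"
  by (simp add: local_norm_def H_nonneg)

lemma H_cauchy_schwarz:
  assumes x: "x \<in> C" and u: "u \<in> tangent_space M x" and v: "v \<in> tangent_space M x"
  shows "\<bar>H x u v\<bar> \<le> local_norm x u * local_norm x v"
proof -
  note B = coord_H[OF x chart_at]
  have "\<bar>coord_Hess F (chart_at M x) x a a\<bar> \<le> 1 * coord_Hess F (chart_at M x) x a a" for a
    using B(4)[of a] linear_0[OF B(1), of 0] by (cases "a = 0") auto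
  from polarization_bound[OF B(1,3) B(1,3,4) this]
  show ?thesis
    unfolding local_norm_def B(5)[OF u v] B(5)[OF u u] B(5)[OF v v] by simp
qed

lemma nabla_H_bound:
  assumes x: "x \<in> C" and v: "v \<in> tangent_space M x" and u: "u \<in> tangent_space M x" and w: "w \<in> tangent_space M x"
  shows "\<bar>nabla_Hess M F x v u w\<bar> \<le> 2 * local_norm x v * (local_norm x u * local_norm x w)"
proof -
  define c where "c = chart_at M x"
  have c: "c \<in> charts_at M x" by (simp add: c_def chart_at)
  note B = coord_H[OF x c]
  note N = nabla_Hess_chart_at[OF F_C3 open_C x v _ _ c_def]
  have "\<bar>coord_nabla_Hess F c x (v c) a a\<bar> \<le> 2 * local_norm x v * coord_Hess F c x a a" for a
  proof -
    let ?a = "coord_field M c a x"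
    have a: "?a \<in> tangent_space M x" by (rule coord_field_tangent[OF c])
    have "\<bar>nabla_Hess M F x v ?a ?a\<bar> \<le> 2 * 1 * sqrt (Hess M F x v v) * Hess M F x ?a ?a"
      using sc x v a unfolding self_concordant_def by blast
    then show ?thesis
      unfolding N[OF a a] B(5)[OF a a] by (simp add: coord_field_self[OF c] local_norm_def)
  qed
  from polarization_bound[OF linear_coord_nabla_Hess[OF F_C3 open_C x c]
      coord_nabla_Hess_symmetric[OF F_C3 open_C x c] B(1,3,4) this, of "u c" "w c"]
  show ?thesis
    unfolding N[OF u w] local_norm_def B(5)[OF u u] B(5)[OF w w] by (simp add: mult.assoc)
qed

text \<open>\<open>tangent_space\<close> is a set of chart-indexed families rather than a type, so
  linearity is required on it alone; outside it \<open>p\<close> is unconstrained.\<close>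

definition covector :: "'m \<Rightarrow> (('m, 'e) tangent \<Rightarrow> real) \<Rightarrow> bool" where
  "covector x p \<longleftrightarrow> (\<forall>u\<in>tangent_space M x. \<forall>v\<in>tangent_space M x. \<forall>a b.
     p (\<lambda>c. a *\<^sub>R u c + b *\<^sub>R v c) = a * p u + b * p v)"

lemma covectorD:
  "covector x p \<Longrightarrow> u \<in> tangent_space M x \<Longrightarrow> v \<in> tangent_space M x \<Longrightarrow>
    p (\<lambda>c. a *\<^sub>R u c + b *\<^sub>R v c) = a * p u + b * p v"
  by (simp add: covector_def)

lemma covector_differential: "Ck_fun_on M (Suc k) U f \<Longrightarrow> x \<in> U \<Longrightarrow> covector x (differential M f x)"
  using differential_linear by (auto simp: covector_def)

lemma covector_H: "x \<in> C \<Longrightarrow> u \<in> tangent_space M x \<Longrightarrow> covector x (H x u)"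
  unfolding covector_def
  using Hess_linear[OF F_C2 open_C] by (simp add: H_sym[of x u] tangent_linear_comb)

lemma covector_lincomb: "covector x p \<Longrightarrow> covector x q \<Longrightarrow> covector x (\<lambda>v. r * p v + s * q v)"
  by (auto simp: covector_def algebra_simps)

text \<open>This makes the definite descriptions in \<open>dual_norm\<close> and
  \<open>newton_direction\<close> meaningful. Existence is solved in one chart; uniqueness is
  definiteness applied to the difference of two solutions.\<close>

lemma riesz:
  assumes x: "x \<in> C" and p: "covector x p"
  shows "\<exists>!w. w \<in> tangent_space M x \<and> (\<forall>v\<in>tangent_space M x. H x w v = p v)"
proof -
  define c where "c = chart_at M x"
  have c: "c \<in> charts_at M x" by (simp add: c_def chart_at)
  note B = coord_H[OF x c]
  have "linear (\<lambda>a. p (coord_field M c a x))"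
  proof (rule linearI)
    fix a b :: 'e and r :: real
    show "p (coord_field M c (a + b) x) = p (coord_field M c a x) + p (coord_field M c b x)"
      using covectorD[OF p coord_field_tangent[OF c] coord_field_tangent[OF c], of 1 a 1 b]
        coord_field_linear[OF c, of 1 a 1 b] by simp
    show "p (coord_field M c (r *\<^sub>R a) x) = r *\<^sub>R p (coord_field M c a x)"
      using covectorD[OF p coord_field_tangent[OF c] coord_field_tangent[OF c], of r a 0 a]
        coord_field_linear[OF c, of r a 0 a] by simp
  qed
  then obtain w where w: "\<And>a. coord_Hess F c x w a = p (coord_field M c a x)"
    using positive_definite_represents[OF B(1,2,4)] by blast
  show ?thesis
  proof (rule ex1I)
    show "coord_field M c w x \<in> tangent_space M x \<and> (\<forall>v\<in>tangent_space M x. H x (coord_field M c w x) v = p v)"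
      using w B(5)[OF coord_field_tangent[OF c]]
      by (simp add: coord_field_tangent[OF c] coord_field_self[OF c] coord_field_tangent_coord[OF _ c])
    fix w' assume w': "w' \<in> tangent_space M x \<and> (\<forall>v\<in>tangent_space M x. H x w' v = p v)"
    have "coord_Hess F c x (w' c) a = coord_Hess F c x w a" for a
      using w[of a] w' B(5)[OF _ coord_field_tangent[OF c], of w' a]
      by (simp add: coord_field_tangent[OF c] coord_field_self[OF c])
    then have "coord_Hess F c x (w' c - w) (w' c - w) = 0"
      using linear_diff[OF B(1)] by simp
    then have "w' c = w" using B(4)[of "w' c - w"] by force
    then show "w' = coord_field M c w x"
      using coord_field_tangent_coord[of w' x c] w' c by simp
  qed
qed

lemma dual_norm_riesz:
  assumes x: "x \<in> C" and p: "covector x p"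
    and w: "w \<in> tangent_space M x" "\<And>v. v \<in> tangent_space M x \<Longrightarrow> H x w v = p v"
  shows "dual_norm M F x p = local_norm x w"
proof -
  have "(THE w. w \<in> tangent_space M x \<and> (\<forall>v\<in>tangent_space M x. H x w v = p v)) = w"
    using w by (intro the1_equality[OF riesz[OF x p]]) auto
  then show ?thesis
    using w by (simp add: dual_norm_def local_norm_def)
qed

lemma dual_norm_nonneg:
  assumes x: "x \<in> C" and p: "covector x p"
  shows "0 \<le> dual_norm M F x p"
proof -
  obtain w where w: "w \<in> tangent_space M x" "\<And>v. v \<in> tangent_space M x \<Longrightarrow> H x w v = p v"
    using riesz[OF x p] by blast
  show ?thesis
    using dual_norm_riesz[OF x p w] local_norm_nonneg[OF x w(1)] by simp
qed

lemma dual_norm_bound: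
  assumes x: "x \<in> C" and p: "covector x p" and v: "v \<in> tangent_space M x"
  shows "\<bar>p v\<bar> \<le> dual_norm M F x p * local_norm x v"
proof -
  obtain w where w: "w \<in> tangent_space M x" "\<And>v. v \<in> tangent_space M x \<Longrightarrow> H x w v = p v"
    using riesz[OF x p] by blast
  show ?thesis
    using dual_norm_riesz[OF x p w] H_cauchy_schwarz[OF x w(1) v] w(2)[OF v] by simp
qed

text \<open>The representative w of p is its own test vector: its squared local norm is p w, which
  is at most K times its local norm.\<close>

lemma dual_norm_le:
  assumes x: "x \<in> C" and p: "covector x p" and K: "0 \<le> K"
    and le: "\<And>v. v \<in> tangent_space M x \<Longrightarrow> \<bar>p v\<bar> \<le> K * local_norm x v"
  shows "dual_norm M F x p \<le> K"
proof -
  obtain w where w: "w \<in> tangent_space M x" "\<And>v. v \<in> tangent_space M x \<Longrightarrow> H x w v = p v"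
    using riesz[OF x p] by blast
  have "local_norm x w * local_norm x w \<le> K * local_norm x w"
    using le[OF w(1)] w(2)[OF w(1)] local_norm_sq[OF x w(1)] by (simp add: power2_eq_square)
  then have "local_norm x w \<le> K"
    using local_norm_nonneg[OF x w(1)] K by (cases "local_norm x w = 0") auto
  then show ?thesis
    using dual_norm_riesz[OF x p w] by simp
qed

lemma dual_norm_lincomb_le:
  assumes x: "x \<in> C" and p: "covector x p" and q: "covector x q"
    and eq: "\<And>v. v \<in> tangent_space M x \<Longrightarrow> h v = r * p v + s * q v" and h: "covector x h"
  shows "dual_norm M F x h \<le> \<bar>r\<bar> * dual_norm M F x p + \<bar>s\<bar> * dual_norm M F x q"
proof (rule dual_norm_le[OF x h])
  show "0 \<le> \<bar>r\<bar> * dual_norm M F x p + \<bar>s\<bar> * dual_norm M F x q"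
    using dual_norm_nonneg[OF x p] dual_norm_nonneg[OF x q] by simp
  fix v assume v: "v \<in> tangent_space M x"
  have "\<bar>h v\<bar> \<le> \<bar>r\<bar> * \<bar>p v\<bar> + \<bar>s\<bar> * \<bar>q v\<bar>"
    unfolding eq[OF v] by (metis abs_mult abs_triangle_ineq)
  also have "\<dots> \<le> \<bar>r\<bar> * (dual_norm M F x p * local_norm x v) + \<bar>s\<bar> * (dual_norm M F x q * local_norm x v)"
    using dual_norm_bound[OF x p v] dual_norm_bound[OF x q v] by (intro add_mono mult_left_mono) auto
  finally show "\<bar>h v\<bar> \<le> (\<bar>r\<bar> * dual_norm M F x p + \<bar>s\<bar> * dual_norm M F x q) * local_norm x v"
    by (simp add: algebra_simps)
qed


section \<open>Geodesics in the domain of a self-concordant function\<close>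

lemma derivative_restrict:
  fixes f :: "real \<Rightarrow> real"
  assumes "(f has_real_derivative f') (at t within {0..1})" "T \<le> 1"
  shows "(f has_real_derivative f') (at t within {0..T})"
  using assms by (intro has_field_derivative_subset[OF assms(1)]) auto

lemma geodesic_speed:
  assumes g: "geodesic M {0..1} \<gamma>" and T: "T \<le> 1" and inC: "\<And>s. s \<in> {0..T} \<Longrightarrow> \<gamma> s \<in> C"
    and V: "V = velocity M \<gamma> {0..1}" and t: "t \<in> {0..T}"
    and r0: "r0 = local_norm (\<gamma> 0) (V 0)"
  shows "local_norm (\<gamma> t) (V t) * (1 - r0 * t) \<le> r0"
    and "r0 \<le> local_norm (\<gamma> t) (V t) * (1 + r0 * t)"
proof -
  have tan: "V s \<in> tangent_space M (\<gamma> s)" if "s \<in> {0..T}" for s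
    unfolding V using that T by (intro velocity_tangent[OF g]) auto
  have d: "((\<lambda>s. H (\<gamma> s) (V s) (V s)) has_real_derivative nabla_Hess M F (\<gamma> s) (V s) (V s) (V s)) (at s within {0..T})"
    if "s \<in> {0..T}" for s
    unfolding V
    by (rule derivative_restrict[OF geodesic_third_derivative[OF g _ _ F_C3 open_C inC[OF that]] T])
      (use that T in auto)
  have n: "0 \<le> H (\<gamma> s) (V s) (V s)" if "s \<in> {0..T}" for s
    by (rule H_nonneg[OF inC[OF that] tan[OF that]])
  have b: "\<bar>nabla_Hess M F (\<gamma> s) (V s) (V s) (V s)\<bar> \<le> 2 * sqrt (H (\<gamma> s) (V s) (V s)) * H (\<gamma> s) (V s) (V s)"
    if "s \<in> {0..T}" for s
    using nabla_H_bound[OF inC[OF that] tan[OF that] tan[OF that] tan[OF that]]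
      local_norm_sq[OF inC[OF that] tan[OF that]] by (simp add: local_norm_def power2_eq_square)
  show "local_norm (\<gamma> t) (V t) * (1 - r0 * t) \<le> r0"
    "r0 \<le> local_norm (\<gamma> t) (V t) * (1 + r0 * t)"
    unfolding r0 local_norm_def
    by (rule self_concordant_speed_bounds[OF d n b t]; assumption)+
qed

text \<open>A first exit is excluded because up to it the curve lies in the closed sublevel set at
  height \<open>K\<close>, which contains its limit. The estimate on \<open>F\<close> is demanded
  only for times up to which the curve is already known to stay in the domain.\<close>

lemma geodesic_stays:
  assumes g: "geodesic M {0..1} \<gamma>" and 0: "\<gamma> 0 \<in> C"
    and bound: "\<And>T. T \<in> {0..1} \<Longrightarrow> (\<And>s. s \<in> {0..T} \<Longrightarrow> \<gamma> s \<in> C) \<Longrightarrow> F (\<gamma> T) \<le> K"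
    and t: "t \<in> {0..1}"
  shows "\<gamma> t \<in> C"
proof (rule unit_interval_continuation[where P="\<lambda>s. \<gamma> s \<in> C", OF 0 _ _ t])
  fix T :: real assume T: "0 < T" "T \<le> 1" and below: "\<And>r. r \<in> {0..<T} \<Longrightarrow> \<gamma> r \<in> C"
  have nt: "at T within {0..<T} \<noteq> bot" using T by (simp add: at_within_eq_bot_iff)
  have sub: "{0..<T} \<subseteq> {0..1}" using T by auto
  have "(\<gamma> \<longlongrightarrow> \<gamma> T) (at T within {0..1})"
    using g T by (auto simp: geodesic_def continuous_on_def)
  note lim = tendsto_within_subset[OF this sub]
  have "\<gamma> r \<in> {x \<in> C. F x \<le> K}" if "r \<in> {0..<T}" for r
  proof -
    have r: "r \<in> {0..1}" "\<And>s. s \<in> {0..r} \<Longrightarrow> \<gamma> s \<in> C"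
      using that T below by auto
    show ?thesis using bound[OF r] r(2)[of r] r(1) by simp
  qed
  then have "eventually (\<lambda>r. \<gamma> r \<in> {x \<in> C. F x \<le> K}) (at T within {0..<T})"
    by (auto simp: eventually_at intro!: exI[of _ 1])
  then have "\<gamma> T \<in> {x \<in> C. F x \<le> K}"
    by (rule Lim_in_closed_set[OF closed_sublevel _ nt lim])
  then show "\<gamma> T \<in> C" by simp
next
  fix T :: real assume T: "0 \<le> T" "T < 1" and TA: "\<And>r. r \<in> {0..T} \<Longrightarrow> \<gamma> r \<in> C"
  have "T \<in> {0..1}" "\<gamma> T \<in> C" using T TA by auto
  then obtain d where d: "0 < d" "\<And>s. s \<in> {0..1} \<Longrightarrow> dist s T < d \<Longrightarrow> \<gamma> s \<in> C"
    using geodesic_near[OF g _ open_C] by blast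
  show "\<exists>d>0. \<forall>r\<in>{T..T + d}. r \<le> 1 \<longrightarrow> \<gamma> r \<in> C"
    using d T by (intro exI[of _ "d / 2"]) (auto simp: dist_real_def)
qed

lemma dikin:
  assumes g: "geodesic M {0..1} \<gamma>" and 0: "\<gamma> 0 \<in> C"
    and r0: "r0 = local_norm (\<gamma> 0) (velocity M \<gamma> {0..1} 0)" and r1: "r0 < 1"
    and t: "t \<in> {0..1}"
  shows "\<gamma> t \<in> C"
proof (rule geodesic_stays[OF g 0 _ t])
  define V where "V = velocity M \<gamma> {0..1}"
  define a where "a = differential M F (\<gamma> 0) (V 0)"
  \<comment> \<open>The speed estimate gives local norm at most r0 / (1 - r0 s), hence at most r0 /
    (1 - r0); \<open>k\<close> is the square of this, a bound for the second derivative of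
    \<open>F\<close> along the curve.\<close>
  define k where "k = (r0 / (1 - r0))\<^sup>2"
  fix T assume T: "T \<in> {0..1}" and inC: "\<And>s. s \<in> {0..T} \<Longrightarrow> \<gamma> s \<in> C"
  have r0n: "0 \<le> r0"
    unfolding r0 by (intro local_norm_nonneg 0 velocity_tangent[OF g]) auto
  have tan: "V s \<in> tangent_space M (\<gamma> s)" if "s \<in> {0..T}" for s
    unfolding V_def using that T by (intro velocity_tangent[OF g]) auto
  have d1: "((\<lambda>s. F (\<gamma> s)) has_real_derivative differential M F (\<gamma> s) (V s)) (at s within {0..T})"
    and d2: "((\<lambda>s. differential M F (\<gamma> s) (V s)) has_real_derivative H (\<gamma> s) (V s) (V s)) (at s within {0..T})"
    if "s \<in> {0..T}" for s
    unfolding V_def using that T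
      derivative_restrict[OF geodesic_chain[OF g _ _ F_C2 inC[OF that]], of T]
      derivative_restrict[OF geodesic_second_derivative[OF g _ _ F_C2 open_C inC[OF that]], of T]
    by auto
  have k: "H (\<gamma> s) (V s) (V s) \<le> k" if s: "s \<in> {0..T}" for s
  proof -
    have "local_norm (\<gamma> s) (V s) * (1 - r0 * s) \<le> r0"
      by (rule geodesic_speed(1)[OF g _ inC V_def s]) (use T r0 V_def in auto)
    moreover have "1 - r0 \<le> 1 - r0 * s"
      using s T r0n by (simp add: mult_left_le)
    moreover have n: "0 \<le> local_norm (\<gamma> s) (V s)" by (rule local_norm_nonneg[OF inC[OF s] tan[OF s]])
    ultimately have "local_norm (\<gamma> s) (V s) * (1 - r0) \<le> r0"
      by (meson mult_left_mono order_trans)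
    then have "local_norm (\<gamma> s) (V s) \<le> r0 / (1 - r0)"
      using r1 by (simp add: field_simps)
    then have "(local_norm (\<gamma> s) (V s))\<^sup>2 \<le> k"
      unfolding k_def using n by (rule power_mono)
    then show ?thesis using local_norm_sq[OF inC[OF s] tan[OF s]] by simp
  qed
  \<comment> \<open>First of two integrations. Taking the absolute value of the initial slope
    \<open>a\<close> makes the bound nonnegative, so that a final time T \<le> 1 can be replaced by
    1.\<close>
  have p: "differential M F (\<gamma> s) (V s) \<le> \<bar>a\<bar> + k" if s: "s \<in> {0..T}" for s
  proof -
    have "differential M F (\<gamma> s) (V s) - differential M F (\<gamma> 0) (V 0) \<le> k * s - k * 0"
      by (rule deriv_le_Icc_imp_diff_le[where f'="\<lambda>s. H (\<gamma> s) (V s) (V s)" and g'="\<lambda>_. k" and g="\<lambda>s. k * s"])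
        (use s in \<open>auto intro!: k derivative_eq_intros has_field_derivative_subset[OF d2]\<close>)
    moreover have "k * s \<le> k * 1" using s T by (intro mult_left_mono) (auto simp: k_def)
    ultimately show ?thesis unfolding a_def by linarith
  qed
  have "F (\<gamma> T) - F (\<gamma> 0) \<le> (\<bar>a\<bar> + k) * T - (\<bar>a\<bar> + k) * 0"
    by (rule deriv_le_Icc_imp_diff_le[where f'="\<lambda>s. differential M F (\<gamma> s) (V s)" and g'="\<lambda>_. \<bar>a\<bar> + k" and g="\<lambda>s. (\<bar>a\<bar> + k) * s" and f="\<lambda>s. F (\<gamma> s)"])
      (use T in \<open>auto intro!: p d1 derivative_eq_intros\<close>)
  moreover have "(\<bar>a\<bar> + k) * T \<le> (\<bar>a\<bar> + k) * 1" using T by (intro mult_left_mono) (auto simp: k_def)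
  ultimately show "F (\<gamma> T) \<le> F (\<gamma> 0) + (\<bar>a\<bar> + k)" by simp
qed

end

section \<open>Newton steps and distance to a critical point\<close>

context self_concordant_mfd
begin

lemma newton_step:
  assumes f: "Ck_fun_on M (Suc (Suc 0)) C f"
    and fF: "\<And>x u v. x \<in> C \<Longrightarrow> u \<in> tangent_space M x \<Longrightarrow> v \<in> tangent_space M x \<Longrightarrow> Hess M f x u v = H x u v"
    and x: "x \<in> C" and u: "u \<in> tangent_space M x"
    and newton: "\<And>v. v \<in> tangent_space M x \<Longrightarrow> differential M f x v + H x u v = 0"
    and r0: "r0 = local_norm x u" and r1: "r0 < 1"
  shows "exp_map M x u \<in> C"
    and "dual_norm M F (exp_map M x u) (differential M f (exp_map M x u)) \<le> (r0 / (1 - r0))\<^sup>2"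
proof -
  obtain \<gamma> where g: "geodesic M {0..1} \<gamma>" and g0: "\<gamma> 0 = x" and g1: "\<gamma> 1 = exp_map M x u"
    and v0: "velocity M \<gamma> {0..1} 0 = u"
    using geodesic_exp[OF u] .
  have inC: "\<gamma> s \<in> C" if "s \<in> {0..1}" for s
    by (rule dikin[OF g _ _ r1 that]) (simp_all add: g0 v0 x r0)
  show "exp_map M x u \<in> C" using inC[of 1] g1 by simp
  define V where "V = velocity M \<gamma> {0..1}"
  have V: "V s \<in> tangent_space M (\<gamma> s)" if "s \<in> {0..1}" for s
    unfolding V_def using that by (intro velocity_tangent[OF g]) auto
  define p where "p s v = differential M f (\<gamma> s) v + (1 - s) * H (\<gamma> s) (V s) v" for s v
  have cov: "covector (\<gamma> s) (p s)" if "s \<in> {0..1}" for s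
    using covector_lincomb[OF covector_differential[OF f inC[OF that]] covector_H[OF inC[OF that] V[OF that]], of 1 "1 - s"]
    unfolding p_def by simp
  have "\<forall>s\<in>{0..1}. \<exists>w. w \<in> tangent_space M (\<gamma> s) \<and> (\<forall>v\<in>tangent_space M (\<gamma> s). H (\<gamma> s) w v = p s v)"
    using riesz[OF inC cov] by blast
  then obtain W where W: "\<And>s. s \<in> {0..1} \<Longrightarrow> W s \<in> tangent_space M (\<gamma> s)"
    and WP: "\<And>s v. s \<in> {0..1} \<Longrightarrow> v \<in> tangent_space M (\<gamma> s) \<Longrightarrow> H (\<gamma> s) (W s) v = p s v"
    by metis
  define N where "N s = H (\<gamma> s) (W s) (W s)" for s
  define N' where "N' s = 2 * (1 - s) * nabla_Hess M F (\<gamma> s) (V s) (V s) (W s)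
      - nabla_Hess M F (\<gamma> s) (V s) (W s) (W s)" for s
  have der: "(N has_real_derivative N' s) (at s within {0..1})" if s: "s \<in> {0..1}" for s
    unfolding N_def N'_def
    by (rule newton_defect_derivative[OF g _ s F_C3 open_C inC[OF s] f H_pos fF V_def])
      (use W WP in \<open>auto simp: p_def\<close>)
  have N0: "0 \<le> N s" if "s \<in> {0..1}" for s
    unfolding N_def by (rule H_nonneg[OF inC[OF that] W[OF that]])
  have "p 0 v = 0" if "v \<in> tangent_space M x" for v
    using newton[OF that] v0 by (simp add: p_def g0 V_def)
  then have Ni: "N 0 = 0"
    using WP[of 0 "W 0"] W[of 0] by (simp add: N_def g0)
  have r0n: "0 \<le> r0" unfolding r0 by (rule local_norm_nonneg[OF x u])
  define r where "r s = local_norm (\<gamma> s) (V s)" for s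
  have rn: "0 \<le> r s" if "s \<in> {0..1}" for s
    unfolding r_def by (rule local_norm_nonneg[OF inC[OF that] V[OF that]])
  have r_bound: "r s * (1 - r0 * s) \<le> r0" if "s \<in> {0..1}" for s
    unfolding r_def by (rule geodesic_speed(1)[OF g _ inC V_def that]) (simp_all add: r0 g0 v0 V_def)
  have one: "1 - r0 \<le> 1 - r0 * s" if "s \<in> {0..1}" for s
    using that r0n by (simp add: mult_left_le)
  have r_bound': "r s \<le> r0 / (1 - r0)" if s: "s \<in> {0..1}" for s
  proof -
    have "r s * (1 - r0) \<le> r s * (1 - r0 * s)" by (rule mult_left_mono[OF one[OF s] rn[OF s]])
    then show ?thesis using r_bound[OF s] r1 by (simp add: field_simps)
  qed
  \<comment> \<open>Below, the weighted root of \<open>N\<close> has derivative at most c (2 - 2 s),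
    whose integral over the unit interval is \<open>c\<close>. Dividing by the final weight 1 - r0
    turns \<open>c\<close> into (r0 / (1 - r0))^2.\<close>
  define c where "c = r0 * (r0 / (1 - r0))"
  have N'_bound: "N' s \<le> 4 * (1 - s) * (r s)\<^sup>2 * sqrt (N s) + 2 * r s * N s" if s: "s \<in> {0..1}" for s
  proof -
    have n: "local_norm (\<gamma> s) (W s) = sqrt (N s)" by (simp add: local_norm_def N_def)
    have 1: "nabla_Hess M F (\<gamma> s) (V s) (V s) (W s) \<le> 2 * r s * (r s * sqrt (N s))"
      using nabla_H_bound[OF inC[OF s] V[OF s] V[OF s] W[OF s]] by (simp add: n r_def)
    have 2: "- nabla_Hess M F (\<gamma> s) (V s) (W s) (W s) \<le> 2 * r s * (sqrt (N s) * sqrt (N s))"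
      using nabla_H_bound[OF inC[OF s] V[OF s] W[OF s] W[OF s]] by (simp add: n r_def)
    have "2 * (1 - s) * nabla_Hess M F (\<gamma> s) (V s) (V s) (W s) \<le> 2 * (1 - s) * (2 * r s * (r s * sqrt (N s)))"
      using s by (intro mult_left_mono 1) auto
    then show ?thesis
      using 2 N0[OF s] unfolding N'_def by (simp add: power2_eq_square algebra_simps)
  qed
  \<comment> \<open>The defect vanishes at s = 0, where the square root of \<open>N\<close> need not
    be differentiable. Adding e^2 under the root repairs this at the cost of the initial value
    \<open>y 0 = e\<close>.\<close>
  have step: "sqrt (N 1) * (1 - r0) \<le> c + e" if e: "0 < e" for e
  proof -
    define y where "y s = sqrt (N s + e\<^sup>2)" for s
    have ypos: "0 < y s" if "s \<in> {0..1}" for s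
      using N0[OF that] e by (simp add: y_def add_nonneg_pos)
    have y': "(y has_real_derivative N' s / (2 * y s)) (at s within {0..1})" if s: "s \<in> {0..1}" for s
    proof -
      have "0 < N s + e\<^sup>2" using N0[OF s] e by (simp add: add_nonneg_pos)
      then have "(y has_real_derivative inverse (sqrt (N s + e\<^sup>2)) / 2 * (N' s + 0)) (at s within {0..1})"
        unfolding y_def
        by (intro DERIV_chain2[where f=sqrt and g="\<lambda>s. N s + e\<^sup>2", OF DERIV_real_sqrt DERIV_add[OF der[OF s] DERIV_const]])
      then show ?thesis by (simp add: y_def field_simps)
    qed
    have ny: "sqrt (N s) \<le> y s" if "s \<in> {0..1}" for s
      unfolding y_def using e by simp
    have yy: "N s \<le> y s * y s" if "s \<in> {0..1}" for s
      using N0[OF that] by (simp add: y_def)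
    have dq: "N' s / (2 * y s) \<le> 2 * (1 - s) * (r s)\<^sup>2 + r s * y s" if s: "s \<in> {0..1}" for s
    proof -
      have "4 * (1 - s) * (r s)\<^sup>2 * sqrt (N s) \<le> 4 * (1 - s) * (r s)\<^sup>2 * y s"
        using s by (intro mult_left_mono ny[OF s]) auto
      moreover have "2 * r s * N s \<le> 2 * r s * (y s * y s)"
        using rn[OF s] by (intro mult_left_mono yy[OF s]) auto
      ultimately have "N' s \<le> (2 * (1 - s) * (r s)\<^sup>2 + r s * y s) * (2 * y s)"
        using N'_bound[OF s] by (simp add: algebra_simps)
      then show ?thesis using ypos[OF s] by (simp add: pos_divide_le_eq)
    qed
    \<comment> \<open>The weight 1 - r0 s is an integrating factor: its derivative contributes -r0
      y, which compensates the term r y (1 - r0 s) because r (1 - r0 s) \<le> r0 by the speed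
      estimate.\<close>
    define m' where "m' s = N' s / (2 * y s) * (1 - r0 * s) + y s * (- r0)" for s
    have m': "((\<lambda>s. y s * (1 - r0 * s)) has_real_derivative m' s) (at s within {0..1})" if s: "s \<in> {0..1}" for s
      unfolding m'_def by (rule derivative_eq_intros y'[OF s] refl | simp)+
    have m'_le: "m' s \<le> c * (2 - 2 * s)" if s: "s \<in> {0..1}" for s
    proof -
      have pos: "0 \<le> 1 - r0 * s" using one[OF s] r1 by simp
      have "N' s / (2 * y s) * (1 - r0 * s) \<le> (2 * (1 - s) * (r s)\<^sup>2 + r s * y s) * (1 - r0 * s)"
        by (rule mult_right_mono[OF dq[OF s] pos])
      also have "\<dots> = 2 * (1 - s) * r s * (r s * (1 - r0 * s)) + y s * (r s * (1 - r0 * s))"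
        by (simp add: power2_eq_square algebra_simps)
      also have "\<dots> \<le> 2 * (1 - s) * r s * r0 + y s * r0"
        using s rn[OF s] ypos[OF s] r_bound[OF s] by (intro add_mono mult_left_mono) auto
      finally have "m' s \<le> 2 * (1 - s) * r0 * r s" by (simp add: m'_def algebra_simps)
      also have "\<dots> \<le> 2 * (1 - s) * r0 * (r0 / (1 - r0))"
        using s r0n by (intro mult_left_mono r_bound'[OF s]) auto
      finally show ?thesis by (simp add: c_def algebra_simps)
    qed
    have "y 1 * (1 - r0 * 1) - y 0 * (1 - r0 * 0) \<le> c * (2 * 1 - 1\<^sup>2) - c * (2 * 0 - 0\<^sup>2)"
      by (rule deriv_le_Icc_imp_diff_le[where f="\<lambda>s. y s * (1 - r0 * s)" and g="\<lambda>s. c * (2 * s - s\<^sup>2)", OF _ m' _ m'_le])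
        (auto intro!: derivative_eq_intros)
    moreover have "y 0 = e" using e by (simp add: y_def Ni)
    ultimately have "y 1 * (1 - r0) \<le> c + e" by simp
    moreover have "sqrt (N 1) * (1 - r0) \<le> y 1 * (1 - r0)"
      using r1 by (intro mult_right_mono ny) auto
    ultimately show ?thesis by simp
  qed
  have "sqrt (N 1) * (1 - r0) \<le> c" by (rule field_le_epsilon[OF step])
  then have "sqrt (N 1) \<le> c / (1 - r0)" using r1 by (simp add: pos_le_divide_eq)
  also have "\<dots> = (r0 / (1 - r0))\<^sup>2" by (simp add: c_def power2_eq_square)
  finally have *: "sqrt (N 1) \<le> (r0 / (1 - r0))\<^sup>2" .
  have "dual_norm M F (\<gamma> 1) (differential M f (\<gamma> 1)) = local_norm (\<gamma> 1) (W 1)"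
    by (rule dual_norm_riesz[OF inC covector_differential[OF f inC] W])
      (use WP[of 1] in \<open>simp_all add: p_def\<close>)
  then show "dual_norm M F (exp_map M x u) (differential M f (exp_map M x u)) \<le> (r0 / (1 - r0))\<^sup>2"
    using * by (simp add: g1 local_norm_def N_def)
qed

text \<open>Towards the critical point, the differential of \<open>f\<close> at the velocity rises
  from at least -b r to 0, where r is the initial speed. Self-concordance forces its derivative to
  be at least r^2 / (1 + r s)^2, with integral r - r / (1 + r). Hence r / (1 + r) \<le> b.\<close>

lemma distance_to_critical_point:
  assumes f: "Ck_fun_on M (Suc (Suc 0)) C f"
    and fF: "\<And>x u v. x \<in> C \<Longrightarrow> u \<in> tangent_space M x \<Longrightarrow> v \<in> tangent_space M x \<Longrightarrow> Hess M f x u v = H x u v"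
    and g: "geodesic M {0..1} \<gamma>" and inC: "\<And>s. s \<in> {0..1} \<Longrightarrow> \<gamma> s \<in> C"
    and crit: "\<And>v. v \<in> tangent_space M (\<gamma> 1) \<Longrightarrow> differential M f (\<gamma> 1) v = 0"
    and le: "dual_norm M F (\<gamma> 0) (differential M f (\<gamma> 0)) \<le> b" and b: "b < 1"
  shows "local_norm (\<gamma> 0) (velocity M \<gamma> {0..1} 0) \<le> b / (1 - b)"
proof -
  define V where "V = velocity M \<gamma> {0..1}"
  have V: "V s \<in> tangent_space M (\<gamma> s)" if "s \<in> {0..1}" for s
    unfolding V_def using that by (intro velocity_tangent[OF g]) auto
  define r where "r = local_norm (\<gamma> 0) (V 0)"
  have rn: "0 \<le> r" unfolding r_def by (intro local_norm_nonneg inC V) auto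
  have b0: "0 \<le> b"
    using dual_norm_nonneg[OF inC covector_differential[OF f inC]] le by force
  have D: "((\<lambda>s. differential M f (\<gamma> s) (V s)) has_real_derivative Hess M f (\<gamma> s) (V s) (V s)) (at s within {0..1})"
    if "s \<in> {0..1}" for s
    unfolding V_def by (rule geodesic_second_derivative[OF g _ that f open_C inC[OF that]]) simp
  have pos: "0 < 1 + r * s" if "s \<in> {0..1}" for s
    using that rn by (simp add: add_pos_nonneg)
  have low: "r\<^sup>2 / (1 + r * s)\<^sup>2 \<le> Hess M f (\<gamma> s) (V s) (V s)" if s: "s \<in> {0..1}" for s
  proof -
    have "r \<le> local_norm (\<gamma> s) (V s) * (1 + r * s)"
      by (rule geodesic_speed(2)[OF g _ inC V_def s]) (simp_all add: r_def)
    then have "r / (1 + r * s) \<le> local_norm (\<gamma> s) (V s)"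
      using pos[OF s] by (simp add: pos_divide_le_eq)
    then have "(r / (1 + r * s))\<^sup>2 \<le> (local_norm (\<gamma> s) (V s))\<^sup>2"
      using rn pos[OF s] by (intro power_mono) auto
    then show ?thesis
      using local_norm_sq[OF inC[OF s] V[OF s]] fF[OF inC[OF s] V[OF s] V[OF s]] by (simp add: power_divide)
  qed
  have "- r / (1 + r * 1) - - r / (1 + r * 0) \<le>
      differential M f (\<gamma> 1) (V 1) - differential M f (\<gamma> 0) (V 0)"
  proof (rule deriv_le_Icc_imp_diff_le[where f="\<lambda>s. - r / (1 + r * s)", OF _ _ D low])
    show "((\<lambda>s. - r / (1 + r * s)) has_real_derivative r\<^sup>2 / (1 + r * s)\<^sup>2) (at s within {0..1})"
      if "s \<in> {0..1}" for s
      using pos[OF that] by (auto intro!: derivative_eq_intros simp: power2_eq_square)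
  qed auto
  moreover have "differential M f (\<gamma> 1) (V 1) = 0" by (rule crit[OF V]) simp
  moreover have "- differential M f (\<gamma> 0) (V 0) \<le> b * r"
  proof -
    have "\<bar>differential M f (\<gamma> 0) (V 0)\<bar> \<le> dual_norm M F (\<gamma> 0) (differential M f (\<gamma> 0)) * r"
      unfolding r_def by (intro dual_norm_bound inC covector_differential[OF f] V) auto
    also have "\<dots> \<le> b * r" by (rule mult_right_mono[OF le rn])
    finally show ?thesis by simp
  qed
  ultimately have *: "r - r / (1 + r) \<le> b * r" by simp
  have "r \<le> b / (1 - b)"
  proof (cases "r = 0")
    case False
    then have r: "0 < r" using rn by simp
    have "r - r / (1 + r) = r * (r / (1 + r))" using r by (simp add: field_simps)
    then have "r * (r / (1 + r)) \<le> r * b" using * by (simp add: mult.commute)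
    then have "r / (1 + r) \<le> b" using r by (simp only: mult_le_cancel_left_pos)
    then have "r * (1 - b) \<le> b" using r by (simp add: pos_divide_le_eq algebra_simps)
    then show ?thesis using b by (simp add: pos_le_divide_eq)
  qed (use b0 b in simp)
  then show ?thesis by (simp add: r_def V_def)
qed

end


section \<open>Barriers\<close>

locale barrier_mfd = self_concordant_mfd M C F
  for M :: "('m::{t2_space,second_countable_topology}, 'e::euclidean_space) affine_manifold"
    and C :: "'m set" and F :: "'m \<Rightarrow> real" +
  fixes \<nu> :: real
  assumes nu_pos: "0 < \<nu>"
    and barrier: "x \<in> C \<Longrightarrow> u \<in> tangent_space M x \<Longrightarrow> (differential M F x u)\<^sup>2 \<le> \<nu> * Hess M F x u u"
begin

lemma covector_DF: "x \<in> C \<Longrightarrow> covector x (differential M F x)"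
  by (rule covector_differential[OF F_C2])

lemma dual_norm_DF_le:
  assumes x: "x \<in> C"
  shows "dual_norm M F x (differential M F x) \<le> sqrt \<nu>"
proof (rule dual_norm_le[OF x covector_DF[OF x]])
  fix v assume v: "v \<in> tangent_space M x"
  have "\<bar>differential M F x v\<bar> = sqrt ((differential M F x v)\<^sup>2)" by simp
  also have "\<dots> \<le> sqrt (\<nu> * H x v v)" using barrier[OF x v] by (rule real_sqrt_le_mono)
  finally show "\<bar>differential M F x v\<bar> \<le> sqrt \<nu> * local_norm x v"
    by (simp add: real_sqrt_mult local_norm_def)
qed (use nu_pos in simp)

text \<open>Only an initial segment of the geodesic may be known to lie in the domain, while the
  velocity is that of the whole geodesic; hence derivatives restricted to
  \<open>{0..T}\<close>.\<close>

lemma barrier_along: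
  assumes g: "geodesic M {0..1} \<gamma>" and T: "T \<le> 1" and img: "\<gamma> ` {0..T} \<subseteq> C"
    and V_def: "V = velocity M \<gamma> {0..1}" and s: "s \<in> {0..T}"
  shows "V s \<in> tangent_space M (\<gamma> s)"
    and "((\<lambda>s. F (\<gamma> s)) has_real_derivative differential M F (\<gamma> s) (V s)) (at s within {0..T})"
    and "((\<lambda>s. differential M F (\<gamma> s) (V s)) has_real_derivative H (\<gamma> s) (V s) (V s)) (at s within {0..T})"
    and "((\<lambda>s. H (\<gamma> s) (V s) (V s)) has_real_derivative nabla_Hess M F (\<gamma> s) (V s) (V s) (V s)) (at s within {0..T})"
    and "differential M F (\<gamma> 0) (V 0) \<le> differential M F (\<gamma> s) (V s)"
proof -
  have inC: "\<gamma> s \<in> C" if "s \<in> {0..T}" for s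
    using img that by blast
  have tan: "V s \<in> tangent_space M (\<gamma> s)" if "s \<in> {0..T}" for s
    unfolding V_def using that T by (intro velocity_tangent[OF g]) auto
  show "V s \<in> tangent_space M (\<gamma> s)" by (rule tan[OF s])
  have d2: "((\<lambda>s. differential M F (\<gamma> s) (V s)) has_real_derivative H (\<gamma> s) (V s) (V s)) (at s within {0..T})"
    if "s \<in> {0..T}" for s
    unfolding V_def
    by (rule derivative_restrict[OF geodesic_second_derivative[OF g _ _ F_C2 open_C inC[OF that]] T])
      (use that T in auto)
  show "((\<lambda>s. differential M F (\<gamma> s) (V s)) has_real_derivative H (\<gamma> s) (V s) (V s)) (at s within {0..T})"
    by (rule d2[OF s])
  show "((\<lambda>s. F (\<gamma> s)) has_real_derivative differential M F (\<gamma> s) (V s)) (at s within {0..T})"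
    unfolding V_def by (rule derivative_restrict[OF geodesic_chain[OF g _ _ F_C2 inC[OF s]] T]) (use s T in auto)
  show "((\<lambda>s. H (\<gamma> s) (V s) (V s)) has_real_derivative nabla_Hess M F (\<gamma> s) (V s) (V s) (V s)) (at s within {0..T})"
    unfolding V_def by (rule derivative_restrict[OF geodesic_third_derivative[OF g _ _ F_C3 open_C inC[OF s]] T]) (use s T in auto)
  show "differential M F (\<gamma> 0) (V 0) \<le> differential M F (\<gamma> s) (V s)"
  proof (rule deriv_nonneg_Icc_imp_le[where f="\<lambda>s. differential M F (\<gamma> s) (V s)" and f'="\<lambda>s. H (\<gamma> s) (V s) (V s)"])
    fix t assume t: "t \<in> {0..s}"
    then have tT: "t \<in> {0..T}" using s by auto
    show "((\<lambda>s. differential M F (\<gamma> s) (V s)) has_real_derivative H (\<gamma> t) (V t) (V t)) (at t within {0..s})"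
      by (rule has_field_derivative_subset[OF d2[OF tT]]) (use s in auto)
    show "0 \<le> H (\<gamma> t) (V t) (V t)" by (rule H_nonneg[OF inC[OF tT] tan[OF tT]])
  qed (use s in simp)
qed

text \<open>The slope p of \<open>F\<close> satisfies p' \<ge> p^2 / \<nu>. If p exceeded \<nu> at 0
  it would stay positive, and -1/p would grow by at least 1/\<nu> in unit time while remaining
  negative, so p at 0 would be less than \<nu>.\<close>

lemma barrier_semibounded:
  assumes g: "geodesic M {0..1} \<gamma>" and inC: "\<And>s. s \<in> {0..1} \<Longrightarrow> \<gamma> s \<in> C"
  shows "differential M F (\<gamma> 0) (velocity M \<gamma> {0..1} 0) \<le> \<nu>"
proof (rule ccontr)
  define V where "V = velocity M \<gamma> {0..1}"
  define p where "p s = differential M F (\<gamma> s) (V s)" for s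
  assume "\<not> ?thesis"
  then have p0: "\<nu> < p 0" by (simp add: p_def V_def)
  have "\<gamma> ` {0..1} \<subseteq> C" using inC by blast
  note A = barrier_along[OF g order_refl this V_def]
  have pp: "0 < p s" if "s \<in> {0..1}" for s
    using A(5)[OF that] p0 nu_pos unfolding p_def by linarith
  have "1 / \<nu> * 1 - 1 / \<nu> * 0 \<le> - inverse (p 1) - - inverse (p 0)"
  proof (rule deriv_le_Icc_imp_diff_le[where f="\<lambda>s. 1 / \<nu> * s" and g="\<lambda>s. - inverse (p s)" and f'="\<lambda>_. 1 / \<nu>"
        and g'="\<lambda>s. H (\<gamma> s) (V s) (V s) / (p s)\<^sup>2"])
    fix s :: real assume s: "s \<in> {0..1}"
    have "((\<lambda>s. - inverse (p s)) has_real_derivative - (- (inverse (p s) * H (\<gamma> s) (V s) (V s) * inverse (p s)))) (at s within {0..1})"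
      unfolding p_def by (intro DERIV_minus DERIV_inverse' A(3)[OF s]) (use pp[OF s] in \<open>simp add: p_def\<close>)
    then show "((\<lambda>s. - inverse (p s)) has_real_derivative H (\<gamma> s) (V s) (V s) / (p s)\<^sup>2) (at s within {0..1})"
      by (simp add: power2_eq_square field_simps)
    have "(p s)\<^sup>2 \<le> \<nu> * H (\<gamma> s) (V s) (V s)"
      unfolding p_def by (rule barrier[OF inC[OF s] A(1)[OF s]])
    then show "1 / \<nu> \<le> H (\<gamma> s) (V s) (V s) / (p s)\<^sup>2"
      using nu_pos pp[OF s] by (simp add: field_simps)
  qed (use nu_pos in \<open>auto intro!: derivative_eq_intros\<close>)
  then have "1 / \<nu> \<le> inverse (p 0) - inverse (p 1)" by simp
  also have "\<dots> < inverse (p 0)" using pp[of 1] by simp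
  finally have "p 0 < \<nu>" using nu_pos pp[of 0] by (simp add: field_simps)
  then show False using p0 by simp
qed

section \<open>The barrier parameter is at least one\<close>

lemma nonzero_tangent: obtains v where "v \<in> tangent_space M x" "v \<noteq> (\<lambda>c. 0)"
proof -
  have "coord_field M (chart_at M x) (SOME b. b \<in> Basis) x \<noteq> (\<lambda>c. 0)"
    using coord_field_self[OF chart_at, of x "SOME b. b \<in> Basis"] SOME_Basis nonzero_Basis by metis
  then show ?thesis using that coord_field_tangent[OF chart_at] by blast
qed

text \<open>If the slope of \<open>F\<close> vanished on a whole segment of a nonconstant geodesic,
  so would its derivative, which is the Hessian at a nonzero vector.\<close>

lemma DF_not_identically_zero:
  assumes "C \<noteq> {}"
  obtains x v where "x \<in> C" "v \<in> tangent_space M x" "differential M F x v \<noteq> 0"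
proof -
  obtain x where x: "x \<in> C" using assms by blast
  obtain v where v: "v \<in> tangent_space M x" "v \<noteq> (\<lambda>c. 0)" using nonzero_tangent .
  obtain \<gamma> where g: "geodesic M {0..1} \<gamma>" "\<gamma> 0 = x" "velocity M \<gamma> {0..1} 0 = v"
    using geodesic_exp[OF v(1)] by metis
  obtain d where d: "0 < d" "\<And>s. s \<in> {0..1} \<Longrightarrow> dist s 0 < d \<Longrightarrow> \<gamma> s \<in> C"
    using geodesic_near[OF g(1), of 0 C] open_C x g(2) by auto
  define T where "T = min (d / 2) 1"
  have T: "0 < T" "T \<le> 1" "T < d" using d(1) by (auto simp: T_def)
  have inC: "\<gamma> s \<in> C" if "s \<in> {0..T}" for s
    using that T by (intro d(2)) auto
  define V where "V = velocity M \<gamma> {0..1}"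
  have "\<gamma> ` {0..T} \<subseteq> C" using inC by blast
  note A = barrier_along[OF g(1) T(2) this V_def]
  have "\<exists>s\<in>{0..T}. differential M F (\<gamma> s) (V s) \<noteq> 0"
  proof (rule ccontr)
    assume "\<not> ?thesis"
    then have z: "differential M F (\<gamma> s) (V s) = 0" if "s \<in> {0..T}" for s using that by blast
    have 0: "0 \<in> {0..T}" using T by simp
    have "((\<lambda>s. 0) has_real_derivative H (\<gamma> 0) (V 0) (V 0)) (at 0 within {0..T})"
      by (rule has_real_derivative_transform_Icc[OF A(3)[OF 0] zero_less_one 0]) (use z in auto)
    then have "H (\<gamma> 0) (V 0) (V 0) = 0"
      using has_vector_derivative_unique_Icc[OF T(1) 0, of "\<lambda>s. 0::real" "H (\<gamma> 0) (V 0) (V 0)" 0]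
      by (simp add: has_real_derivative_iff_has_vector_derivative)
    then show False using H_pos[OF x v] g by (simp add: V_def)
  qed
  then show ?thesis using that inC A(1) by blast
qed

text \<open>Geodesics with any initial velocity exist for unit time, so a vector on which the
  differential is nonzero can be rescaled until the slope is \<nu> + 1.\<close>

lemma geodesic_unbounded_slope:
  assumes "C \<noteq> {}"
  obtains \<gamma> where "geodesic M {0..1} \<gamma>" "\<gamma> 0 \<in> C" "differential M F (\<gamma> 0) (velocity M \<gamma> {0..1} 0) > \<nu>"
proof -
  obtain x v where x: "x \<in> C" and v: "v \<in> tangent_space M x" and D: "differential M F x v \<noteq> 0"
    using DF_not_identically_zero[OF assms] .
  define k where "k = (\<nu> + 1) / differential M F x v"
  have "differential M F x (\<lambda>c. k *\<^sub>R v c + 0 *\<^sub>R v c) = k * differential M F x v + 0 * differential M F x v"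
    by (rule covectorD[OF covector_DF[OF x] v v])
  also have "\<dots> = \<nu> + 1" using D by (simp add: k_def)
  finally have "differential M F x (\<lambda>c. k *\<^sub>R v c) > \<nu>" by simp
  moreover obtain \<gamma> where "geodesic M {0..1} \<gamma>" "\<gamma> 0 = x" "velocity M \<gamma> {0..1} 0 = (\<lambda>c. k *\<^sub>R v c)"
    using geodesic_exp[OF tangent_scaleR[OF v]] by metis
  ultimately show ?thesis using that[of \<gamma>] x by simp
qed

text \<open>If \<open>\<nu> < 1\<close>, then \<open>\<psi> = (F\<circ>\<gamma>)'\<^sup>2 / (F\<circ>\<gamma>)''\<close> grows at least like a multiple of \<open>F\<circ>\<gamma>\<close> while
  \<open>\<psi> \<le> \<nu>\<close>, so \<open>F\<close> stays bounded on every geodesic on which it increases, and such a geodesic never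
  leaves the domain. This contradicts semiboundedness for long geodesics.\<close>

lemma nu_ge_1:
  assumes "C \<noteq> {}"
  shows "1 \<le> \<nu>"
proof (rule ccontr)
  assume "\<not> 1 \<le> \<nu>"
  then have nu: "\<nu> < 1" by simp
  \<comment> \<open>The derivative of \<psi> is 2 p - p^2 q' / q^2. Self-concordance together with p
    \<le> sqrt \<nu> sqrt q bounds the subtracted term by 2 p sqrt \<nu>, and the remaining k p is a
    positive multiple of the slope of \<open>F\<close>.\<close>
  define k where "k = 2 * (1 - sqrt \<nu>)"
  have k: "0 < k" using nu by (simp add: k_def)
  obtain \<gamma> where g: "geodesic M {0..1} \<gamma>" and g0: "\<gamma> 0 \<in> C"
    and slope: "differential M F (\<gamma> 0) (velocity M \<gamma> {0..1} 0) > \<nu>"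
    using geodesic_unbounded_slope[OF assms] .
  define V where "V = velocity M \<gamma> {0..1}"
  have "\<gamma> s \<in> C" if s: "s \<in> {0..1}" for s
  proof (rule geodesic_stays[OF g g0 _ s])
    fix T assume T: "T \<in> {0..1::real}" and inC: "\<And>s. s \<in> {0..T} \<Longrightarrow> \<gamma> s \<in> C"
    have T1: "T \<le> 1" using T by simp
    have "\<gamma> ` {0..T} \<subseteq> C" using inC by blast
    note A = barrier_along[OF g T1 this V_def]
    define p where "p s = differential M F (\<gamma> s) (V s)" for s
    define q where "q s = H (\<gamma> s) (V s) (V s)" for s
    define q' where "q' s = nabla_Hess M F (\<gamma> s) (V s) (V s) (V s)" for s
    have p: "0 < p s" if "s \<in> {0..T}" for s
      using A(5)[OF that] slope nu_pos unfolding p_def V_def by linarith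
    have pq: "(p s)\<^sup>2 \<le> \<nu> * q s" if "s \<in> {0..T}" for s
      unfolding p_def q_def by (rule barrier[OF inC[OF that] A(1)[OF that]])
    have q: "0 < q s" if "s \<in> {0..T}" for s
    proof -
      have "0 < \<nu> * q s" using p[OF that] pq[OF that] by (meson less_le_trans zero_less_power)
      then show ?thesis using nu_pos by (simp add: zero_less_mult_iff)
    qed
    define \<psi> where "\<psi> s = (p s)\<^sup>2 / q s" for s
    have psi_le: "\<psi> s \<le> \<nu>" if "s \<in> {0..T}" for s
      using pq[OF that] q[OF that] by (simp add: \<psi>_def pos_divide_le_eq)
    have dp: "(p has_real_derivative q s) (at s within {0..T})"
      and dq: "(q has_real_derivative q' s) (at s within {0..T})" if "s \<in> {0..T}" for s
      unfolding p_def q_def q'_def using A(3,4)[OF that] by auto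
    have q'_le: "q' s \<le> 2 * sqrt (q s) * q s" if "s \<in> {0..T}" for s
      using nabla_H_bound[OF inC[OF that] A(1)[OF that] A(1)[OF that] A(1)[OF that]] q[OF that]
      unfolding q'_def q_def local_norm_def by (simp add: abs_le_iff)
    have "k * F (\<gamma> T) - k * F (\<gamma> 0) \<le> \<psi> T - \<psi> 0"
    proof (rule deriv_le_Icc_imp_diff_le[where f="\<lambda>s. k * F (\<gamma> s)" and f'="\<lambda>s. k * p s" and g=\<psi>
          and g'="\<lambda>s. 2 * p s - (p s)\<^sup>2 * q' s / (q s)\<^sup>2"])
      fix s assume s: "s \<in> {0..T}"
      show "((\<lambda>s. k * F (\<gamma> s)) has_real_derivative k * p s) (at s within {0..T})"
        unfolding p_def by (rule DERIV_cmult[OF A(2)[OF s]])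
      have "(\<psi> has_real_derivative ((2 * (p s * q s)) * q s - (p s)\<^sup>2 * q' s) / (q s * q s)) (at s within {0..T})"
        unfolding \<psi>_def
      proof (rule DERIV_divide[OF _ dq[OF s]])
        show "((\<lambda>s. (p s)\<^sup>2) has_real_derivative 2 * (p s * q s)) (at s within {0..T})"
          using DERIV_power[OF dp[OF s], of 2] by (simp add: ac_simps)
        show "q s \<noteq> 0" using q[OF s] by simp
      qed
      moreover have "((2 * (p s * q s)) * q s - (p s)\<^sup>2 * q' s) / (q s * q s) = 2 * p s - (p s)\<^sup>2 * q' s / (q s)\<^sup>2"
        using q[OF s] by (simp add: field_simps power2_eq_square)
      ultimately show "(\<psi> has_real_derivative 2 * p s - (p s)\<^sup>2 * q' s / (q s)\<^sup>2) (at s within {0..T})"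
        by simp
      define z where "z = sqrt (q s)"
      have z: "0 < z" "q s = z * z" using q[OF s] by (auto simp: z_def)
      have "(p s)\<^sup>2 \<le> (sqrt \<nu> * z)\<^sup>2"
        using pq[OF s] nu_pos by (simp add: power_mult_distrib z(2) power2_eq_square[of z])
      then have pz: "p s \<le> sqrt \<nu> * z"
        by (rule power2_le_imp_le) (use nu_pos z(1) in simp)
      have "(p s)\<^sup>2 * q' s / (q s)\<^sup>2 \<le> (p s)\<^sup>2 * (2 * z * q s) / (q s)\<^sup>2"
        using q'_le[OF s] by (intro divide_right_mono mult_left_mono) (auto simp: z_def)
      also have "\<dots> = 2 * p s * (p s / z)"
        unfolding z(2) using z(1) by (simp add: field_simps power2_eq_square)
      also have "\<dots> \<le> 2 * p s * sqrt \<nu>"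
        using pz p[OF s] z(1) by (intro mult_left_mono) (auto simp: pos_divide_le_eq)
      finally show "k * p s \<le> 2 * p s - (p s)\<^sup>2 * q' s / (q s)\<^sup>2"
        by (simp add: k_def algebra_simps)
    qed (use T in simp)
    moreover have "\<psi> T \<le> \<nu>" using psi_le T by simp
    moreover have "0 \<le> \<psi> 0" unfolding \<psi>_def using q[of 0] T by simp
    ultimately have "k * (F (\<gamma> T) - F (\<gamma> 0)) \<le> \<nu>" by (simp add: algebra_simps)
    then have "F (\<gamma> T) - F (\<gamma> 0) \<le> \<nu> / k" using k by (simp add: pos_le_divide_eq mult.commute)
    then show "F (\<gamma> T) \<le> F (\<gamma> 0) + \<nu> / k" by simp
  qed
  then show False using barrier_semibounded[OF g] slope by force
qed

end

section \<open>Path following\<close>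

text \<open>Pure arithmetic: \<open>n\<close> steps of geometric growth follow one initial step that
  brings t from 0 to \<alpha> / L, which is why the bound concerns \<open>Suc n\<close>.\<close>

lemma path_iteration_count:
  fixes \<alpha> \<beta> \<nu> L \<epsilon> :: real
  assumes a: "\<alpha> = path_alpha \<beta>" "0 < \<alpha>" "\<alpha> + \<beta> < 1" and b: "0 < \<beta>" and nu: "1 \<le> \<nu>" and L: "0 < L" and e: "0 < \<epsilon>"
  obtains n where "real (Suc n) \<le> path_const \<beta> * sqrt \<nu> * max 1 (ln (\<nu> * L / \<epsilon>))"
    "\<And>\<tau>. (1 + \<alpha> / (\<beta> + sqrt \<nu>)) ^ n * (\<alpha> / L) \<le> \<tau> \<Longrightarrow>
      1 / \<tau> * (\<nu> + (\<beta> + sqrt \<nu>) * \<beta> / (1 - \<beta>)) \<le> \<epsilon>"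
proof -
  define s where "s = sqrt \<nu>"
  have s: "1 \<le> s" "s * s = \<nu>" using nu by (auto simp: s_def)
  have b1: "0 < 1 - \<beta>" "\<alpha> < 1" using a b by auto
  \<comment> \<open>Chosen so that \<nu> \<alpha> K = \<nu> (1 + \<beta>^2) / (1 - \<beta>), an
    upper bound for the numerator of the gap estimate.\<close>
  define K where "K = (1 + \<beta>\<^sup>2) / ((1 - \<beta>) * \<alpha>)"
  have K: "1 \<le> K"
  proof -
    have "(1 - \<beta>) * \<alpha> \<le> 1 * 1" using a b b1 by (intro mult_mono) auto
    also have "1 * 1 \<le> 1 + \<beta>\<^sup>2" by simp
    finally show ?thesis using b1 a by (simp add: K_def)
  qed
  define m where "m = max 1 (ln (\<nu> * L / \<epsilon>))"
  \<comment> \<open>Logarithm of the factor \<nu> L K / \<epsilon> by which t has to exceed its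
    first positive value \<alpha> / L.\<close>
  define X where "X = ln (\<nu> * L / \<epsilon>) + ln K"
  define Y where "Y = 2 / \<alpha> * (1 + ln K) * s * m"
  have lnK: "0 \<le> ln K" using K by simp
  have m: "1 \<le> m" "ln (\<nu> * L / \<epsilon>) \<le> m" by (auto simp: m_def)
  have "X \<le> m * (1 + ln K)"
    using m lnK mult_right_mono[OF m(1) lnK] by (simp add: X_def algebra_simps)
  then have "2 * s / \<alpha> * X \<le> 2 * s / \<alpha> * (m * (1 + ln K))"
    using s a by (intro mult_left_mono) auto
  then have XY: "2 * s / \<alpha> * X \<le> Y" by (simp add: Y_def ac_simps)
  have Y0: "0 \<le> Y" using s m lnK a by (simp add: Y_def)
  \<comment> \<open>The maximum with 0 covers a starting point whose first step is already good
    enough, where \<open>X\<close> is negative.\<close>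
  define n where "n = nat \<lceil>max 0 (2 * s / \<alpha> * X)\<rceil>"
  have n1: "2 * s / \<alpha> * X \<le> real n"
    unfolding n_def by (rule order_trans[OF _ real_nat_ceiling_ge]) simp
  have "real n \<le> max 0 (2 * s / \<alpha> * X) + 1"
    unfolding n_def by (simp add: of_nat_nat)
  then have n2: "real n \<le> Y + 1" using XY Y0 by simp
  \<comment> \<open>One unit from the ceiling and one from \<open>Suc\<close> are absorbed by 2 s m,
    the origin of the summand 2 in \<open>path_const\<close>.\<close>
  have "1 * 1 \<le> s * m" using s m by (intro mult_mono) auto
  then have "real (Suc n) \<le> 2 * (s * m) + Y" using n2 by simp
  also have "\<dots> = path_const \<beta> * sqrt \<nu> * max 1 (ln (\<nu> * L / \<epsilon>))"
    unfolding path_const_def a(1)[symmetric] K_def[symmetric] m_def[symmetric] s_def[symmetric] Y_def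
    by (simp add: algebra_simps)
  finally have 1: "real (Suc n) \<le> path_const \<beta> * sqrt \<nu> * max 1 (ln (\<nu> * L / \<epsilon>))" .
  define d where "d = \<alpha> / (\<beta> + s)"
  have bs: "0 < \<beta> + s" using b s by simp
  have d: "0 < d" using a bs by (simp add: d_def)
  \<comment> \<open>The elementary bound ln y \<le> y - 1 at y = 1 / (1 + d) gives ln (1 + d) \<ge>
    \<alpha> / (\<alpha> + \<beta> + s), and \<alpha> + \<beta> < 1 \<le> s simplifies the
    denominator to 2 s.\<close>
  have "ln (1 / (1 + d)) \<le> 1 / (1 + d) - 1" using d by (intro ln_le_minus_one) simp
  then have "1 - 1 / (1 + d) \<le> ln (1 + d)" using d by (simp add: ln_div)
  moreover have "1 - 1 / (1 + d) = \<alpha> / (\<alpha> + \<beta> + s)"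
    using bs a by (simp add: d_def field_simps)
  moreover have "\<alpha> / (2 * s) \<le> \<alpha> / (\<alpha> + \<beta> + s)"
    using a b s by (intro divide_left_mono) auto
  ultimately have ln: "\<alpha> / (2 * s) \<le> ln (1 + d)" by simp
  have "X = (2 * s / \<alpha> * X) * (\<alpha> / (2 * s))" using s a by simp
  also have "\<dots> \<le> real n * (\<alpha> / (2 * s))" using n1 a s by (intro mult_right_mono) auto
  also have "\<dots> \<le> real n * ln (1 + d)" by (intro mult_left_mono ln) simp
  finally have "exp X \<le> exp (real n * ln (1 + d))" by simp
  also have "\<dots> = (1 + d) ^ n" using d by (simp add: exp_of_nat_mult)
  finally have pow: "\<nu> * L / \<epsilon> * K \<le> (1 + d) ^ n"
    using nu L e K by (simp add: X_def exp_add)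
  have 2: "1 / \<tau> * (\<nu> + (\<beta> + sqrt \<nu>) * \<beta> / (1 - \<beta>)) \<le> \<epsilon>"
    if tau: "(1 + \<alpha> / (\<beta> + sqrt \<nu>)) ^ n * (\<alpha> / L) \<le> \<tau>" for \<tau>
  proof -
    define G where "G = \<nu> * (1 + \<beta>\<^sup>2) / (1 - \<beta>)"
    have "\<nu> * L / \<epsilon> * K * (\<alpha> / L) \<le> \<tau>"
      using mult_right_mono[OF pow, of "\<alpha> / L"] tau a L by (simp add: d_def s_def)
    moreover have "\<nu> * L / \<epsilon> * K * (\<alpha> / L) = G / \<epsilon>"
      using L a e b1 by (simp add: G_def K_def field_simps)
    ultimately have tG: "G / \<epsilon> \<le> \<tau>" by simp
    have G0: "0 < G" using nu b1 by (simp add: G_def add_pos_nonneg)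
    have t0: "0 < \<tau>" using tG G0 e by (meson divide_pos_pos less_le_trans)
    \<comment> \<open>Both lower-order quantities are replaced by multiples of \<nu>, after which 1
      - \<beta> + (\<beta> + 1) \<beta> = 1 + \<beta>^2.\<close>
    have "s \<le> \<nu>" using s mult_right_mono[OF s(1), of s] by simp
    moreover have "\<beta> * 1 \<le> \<beta> * \<nu>" using b nu by (intro mult_left_mono) auto
    ultimately have "(\<beta> + s) * \<beta> \<le> (\<beta> * \<nu> + \<nu>) * \<beta>"
      using b by (intro mult_right_mono) linarith+
    then have "\<nu> * (1 - \<beta>) + (\<beta> + s) * \<beta> \<le> \<nu> * (1 + \<beta>\<^sup>2)"
      by (simp add: power2_eq_square algebra_simps)
    then have "(\<nu> * (1 - \<beta>) + (\<beta> + s) * \<beta>) / (1 - \<beta>) \<le> G"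
      unfolding G_def using b1 by (intro divide_right_mono) auto
    then have "\<nu> + (\<beta> + s) * \<beta> / (1 - \<beta>) \<le> G" using b1 by (simp add: add_divide_distrib)
    also have "G \<le> \<epsilon> * \<tau>" using tG e by (simp add: pos_divide_le_eq mult.commute)
    finally show ?thesis using t0 by (simp add: s_def pos_divide_le_eq)
  qed
  show ?thesis by (rule that[OF 1 2])
qed

section \<open>Polarization and minima along geodesics\<close>

context admissible_mfd
begin

lemma Hess_eq_of_diagonal:
  assumes f: "Ck_fun_on M (Suc (Suc k)) U f" and g: "Ck_fun_on M (Suc (Suc k')) U g" and U: "open U" "x \<in> U"
    and diag: "\<And>u. u \<in> tangent_space M x \<Longrightarrow> Hess M f x u u = Hess M g x u u"
    and u: "u \<in> tangent_space M x" and v: "v \<in> tangent_space M x"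
  shows "Hess M f x u v = Hess M g x u v"
proof -
  have uv: "(\<lambda>c. 1 *\<^sub>R u c + 1 *\<^sub>R v c) \<in> tangent_space M x" by (rule tangent_linear_comb[OF u v])
  have "2 * Hess M h x u v = Hess M h x (\<lambda>c. 1 *\<^sub>R u c + 1 *\<^sub>R v c) (\<lambda>c. 1 *\<^sub>R u c + 1 *\<^sub>R v c)
      - Hess M h x u u - Hess M h x v v" if h: "Ck_fun_on M (Suc (Suc j)) U h" for h j
    using Hess_linear[OF h U u v uv, of 1 1] Hess_linear[OF h U u v u, of 1 1] Hess_linear[OF h U u v v, of 1 1]
      Hess_symmetric[OF h U u uv] Hess_symmetric[OF h U v uv] Hess_symmetric[OF h U u v] by simp
  from this[OF f] this[OF g] show ?thesis
    using diag[OF uv] diag[OF u] diag[OF v] by simp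
qed

lemma geodesic_initial_segment:
  assumes U: "open U" "x \<in> U" and v: "v \<in> tangent_space M x"
  obtains \<gamma> T where "geodesic M {0..1} \<gamma>" "\<gamma> 0 = x" "velocity M \<gamma> {0..1} 0 = v" "0 < T" "T \<le> 1"
    "\<And>s. s \<in> {0..T} \<Longrightarrow> \<gamma> s \<in> U"
proof -
  obtain \<gamma> where g: "geodesic M {0..1} \<gamma>" "\<gamma> 0 = x" "velocity M \<gamma> {0..1} 0 = v"
    using geodesic_exp[OF v] by metis
  obtain d where d: "0 < d" "\<And>s. s \<in> {0..1} \<Longrightarrow> dist s 0 < d \<Longrightarrow> \<gamma> s \<in> U"
    using geodesic_near[OF g(1), of 0 U] U g(2) by auto
  show ?thesis
  proof (rule that[OF g, of "min (d / 2) 1"])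
    show "\<gamma> s \<in> U" if "s \<in> {0..min (d / 2) 1}" for s
      using that d(1) by (intro d(2)) auto
  qed (use d(1) in auto)
qed

text \<open>A geodesic on the unit interval yields only a one-sided derivative at its start, hence
  an inequality; applying it to \<open>v\<close> and to its negative gives equality.\<close>

lemma critical_of_minimum:
  assumes f: "Ck_fun_on M (Suc k) U f" and U: "open U" "z \<in> U" and min: "\<And>y. y \<in> U \<Longrightarrow> f z \<le> f y"
    and v: "v \<in> tangent_space M z"
  shows "differential M f z v = 0"
proof -
  have nonneg: "0 \<le> differential M f z w" if w: "w \<in> tangent_space M z" for w
  proof (rule ccontr)
    assume neg: "\<not> ?thesis"
    obtain \<gamma> T where g: "geodesic M {0..1} \<gamma>" "\<gamma> 0 = z" "velocity M \<gamma> {0..1} 0 = w" and T: "0 < T" "T \<le> 1"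
      and inU: "\<And>s. s \<in> {0..T} \<Longrightarrow> \<gamma> s \<in> U"
      using geodesic_initial_segment[OF U w] by blast
    have "((\<lambda>s. f (\<gamma> s)) has_real_derivative differential M f z w) (at 0 within {0..1})"
      using geodesic_chain[OF g(1) _ _ f, of 0] U g by simp
    then obtain d where d: "0 < d" "\<And>h. 0 < h \<Longrightarrow> 0 + h \<in> {0..1} \<Longrightarrow> h < d \<Longrightarrow> f (\<gamma> (0 + h)) < f (\<gamma> 0)"
      using has_real_derivative_neg_dec_right[of "\<lambda>s. f (\<gamma> s)" "differential M f z w" 0 "{0..1}"] neg by force
    define h where "h = min (d / 2) T"
    have h: "0 < h" "h < d" "h \<le> T" using d(1) T by (auto simp: h_def)
    have "f (\<gamma> h) < f z" using d(2)[of h] h T g(2) by simp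
    moreover have "f z \<le> f (\<gamma> h)" using h by (intro min inU) simp
    ultimately show False by simp
  qed
  have "differential M f z (\<lambda>c. (- 1) *\<^sub>R v c + 0 *\<^sub>R v c) = (- 1) * differential M f z v + 0 * differential M f z v"
    by (rule differential_linear[OF f U(2)])
  then show ?thesis
    using nonneg[OF v] nonneg[OF tangent_linear_comb[OF v v, of "- 1" 0]] by simp
qed

end

section \<open>The affine objective and the path functions\<close>

locale path_following = barrier_mfd M "interior Q" F \<nu>
  for M :: "('m::{t2_space,second_countable_topology}, 'e::euclidean_space) affine_manifold"
    and Q :: "'m set" and F :: "'m \<Rightarrow> real" and \<nu> :: real +
  fixes l :: "'m \<Rightarrow> real" and \<beta> :: real
  assumes compact_Q: "compact Q" and convex_Q: "geo_convex_set M Q" and nonempty: "interior Q \<noteq> {}"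
    and affine: "geo_affine_on M Q l" and nonconst: "\<not> l constant_on Q"
    and closure_interior: "closure (interior Q) = Q"
    and beta: "0 < \<beta>" "\<beta> < sqrt \<beta> / (1 + sqrt \<beta>)"
begin

abbreviation C :: "'m set" where "C \<equiv> interior Q"

abbreviation Dl :: "'m \<Rightarrow> ('m, 'e) tangent \<Rightarrow> real" where "Dl \<equiv> differential M l"

lemma l_C3: "Ck_fun_on M (Suc (Suc (Suc 0))) C l"
  using affine by (simp add: geo_affine_on_def numeral_3_eq_3)

lemma l_C2: "Ck_fun_on M (Suc (Suc 0)) C l"
  using Ck_fun_on_mono[OF _ l_C3] by simp

lemma path_fun_C2: "Ck_fun_on M (Suc (Suc 0)) C (path_fun l F t)"
proof -
  have "Ck_on (Suc (Suc 0)) (coord c ` (C \<inter> dom_of c)) (\<lambda>p. t *\<^sub>R l (coord_inv c p) + F (coord_inv c p))"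
    if c: "c \<in> atlas M" for c
    using open_coord_image[OF c open_C]
    by (intro Ck_on_add Ck_on_scaleR Ck_on_const Ck_fun_onD[OF l_C2 c] Ck_fun_onD[OF F_C2 c])
  then show ?thesis
    unfolding Ck_fun_on_def path_fun_def o_def by simp
qed

lemma differential_path_fun:
  assumes x: "x \<in> C"
  shows "differential M (path_fun l F t) x v = t * Dl x v + differential M F x v"
proof -
  let ?c = "chart_at M x"
  have c: "?c \<in> atlas M" "x \<in> dom_of ?c" using chart_at[of x] by (auto simp: charts_at_def)
  have xS: "coord ?c x \<in> coord ?c ` (C \<inter> dom_of ?c)" using c x by auto
  have "((\<lambda>p. t * l (coord_inv ?c p) + F (coord_inv ?c p)) has_derivative
      (\<lambda>v. t * fderiv (\<lambda>p. l (coord_inv ?c p)) (coord ?c x) v + fderiv (\<lambda>p. F (coord_inv ?c p)) (coord ?c x) v))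
      (at (coord ?c x))"
    by (intro has_derivative_add has_derivative_mult_right has_fderiv[OF Ck_fun_onD[OF l_C2 c(1)] xS]
        has_fderiv[OF Ck_fun_onD[OF F_C2 c(1)] xS])
  from frechet_derivative_at[OF this] show ?thesis
    by (simp add: differential_def Let_def o_def path_fun_def fun_eq_iff)
qed

lemma geodesic_in_Q: "geodesic M {0..1} \<gamma> \<Longrightarrow> \<gamma> 0 \<in> Q \<Longrightarrow> \<gamma> 1 \<in> Q \<Longrightarrow> \<gamma> ` {0..1} \<subseteq> Q"
  using convex_Q unfolding geo_convex_set_def by (meson zero_le_one)

lemma affine_along:
  assumes "a \<le> b" "geodesic M {a..b} \<gamma>" "\<gamma> ` {a..b} \<subseteq> Q"
  obtains g where "\<And>t. t \<in> {a..b} \<Longrightarrow> ((\<lambda>s. l (\<gamma> s)) has_real_derivative g t) (at t within {a..b})"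
    "\<And>t. t \<in> {a..b} \<Longrightarrow> (g has_real_derivative 0) (at t within {a..b})"
proof -
  have "\<exists>g. \<forall>t\<in>{a..b}. ((l \<circ> \<gamma>) has_real_derivative g t) (at t within {a..b}) \<and>
      (g has_real_derivative 0) (at t within {a..b})"
    using affine assms unfolding geo_affine_on_def by blast
  then show ?thesis using that unfolding o_def by blast
qed

text \<open>The derivative provided by \<open>geo_affine_on\<close> must be the differential of
  \<open>l\<close> at the velocity on any segment inside the interior, so its vanishing derivative
  is the Hessian.\<close>

lemma Hess_l_zero:
  assumes x: "x \<in> C" and u: "u \<in> tangent_space M x"
  shows "Hess M l x u u = 0"
proof -
  obtain \<gamma> T where g: "geodesic M {0..1} \<gamma>" "\<gamma> 0 = x" "velocity M \<gamma> {0..1} 0 = u" and T: "0 < T" "T \<le> 1"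
    and inC: "\<And>s. s \<in> {0..T} \<Longrightarrow> \<gamma> s \<in> C"
    using geodesic_initial_segment[OF open_C x u] by blast
  define V where "V = velocity M \<gamma> {0..1}"
  have "\<gamma> ` {0..T} \<subseteq> Q" using inC interior_subset by blast
  then obtain h where h: "\<And>t. t \<in> {0..T} \<Longrightarrow> ((\<lambda>s. l (\<gamma> s)) has_real_derivative h t) (at t within {0..T})"
    "\<And>t. t \<in> {0..T} \<Longrightarrow> (h has_real_derivative 0) (at t within {0..T})"
    using affine_along[OF _ geodesic_subinterval[OF g(1) order_refl T(2)]] T(1) by (metis less_imp_le)
  have 0: "0 \<in> {0..T}" using T by simp
  have eq: "h s = Dl (\<gamma> s) (V s)" if s: "s \<in> {0..T}" for s
  proof -
    have "((\<lambda>s. l (\<gamma> s)) has_real_derivative Dl (\<gamma> s) (V s)) (at s within {0..T})"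
      unfolding V_def by (rule derivative_restrict[OF geodesic_chain[OF g(1) _ _ l_C2 inC[OF s]] T(2)]) (use s T in auto)
    then show ?thesis
      using has_vector_derivative_unique_Icc[OF T(1) s, of "\<lambda>s. l (\<gamma> s)" "h s"] h(1)[OF s]
      by (simp add: has_real_derivative_iff_has_vector_derivative)
  qed
  have "((\<lambda>s. Dl (\<gamma> s) (V s)) has_real_derivative 0) (at 0 within {0..T})"
    by (rule has_real_derivative_transform_Icc[OF h(2)[OF 0] zero_less_one 0]) (use eq in auto)
  moreover have "((\<lambda>s. Dl (\<gamma> s) (V s)) has_real_derivative Hess M l (\<gamma> 0) (V 0) (V 0)) (at 0 within {0..T})"
    unfolding V_def by (rule derivative_restrict[OF geodesic_second_derivative[OF g(1) _ _ l_C2 open_C inC[OF 0]] T(2)]) auto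
  ultimately show ?thesis
    using has_vector_derivative_unique_Icc[OF T(1) 0, of "\<lambda>s. Dl (\<gamma> s) (V s)" 0 "Hess M l (\<gamma> 0) (V 0) (V 0)"]
    by (simp add: has_real_derivative_iff_has_vector_derivative V_def g)
qed

text \<open>On the diagonal both sides are second derivatives along one geodesic, where additivity
  of \<open>path_fun\<close> is immediate; polarization gives the rest.\<close>

lemma Hess_path_fun:
  assumes x: "x \<in> C" and u: "u \<in> tangent_space M x" and v: "v \<in> tangent_space M x"
  shows "Hess M (path_fun l F t) x u v = H x u v"
proof (rule Hess_eq_of_diagonal[OF path_fun_C2 F_C2 open_C x _ u v])
  fix w assume w: "w \<in> tangent_space M x"
  obtain \<gamma> T where g: "geodesic M {0..1} \<gamma>" "\<gamma> 0 = x" "velocity M \<gamma> {0..1} 0 = w" and T: "0 < T" "T \<le> 1"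
    and inC: "\<And>s. s \<in> {0..T} \<Longrightarrow> \<gamma> s \<in> C"
    using geodesic_initial_segment[OF open_C x w] by blast
  define V where "V = velocity M \<gamma> {0..1}"
  have 0: "0 \<in> {0..T}" using T by simp
  have D: "((\<lambda>s. differential M f (\<gamma> s) (V s)) has_real_derivative Hess M f x w w) (at 0 within {0..T})"
    if f: "Ck_fun_on M (Suc (Suc 0)) C f" for f
    using derivative_restrict[OF geodesic_second_derivative[OF g(1) _ _ f open_C inC[OF 0]] T(2)]
    by (simp add: V_def g)
  have "((\<lambda>s. t * Dl (\<gamma> s) (V s) + differential M F (\<gamma> s) (V s)) has_real_derivative t * Hess M l x w w + H x w w) (at 0 within {0..T})"
    by (intro DERIV_add DERIV_cmult D l_C2 F_C2)
  then have "((\<lambda>s. differential M (path_fun l F t) (\<gamma> s) (V s)) has_real_derivative t * Hess M l x w w + H x w w) (at 0 within {0..T})"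
    by (rule has_real_derivative_transform_Icc[OF _ zero_less_one 0]) (use inC in \<open>simp add: differential_path_fun\<close>)
  then show "Hess M (path_fun l F t) x w w = H x w w"
    using has_vector_derivative_unique_Icc[OF T(1) 0, of "\<lambda>s. differential M (path_fun l F t) (\<gamma> s) (V s)"
        "t * Hess M l x w w + H x w w" "Hess M (path_fun l F t) x w w"] D[OF path_fun_C2]
    by (simp add: has_real_derivative_iff_has_vector_derivative Hess_l_zero[OF x w])
qed

text \<open>The end point may lie on the boundary, where the differential gives no information. The
  slope of an affine function is constant along the geodesic in \<open>Q\<close>, so it can be read
  off at the interior starting point.\<close>

lemma l_increment:
  assumes g: "geodesic M {0..1} \<gamma>" and 0: "\<gamma> 0 \<in> C" and 1: "\<gamma> 1 \<in> Q"
  shows "l (\<gamma> 1) - l (\<gamma> 0) = Dl (\<gamma> 0) (velocity M \<gamma> {0..1} 0)"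
proof -
  have "\<gamma> 0 \<in> Q" using 0 interior_subset by blast
  then obtain h where h: "\<And>t. t \<in> {0..1} \<Longrightarrow> ((\<lambda>s. l (\<gamma> s)) has_real_derivative h t) (at t within {0..1})"
    "\<And>t. t \<in> {0..1} \<Longrightarrow> (h has_real_derivative 0) (at t within {0..1})"
    using affine_along[OF zero_le_one g geodesic_in_Q[OF g _ 1]] by metis
  have const: "h t = h 0" if t: "t \<in> {0..1}" for t
  proof (rule deriv_zero_Icc_imp_eq[where f=h])
    show "(h has_real_derivative 0) (at s within {0..t})" if "s \<in> {0..t}" for s
      using that t by (intro has_field_derivative_subset[OF h(2)]) auto
  qed (use t in simp)
  have "(\<lambda>s. l (\<gamma> s) - h 0 * s) 1 = (\<lambda>s. l (\<gamma> s) - h 0 * s) 0"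
  proof (rule deriv_zero_Icc_imp_eq[where f="\<lambda>s. l (\<gamma> s) - h 0 * s"])
    show "((\<lambda>s. l (\<gamma> s) - h 0 * s) has_real_derivative 0) (at t within {0..1})" if "t \<in> {0..1}" for t
      using h(1)[OF that] const[OF that] by (auto intro!: derivative_eq_intros)
  qed simp
  then have "l (\<gamma> 1) - l (\<gamma> 0) = h 0" by simp
  moreover have "h 0 = Dl (\<gamma> 0) (velocity M \<gamma> {0..1} 0)"
    using has_vector_derivative_unique_Icc[of 0 1 0 "\<lambda>s. l (\<gamma> s)" "h 0" "Dl (\<gamma> 0) (velocity M \<gamma> {0..1} 0)"]
      h(1)[of 0] geodesic_chain[OF g _ _ l_C2 0]
    by (simp add: has_real_derivative_iff_has_vector_derivative)
  ultimately show ?thesis by simp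
qed

lemma covector_Dl: "x \<in> C \<Longrightarrow> covector x (Dl x)"
  by (rule covector_differential[OF l_C2])

lemma covector_Df: "x \<in> C \<Longrightarrow> covector x (differential M (path_fun l F t) x)"
  by (rule covector_differential[OF path_fun_C2])

text \<open>This legitimates the division in \<open>t_plus\<close>. If the norm were zero,
  \<open>l\<close> would not change along the geodesics from \<open>x\<close>, and these reach all
  of \<open>Q\<close> since the exponential map is onto.\<close>

lemma dual_norm_Dl_pos:
  assumes x: "x \<in> C"
  shows "0 < dual_norm M F x (Dl x)"
proof (rule ccontr)
  assume "\<not> ?thesis"
  then have z: "dual_norm M F x (Dl x) = 0"
    using dual_norm_nonneg[OF x covector_Dl[OF x]] by simp
  have "l y = l x" if y: "y \<in> Q" for y
  proof -
    obtain \<gamma> where g: "geodesic M {0..1} \<gamma>" "\<gamma> 0 = x" "\<gamma> 1 = y" by (rule geodesic_between)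
    have "velocity M \<gamma> {0..1} 0 \<in> tangent_space M x"
      using velocity_tangent[OF g(1), of 0] g(2) by simp
    then show ?thesis
      using l_increment[OF g(1)] dual_norm_bound[OF x covector_Dl[OF x]] x y g z by simp
  qed
  then show False using nonconst by (auto simp: constant_on_def)
qed

lemma beta_less_1: "\<beta> < 1"
proof -
  have "sqrt \<beta> / (1 + sqrt \<beta>) < 1" using beta(1) by (simp add: add_pos_pos)
  then show ?thesis using beta(2) by simp
qed

lemma alpha_pos: "0 < path_alpha \<beta>"
  using beta by (simp add: path_alpha_def)

section \<open>One step of the method\<close>

lemma newton_direction_spec:
  assumes x: "x \<in> C"
  shows "newton_direction M (path_fun l F t) x \<in> tangent_space M x"
    and "v \<in> tangent_space M x \<Longrightarrow>
      differential M (path_fun l F t) x v + H x (newton_direction M (path_fun l F t) x) v = 0"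
    and "local_norm x (newton_direction M (path_fun l F t) x) \<le>
      dual_norm M F x (differential M (path_fun l F t) x)"
proof -
  let ?D = "differential M (path_fun l F t) x" and ?u = "newton_direction M (path_fun l F t) x"
  have cov: "covector x (\<lambda>v. - ?D v)"
    using covector_lincomb[OF covector_Df[OF x, of t] covector_Df[OF x, of t], of "- 1" 0] by simp
  obtain w where w: "w \<in> tangent_space M x" "\<And>v. v \<in> tangent_space M x \<Longrightarrow> H x w v = - ?D v"
    using riesz[OF x cov] by blast
  have u: "?u = w"
    unfolding newton_direction_def
  proof (rule the_equality)
    show "w \<in> tangent_space M x \<and> (\<forall>v\<in>tangent_space M x. ?D v + Hess M (path_fun l F t) x w v = 0)"
      using w Hess_path_fun[OF x w(1)] by simp
    fix w' assume w': "w' \<in> tangent_space M x \<and> (\<forall>v\<in>tangent_space M x. ?D v + Hess M (path_fun l F t) x w' v = 0)"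
    then have "\<forall>v\<in>tangent_space M x. H x w' v = - ?D v"
      using Hess_path_fun[OF x] by (metis add.commute add_eq_0_iff)
    then show "w' = w" using riesz[OF x cov] w w' by blast
  qed
  show "?u \<in> tangent_space M x" using u w by simp
  show "?D v + H x ?u v = 0" if "v \<in> tangent_space M x" for v
    using u w(2)[OF that] by simp
  have "local_norm x w * local_norm x w \<le> dual_norm M F x ?D * local_norm x w"
    using dual_norm_bound[OF x covector_Df[OF x, of t] w(1)] w(2)[OF w(1)] local_norm_sq[OF x w(1)] H_nonneg[OF x w(1)]
    by (simp add: power2_eq_square)
  then have "local_norm x w \<le> dual_norm M F x ?D"
    using local_norm_nonneg[OF x w(1)] dual_norm_nonneg[OF x covector_Df[OF x, of t]]
    by (cases "local_norm x w = 0") auto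
  then show "local_norm x ?u \<le> dual_norm M F x ?D" using u by simp
qed

lemma path_step_correct:
  assumes x: "x \<in> C" and le: "dual_norm M F x (differential M (path_fun l F t) x) \<le> \<beta>"
    and t': "t' = t_plus M l F \<beta> x t" and x': "x' = x_plus M l F \<beta> x t"
  shows "x' \<in> C" and "dual_norm M F x' (differential M (path_fun l F t') x') \<le> \<beta>"
proof -
  define L where "L = dual_norm M F x (Dl x)"
  have L: "0 < L" unfolding L_def by (rule dual_norm_Dl_pos[OF x])
  define u where "u = newton_direction M (path_fun l F t') x"
  note N = newton_direction_spec[OF x, where t=t', folded u_def]
  \<comment> \<open>The differentials at the two parameters differ by (t' - t) Dl, and t' was chosen
    such that \<open>(t' - t) * L\<close> equals \<alpha>.\<close>
  have "dual_norm M F x (differential M (path_fun l F t') x) \<le>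
      \<bar>1\<bar> * dual_norm M F x (differential M (path_fun l F t) x) + \<bar>t' - t\<bar> * L"
    unfolding L_def
    by (rule dual_norm_lincomb_le[OF x covector_Df[OF x] covector_Dl[OF x] _ covector_Df[OF x]])
      (simp add: differential_path_fun[OF x] algebra_simps)
  also have "\<dots> \<le> \<beta> + path_alpha \<beta>"
    using le L alpha_pos by (simp add: t' t_plus_def L_def[symmetric])
  also have "\<dots> = sqrt \<beta> / (1 + sqrt \<beta>)" by (simp add: path_alpha_def)
  finally have r: "local_norm x u \<le> sqrt \<beta> / (1 + sqrt \<beta>)" using N(3) by simp
  have sb: "0 < 1 + sqrt \<beta>" "sqrt \<beta> / (1 + sqrt \<beta>) < 1" using beta(1) by (auto simp: add_pos_pos)
  have r1: "local_norm x u < 1" using r sb(2) by linarith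
  \<comment> \<open>Solving the bound on the Newton direction for the ratio in
    \<open>newton_step\<close>: with r its local norm, r (1 + sqrt \<beta>) \<le> sqrt \<beta> is
    the same as r / (1 - r) \<le> sqrt \<beta>.\<close>
  have "local_norm x u * (1 + sqrt \<beta>) \<le> sqrt \<beta>" using r sb(1) by (simp add: pos_le_divide_eq)
  then have "local_norm x u \<le> sqrt \<beta> * (1 - local_norm x u)" by (simp add: algebra_simps)
  then have "local_norm x u / (1 - local_norm x u) \<le> sqrt \<beta>" using r1 by (simp add: pos_divide_le_eq)
  then have "(local_norm x u / (1 - local_norm x u))\<^sup>2 \<le> (sqrt \<beta>)\<^sup>2"
    using r1 local_norm_nonneg[OF x N(1)] by (intro power_mono) auto
  then have sq: "(local_norm x u / (1 - local_norm x u))\<^sup>2 \<le> \<beta>" using beta(1) by simp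
  have e: "x' = exp_map M x u" by (simp add: x' x_plus_def u_def t')
  show "x' \<in> C"
    unfolding e by (rule newton_step(1)[OF path_fun_C2 Hess_path_fun x N(1,2) refl r1])
  show "dual_norm M F x' (differential M (path_fun l F t') x') \<le> \<beta>"
    unfolding e by (rule order_trans[OF newton_step(2)[OF path_fun_C2 Hess_path_fun x N(1,2) refl r1] sq])
qed

text \<open>The differential of \<open>l\<close> is 1/t times the difference of those of the path
  function and of \<open>F\<close>, whose dual norms are at most \<beta> and sqrt \<nu>.\<close>

lemma dual_norm_Dl_le:
  assumes x: "x \<in> C" and t: "0 < t" and le: "dual_norm M F x (differential M (path_fun l F t) x) \<le> \<beta>"
  shows "dual_norm M F x (Dl x) \<le> 1 / t * (\<beta> + sqrt \<nu>)"
proof -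
  have "dual_norm M F x (Dl x) \<le> \<bar>1 / t\<bar> * dual_norm M F x (differential M (path_fun l F t) x)
      + \<bar>- 1 / t\<bar> * dual_norm M F x (differential M F x)"
    by (rule dual_norm_lincomb_le[OF x covector_Df[OF x] covector_DF[OF x] _ covector_Dl[OF x]])
      (use t in \<open>simp add: differential_path_fun[OF x] field_simps\<close>)
  also have "\<dots> \<le> 1 / t * \<beta> + 1 / t * sqrt \<nu>"
    using t le dual_norm_DF_le[OF x] dual_norm_nonneg[OF x covector_DF[OF x]]
      dual_norm_nonneg[OF x covector_Df[OF x]]
    by (intro add_mono mult_mono) auto
  finally show ?thesis by (simp add: algebra_simps)
qed

lemma t_plus_growth:
  assumes x: "x \<in> C" and t: "0 < t" and le: "dual_norm M F x (differential M (path_fun l F t) x) \<le> \<beta>"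
  shows "(1 + path_alpha \<beta> / (\<beta> + sqrt \<nu>)) * t \<le> t_plus M l F \<beta> x t"
proof -
  have p: "0 < \<beta> + sqrt \<nu>" using beta(1) nu_pos by (simp add: add_pos_pos)
  have "path_alpha \<beta> / (1 / t * (\<beta> + sqrt \<nu>)) \<le> path_alpha \<beta> / dual_norm M F x (Dl x)"
    using dual_norm_Dl_le[OF assms] dual_norm_Dl_pos[OF x] alpha_pos p t
    by (intro divide_left_mono) auto
  moreover have "path_alpha \<beta> / (1 / t * (\<beta> + sqrt \<nu>)) = path_alpha \<beta> / (\<beta> + sqrt \<nu>) * t"
    using t p by (simp add: field_simps)
  ultimately show ?thesis by (simp add: t_plus_def algebra_simps)
qed

text \<open>The path function lives only on the open interior, so compactness of \<open>Q\<close>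
  alone gives no minimizer. A sublevel set of \<open>F\<close> is closed in the manifold and
  contained in \<open>Q\<close>, hence compact.\<close>

lemma central_point:
  assumes t: "0 \<le> t"
  obtains z where "z \<in> C" "\<And>v. v \<in> tangent_space M z \<Longrightarrow> differential M (path_fun l F t) z v = 0"
proof -
  have lcont: "continuous_on Q l" using affine by (simp add: geo_affine_on_def)
  obtain q where q: "q \<in> Q" "\<And>y. y \<in> Q \<Longrightarrow> l q \<le> l y"
    using continuous_attains_inf[OF compact_Q _ lcont] nonempty interior_subset by blast
  obtain x0 where x0: "x0 \<in> C" using nonempty by blast
  \<comment> \<open>If F y exceeds \<open>b\<close>, then since t l y is at least t l q, the path
    function at y is at least its value at \<open>x0\<close>. Minimising over the sublevel set at
    height \<open>b\<close> is therefore enough.\<close>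
  define b where "b = path_fun l F t x0 - t * l q"
  define S where "S = {x \<in> C. F x \<le> b}"
  have "S = Q \<inter> S" using interior_subset by (auto simp: S_def)
  then have "compact S"
    using compact_Int_closed[OF compact_Q closed_sublevel[of b]] unfolding S_def by simp
  moreover have "x0 \<in> S"
    using x0 t q(2)[of x0] interior_subset mult_left_mono[of "l q" "l x0" t]
    by (auto simp: S_def b_def path_fun_def)
  moreover have "continuous_on S (path_fun l F t)"
    by (rule continuous_on_subset[OF Ck_fun_on_continuous[OF path_fun_C2 open_C]]) (auto simp: S_def)
  ultimately obtain z where z: "z \<in> S" "\<And>y. y \<in> S \<Longrightarrow> path_fun l F t z \<le> path_fun l F t y"
    using continuous_attains_inf[of S "path_fun l F t"] by blast
  have "path_fun l F t z \<le> path_fun l F t y" if y: "y \<in> C" for y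
  proof (cases "y \<in> S")
    case False
    have yQ: "y \<in> Q" using y interior_subset by blast
    have "t * l q \<le> t * l y" by (rule mult_left_mono[OF q(2)[OF yQ] t])
    then have "path_fun l F t x0 \<le> path_fun l F t y"
      using False y by (simp add: S_def b_def path_fun_def)
    then show ?thesis using z(2)[OF \<open>x0 \<in> S\<close>] by simp
  qed (rule z(2))
  then show ?thesis
    using that[of z] critical_of_minimum[OF path_fun_C2 open_C] z(1) by (auto simp: S_def)
qed

lemma gap_interior:
  assumes x: "x \<in> C" and t: "0 < t" and le: "dual_norm M F x (differential M (path_fun l F t) x) \<le> \<beta>"
    and y: "y \<in> C"
  shows "l x - l y \<le> 1 / t * (\<nu> + (\<beta> + sqrt \<nu>) * \<beta> / (1 - \<beta>))"
proof -
  obtain z where z: "z \<in> C" "\<And>v. v \<in> tangent_space M z \<Longrightarrow> differential M (path_fun l F t) z v = 0"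
    using central_point[of t] t by (metis less_imp_le)
  \<comment> \<open>The first part of the gap is the pairing of Dl with the initial velocity of the
    geodesic from x to the minimizer, estimated by the dual norm of Dl times
    \<open>distance_to_critical_point\<close>.\<close>
  have "l x - l z \<le> 1 / t * (\<beta> + sqrt \<nu>) * (\<beta> / (1 - \<beta>))"
  proof -
    obtain \<gamma> where g: "geodesic M {0..1} \<gamma>" "\<gamma> 0 = x" "\<gamma> 1 = z" by (rule geodesic_between)
    have inC: "\<gamma> s \<in> C" if "s \<in> {0..1}" for s
      using convex_C[OF g(1) _ _ that] g x z by simp
    define v where "v = velocity M \<gamma> {0..1} 0"
    have v: "v \<in> tangent_space M x" using velocity_tangent[OF g(1), of 0] g(2) by (simp add: v_def)
    have r: "local_norm x v \<le> \<beta> / (1 - \<beta>)"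
      using distance_to_critical_point[OF path_fun_C2 Hess_path_fun g(1) inC, of t \<beta>] z(2) le beta_less_1
      by (simp add: g v_def)
    have "l z - l x = Dl x v"
      using l_increment[OF g(1)] g x z(1) interior_subset by (auto simp: v_def)
    then have "l x - l z \<le> dual_norm M F x (Dl x) * local_norm x v"
      using dual_norm_bound[OF x covector_Dl[OF x] v] by simp
    also have "\<dots> \<le> 1 / t * (\<beta> + sqrt \<nu>) * (\<beta> / (1 - \<beta>))"
      using dual_norm_Dl_le[OF x t le] r local_norm_nonneg[OF x v] beta(1) nu_pos t by (intro mult_mono) auto
    finally show ?thesis .
  qed
  \<comment> \<open>At the minimizer t Dl = -DF, so t times this decrease of \<open>l\<close> is the
    slope of \<open>F\<close> towards y.\<close>
  moreover have "l z - l y \<le> 1 / t * \<nu>"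
  proof -
    obtain \<gamma> where g: "geodesic M {0..1} \<gamma>" "\<gamma> 0 = z" "\<gamma> 1 = y" by (rule geodesic_between)
    have inC: "\<gamma> s \<in> C" if "s \<in> {0..1}" for s
      using convex_C[OF g(1) _ _ that] g y z by simp
    define v where "v = velocity M \<gamma> {0..1} 0"
    have v: "v \<in> tangent_space M z" using velocity_tangent[OF g(1), of 0] g(2) by (simp add: v_def)
    have "l y - l z = Dl z v"
      using l_increment[OF g(1)] g z(1) y interior_subset by (auto simp: v_def)
    moreover have "t * Dl z v + differential M F z v = 0"
      using z(2)[OF v] differential_path_fun[OF z(1)] by simp
    moreover have "differential M F z v \<le> \<nu>"
      using barrier_semibounded[OF g(1) inC] by (simp add: g v_def)
    ultimately have "t * (l z - l y) \<le> \<nu>" by (simp add: algebra_simps)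
    then show ?thesis using t by (simp add: field_simps)
  qed
  ultimately have "l x - l y \<le> 1 / t * \<nu> + 1 / t * (\<beta> + sqrt \<nu>) * (\<beta> / (1 - \<beta>))" by simp
  also have "k * \<nu> + k * a * b = k * (\<nu> + a * b)" for k a b :: real
    by (simp add: algebra_simps)
  finally show ?thesis by (simp only: times_divide_eq_right)
qed

text \<open>The minimum of \<open>l\<close> may be attained on the boundary, where \<open>F\<close>
  is not controlled; since \<open>Q\<close> is the closure of its interior, the bound extends by
  continuity of \<open>l\<close>.\<close>

lemma gap:
  assumes x: "x \<in> C" and t: "0 < t" and le: "dual_norm M F x (differential M (path_fun l F t) x) \<le> \<beta>"
    and y: "y \<in> Q"
  shows "l x - l y \<le> 1 / t * (\<nu> + (\<beta> + sqrt \<nu>) * \<beta> / (1 - \<beta>))"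
proof -
  let ?K = "1 / t * (\<nu> + (\<beta> + sqrt \<nu>) * \<beta> / (1 - \<beta>))"
  have "continuous_on (closure C) l"
    using affine by (simp add: closure_interior geo_affine_on_def)
  moreover have "y \<in> closure C" using y by (simp add: closure_interior)
  moreover have "l x - ?K \<le> l w" if "w \<in> C" for w
    using gap_interior[OF x t le that] by simp
  ultimately have "l x - ?K \<le> l y"
    by (rule continuous_ge_on_closure)
  then show ?thesis by simp
qed

text \<open>The growth factor applies only once t is positive, so the invariant starts after the
  first step, whose gain is exactly \<open>path_alpha \<beta> / L\<close>.\<close>

lemma path_iterates:
  assumes x0: "x0 \<in> C" and le: "dual_norm M F x0 (differential M F x0) \<le> \<beta>"
    and L: "L = dual_norm M F x0 (Dl x0)"
  shows "case (path_step M l F \<beta> ^^ Suc n) (x0, 0) of (x, t) \<Rightarrow> x \<in> C \<and>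
    (1 + path_alpha \<beta> / (\<beta> + sqrt \<nu>)) ^ n * (path_alpha \<beta> / L) \<le> t \<and>
    dual_norm M F x (differential M (path_fun l F t) x) \<le> \<beta>"
proof (induction n)
  case 0
  have "path_fun l F 0 = F" by (simp add: path_fun_def)
  then have "dual_norm M F x0 (differential M (path_fun l F 0) x0) \<le> \<beta>" using le by simp
  from path_step_correct[OF x0 this refl refl] show ?case
    by (simp add: path_step_def t_plus_def L)
next
  case (Suc n)
  obtain x t where xt: "(path_step M l F \<beta> ^^ Suc n) (x0, 0) = (x, t)" by fastforce
  define q where "q = 1 + path_alpha \<beta> / (\<beta> + sqrt \<nu>)"
  have q: "1 \<le> q" using alpha_pos beta(1) nu_pos by (simp add: q_def)
  have IH: "x \<in> C" "q ^ n * (path_alpha \<beta> / L) \<le> t"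
    "dual_norm M F x (differential M (path_fun l F t) x) \<le> \<beta>"
    using Suc.IH unfolding xt by (simp_all add: q_def)
  have "0 < q ^ n * (path_alpha \<beta> / L)"
    using q alpha_pos dual_norm_Dl_pos[OF x0] by (simp add: L)
  then have t: "0 < t" using IH(2) by linarith
  have "q ^ Suc n * (path_alpha \<beta> / L) = q * (q ^ n * (path_alpha \<beta> / L))" by simp
  also have "\<dots> \<le> q * t" using q IH(2) by (intro mult_left_mono) auto
  also have "\<dots> \<le> t_plus M l F \<beta> x t" unfolding q_def by (rule t_plus_growth[OF IH(1) t IH(3)])
  finally have "q ^ Suc n * (path_alpha \<beta> / L) \<le> t_plus M l F \<beta> x t" .
  moreover have "(path_step M l F \<beta> ^^ Suc (Suc n)) (x0, 0) = (x_plus M l F \<beta> x t, t_plus M l F \<beta> x t)"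
    using xt by (simp add: path_step_def)
  ultimately show ?case
    using path_step_correct[OF IH(1,3) refl refl] by (simp add: q_def)
qed

lemma path_following_complexity:
  assumes x0: "x0 \<in> C" and e: "0 < \<epsilon>" and le: "dual_norm M F x0 (differential M F x0) \<le> \<beta>"
    and y: "y \<in> Q"
  shows "\<exists>k::nat. real k \<le> path_const \<beta> * sqrt \<nu> * max 1 (ln (\<nu> * dual_norm M F x0 (Dl x0) / \<epsilon>)) \<and>
    (let x = fst ((path_step M l F \<beta> ^^ k) (x0, 0)) in x \<in> C \<and> l x - l y \<le> \<epsilon>)"
proof -
  define L where "L = dual_norm M F x0 (Dl x0)"
  have L: "0 < L" unfolding L_def by (rule dual_norm_Dl_pos[OF x0])
  have ab: "path_alpha \<beta> + \<beta> < 1" using beta(1) by (simp add: path_alpha_def add_pos_pos)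
  obtain n where n: "real (Suc n) \<le> path_const \<beta> * sqrt \<nu> * max 1 (ln (\<nu> * L / \<epsilon>))"
    "\<And>\<tau>. (1 + path_alpha \<beta> / (\<beta> + sqrt \<nu>)) ^ n * (path_alpha \<beta> / L) \<le> \<tau> \<Longrightarrow>
      1 / \<tau> * (\<nu> + (\<beta> + sqrt \<nu>) * \<beta> / (1 - \<beta>)) \<le> \<epsilon>"
    using path_iteration_count[OF refl alpha_pos ab beta(1) nu_ge_1[OF nonempty] L e] by blast
  obtain x t where xt: "(path_step M l F \<beta> ^^ Suc n) (x0, 0) = (x, t)" by fastforce
  have I: "x \<in> C" "(1 + path_alpha \<beta> / (\<beta> + sqrt \<nu>)) ^ n * (path_alpha \<beta> / L) \<le> t"
    "dual_norm M F x (differential M (path_fun l F t) x) \<le> \<beta>"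
    using path_iterates[OF x0 le L_def, of n] unfolding xt by simp_all
  have "0 < (1 + path_alpha \<beta> / (\<beta> + sqrt \<nu>)) ^ n * (path_alpha \<beta> / L)"
    using alpha_pos beta(1) nu_pos L by (simp add: add_pos_pos)
  then have t: "0 < t" using I(2) by linarith
  have "l x - l y \<le> \<epsilon>" using gap[OF I(1) t I(3) y] n(2)[OF I(2)] by simp
  then show ?thesis
    using n(1) xt I(1) unfolding L_def by (intro exI[of _ "Suc n"]) (simp del: funpow.simps)
qed

end

theorem theorem3p14:
  fixes M :: "('m::{t2_space,second_countable_topology}, 'e::euclidean_space) affine_manifold"
    and Q :: "'m set" and l F :: "'m \<Rightarrow> real" and lstar \<nu> \<beta> :: real
  assumes "admissible_manifold M"
    and "compact Q" and "geo_convex_set M Q" and "interior Q \<noteq> {}"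
    and "geo_affine_on M Q l" and "\<not> l constant_on Q"
    and "lstar \<in> l ` Q" and "\<And>y. y \<in> Q \<Longrightarrow> lstar \<le> l y"
    and "0 < \<nu>" and "sc_barrier M \<nu> Q F"
    and "0 < \<beta>" and "\<beta> < sqrt \<beta> / (1 + sqrt \<beta>)"
  shows "(\<forall>x\<in>interior Q. \<forall>t\<ge>0.
            dual_norm M F x (differential M (path_fun l F t) x) \<le> \<beta> \<longrightarrow>
            (let t' = t_plus M l F \<beta> x t; x' = x_plus M l F \<beta> x t in
               x' \<in> interior Q \<and>
               dual_norm M F x' (differential M (path_fun l F t') x') \<le> \<beta> \<and>
               (t > 0 \<longrightarrow>
                  dual_norm M F x (differential M l x) \<le> 1 / t * (\<beta> + sqrt \<nu>) \<and>
                  t' \<ge> (1 + path_alpha \<beta> / (\<beta> + sqrt \<nu>)) * t \<and>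
                  l x - lstar \<le> 1 / t * (\<nu> + (\<beta> + sqrt \<nu>) * \<beta> / (1 - \<beta>))))) \<and>
         (\<forall>x0\<in>interior Q. \<forall>\<epsilon>>0.
            dual_norm M F x0 (differential M F x0) \<le> \<beta> \<longrightarrow>
            (\<exists>k::nat.
               real k \<le> path_const \<beta> * sqrt \<nu> *
                 max 1 (ln (\<nu> * dual_norm M F x0 (differential M l x0) / \<epsilon>)) \<and>
               (let x = fst ((path_step M l F \<beta> ^^ k) (x0, 0)) in
                  x \<in> interior Q \<and> l x - lstar \<le> \<epsilon>)))"
proof -
  note adm = assms(1)[unfolded admissible_manifold_def]
  interpret path_following M Q F \<nu> l \<beta>
  proof unfold_locales
    show "smooth_manifold M" "is_connection M" "torsion_free M" using adm by blast+
    show "\<exists>\<gamma>. geodesic_from M x v \<gamma>" if "v \<in> tangent_space M x" for v x using adm that by blast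
    show "exp_map M x ` tangent_space M x = UNIV" for x using adm by blast
    show "self_concordant M 1 (interior Q) F" "closure (interior Q) = Q"
      using assms(10) by (simp_all add: sc_barrier_def)
    show "(differential M F x u)\<^sup>2 \<le> \<nu> * Hess M F x u u" if "x \<in> interior Q" "u \<in> tangent_space M x" for x u
      using assms(10) that by (simp add: sc_barrier_def)
  qed (fact assms)+
  \<comment> \<open>The minimum is attained, so the estimates against an arbitrary point of
    \<open>Q\<close> are used at a minimizer.\<close>
  obtain y where y: "y \<in> Q" "lstar = l y" using assms(7) by blast
  show ?thesis
    using path_step_correct[OF _ _ refl refl] dual_norm_Dl_le t_plus_growth gap[OF _ _ _ y(1)]
      path_following_complexity[OF _ _ _ y(1)]
    unfolding y(2) Let_def by blast
qed

end
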